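(* Let $\mathbb F_q$ have characteristic $p$, let $A\subset \mathbb F_q$, let $f\in \mathbb F_q[x]$ and let $d$ be a positive integer. (1) If $1< \deg(f)<p$, then $$|dA|\gtrsim \min \Big(\frac{q|A|}{|f(A)+A|},\ |A|\cdot\Big(\frac{|A|^{3}}{q|f(A)+A|}\Big)^{d-1}\Big),\qquad |df(A)|\gtrsim \min\Big(\frac{q|A|}{|A+A|},\ |A|\cdot\Big(\frac{|A|^{3}}{q|A+A|}\Big)^{d-1}\Big).$$ If $1 \leq \deg(f) < p$, then $$|A^d|\gtrsim \min \Big(\frac{q|A|}{|f(A)+A|},\ |A|\cdot\Big(\frac{|A|^3}{q|f(A)+A|}\Big)^{d-1}\Big),\qquad |df(A)|\gtrsim \min \Big(\frac{q|A|}{|AA|},\ |A|\cdot\Big(\frac{|A|^3}{q|AA|}\Big)^{d-1}\Big).$$ (2) If $f$ has a simple root not equal to zero, then $$|A^d|\gtrsim \min \Big(\frac{q|A|}{|f(A)A|},\ |A|\cdot\Big(\frac{|A|^3}{q|f(A)A|}\Big)^{d-1}\Big),\qquad |f(A)^d|\gtrsim \min \Big(\frac{q|A|}{|AA|},\ |A|\cdot\Big(\frac{|A|^3}{q|AA|}\Big)^{d-1}\Big).$$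
   Context: $f(A)=\{f(a):a\in A\}$; $S+T=\{s+t\}$ and $ST=\{st\}$ for $s\in S$, $t\in T$. For a set $B$, $dB$ denotes the $d$-fold sum set $B+\cdots+B$ and $B^d$ denotes the $d$-fold product set $B\cdots B$ ($d$ copies). $X\gtrsim Y$ means $X\ge cY$ for a constant $c>0$ depending only on the degree of $f$.
   Formalization: The implied constant may depend on d as well as on deg f; a constant depending on deg f alone is impossible (q=r², r odd, f=x², A=F_r∪sF_r with s² a non-square of F_r: |df(A)|=r for all d, while the claimed bound tends to c·r²). *)

theory Defs
  imports Complex_Main "HOL-Algebra.Algebraic_Closure" "HOL-Algebra.AbelCoset"
begin

text \<open>
  The implied constant has to be uniform over all finite fields.  With a type of class
  \<open>{finite, field}\<close> it would be chosen after the field and could depend on its order, so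
  finite fields are taken as records over a carrier type \<open>'a\<close> and quantified inside
  the statement, after the constant.  Every finite field has an isomorphic copy whose
  carrier is a set of natural numbers, so the instance \<open>'a = nat\<close> already gives one constant
  for all finite fields.

  The implied constant depends on the degree of the polynomial and on the number \<open>d\<close> of
  summands or factors.  It cannot be independent of \<open>d\<close>: let \<open>r\<close> be odd, \<open>q = r^2\<close>, \<open>f = x^2\<close>,
  and \<open>A = F_r \<union> s F_r\<close>, where \<open>s^2\<close> is a non-square of the subfield \<open>F_r\<close>.  Then \<open>AA = A\<close>,
  the \<open>d\<close>-fold sum set of \<open>f(A)\<close> is \<open>F_r\<close> for every \<open>d\<close>, and
  \<open>|A|^3 / (q |AA|) = ((2r - 1) / r)^2 > 1\<close>, so for large \<open>d\<close> the lower bound for \<open>r\<close> would be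
  a constant times \<open>q |A| / |AA| = r^2\<close>.
\<close>

definition characteristic :: "('a, 'b) ring_scheme \<Rightarrow> nat"
  where "characteristic R = group.ord (add_monoid R) \<one>\<^bsub>R\<^esub>"

primrec nfold_sum :: "('a, 'b) ring_scheme \<Rightarrow> nat \<Rightarrow> 'a set \<Rightarrow> 'a set" where
  "nfold_sum R 0 B = {\<zero>\<^bsub>R\<^esub>}"
| "nfold_sum R (Suc n) B = B <+>\<^bsub>R\<^esub> nfold_sum R n B"

primrec nfold_prod :: "('a, 'b) ring_scheme \<Rightarrow> nat \<Rightarrow> 'a set \<Rightarrow> 'a set" where
  "nfold_prod R 0 B = {\<one>\<^bsub>R\<^esub>}"
| "nfold_prod R (Suc n) B = B <#>\<^bsub>R\<^esub> nfold_prod R n B"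

text \<open>
  As usual for a polynomial over a field that need not contain its roots, the root may lie in
  the algebraic closure.  The map \<open>ring.\<sigma> R\<close> embeds the coefficients of \<open>f\<close> there.  A root in
  \<open>R\<close> itself is a special case.
\<close>

definition has_nonzero_simple_root :: "('a, 'b) ring_scheme \<Rightarrow> 'a list \<Rightarrow> bool"
  where "has_nonzero_simple_root R f \<longleftrightarrow>
    (let L = field.alg_closure R; g = ring.\<sigma> R f in
      \<exists>x. ring.is_root L g x \<and> ring.alg_mult L g x = 1 \<and> x \<noteq> \<zero>\<^bsub>L\<^esub>)"

text \<open>The common shape of all lower bounds, with \<open>a = |A|\<close> and \<open>s\<close> the size of a sum or
  product set.  For \<open>A = {}\<close> it is \<open>0\<close>, by the convention \<open>x / 0 = 0\<close>.\<close>

definition growth_bound :: "nat \<Rightarrow> nat \<Rightarrow> nat \<Rightarrow> nat \<Rightarrow> real"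
  where "growth_bound q d a s =
    min (real q * real a / real s)
        (real a * (real a ^ 3 / (real q * real s)) ^ (d - 1))"

end

theory Submission
  imports Defs "HOL-Algebra.Exponent" "HOL-Computational_Algebra.Computational_Algebra"
    "HOL-Analysis.FPS_Convergence"
begin

text \<open>
  Let \<open>S\<close> be the other sum or product set and \<open>X\<^sub>d\<close> the \<open>d\<close>-fold one. The points \<open>(a, f(a))\<close>, seen in
  \<open>F \<times> F\<close>, \<open>F\<^sup>* \<times> F\<close> or \<open>F\<^sup>* \<times> F\<^sup>*\<close>, generate a Cayley graph whose nontrivial eigenvalues are the
  character sums \<open>\<Sum> \<psi>(\<alpha> t + \<beta> f(t))\<close>, \<open>\<Sum> \<eta>(t) \<psi>(f(t))\<close> and \<open>\<Sum> \<theta>(f(t)) \<eta>(t)\<close>. They are at most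
  \<open>C sqrt q\<close> by the Weil bound. Since \<open>A\<close> produces many edges between \<open>X\<^sub>d\<^sub>-\<^sub>1 \<times> A\<close> and \<open>X\<^sub>d \<times> S\<close>, expander
  mixing gives \<open>|X\<^sub>d| \<ge> c min (q |A| / |S|, |X\<^sub>d\<^sub>-\<^sub>1| |A|\<^sup>3 / (q |S|))\<close>, and one iterates over \<open>d\<close>.

  The Weil bound: the sums \<open>S\<^sub>n\<close> over the extension of degree \<open>n\<close> are the power sums belonging to the
  polynomial \<open>L(T) = \<Sum> \<Lambda>(h) T\<^bsup>deg h\<^esup>\<close>, where \<open>h\<close> runs over the monic polynomials over \<open>F\<close> and the
  coefficients beyond degree \<open>deg f\<close> vanish. If \<open>S\<^sub>2\<^sub>s = O(q\<^sup>s)\<close>, then \<open>L'/L\<close> is analytic for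
  \<open>|T| < 1 / sqrt q\<close>, so all zeros of \<open>L\<close> lie outside this disc and \<open>|S\<^sub>1| \<le> deg f sqrt q\<close>. The bound for
  \<open>S\<^sub>2\<^sub>s\<close>, with an implied constant that may depend on \<open>q\<close>, follows from upper bounds for the fibres
  of trace and norm, which the method of Bombieri and Stepanov provides.
\<close>

section \<open>Power sums attached to a polynomial without small zeros\<close>

text \<open>The method of Bombieri and Stepanov wants an involution x \<mapsto> x ^ P of the point
  set. It exists on the extension of degree 2 s, with P = q ^ s, so only the even power sums get
  bounded. They suffice because the odd ones cancel from the logarithmic derivative of L(T) L(-T).
  The method yields upper bounds only. But a nontrivial character has sum 0 and does not see a
  constant added to all fibre sizes, so fibres that are hardly larger than the average already bound
  the whole sum. A multiplicative character of the norm is removed by splitting the extension into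
  norm classes, each the image of w \<mapsto> t0 w ^ (q - 1). This multiplies the degree of the
  polynomial by q - 1. The loss is harmless: only the radius of convergence of L'/L matters, and the
  L-function gives back a bound without it. Finally, roots and extensions need an algebraically
  closed type around the field, while the theorem quantifies over carrier sets. This gap shapes the
  end of the proof.\<close>

lemma norm_root_ge_of_log_deriv:
  fixes M :: "complex poly" and H :: "complex fps" and r :: real
  assumes log_deriv: "fps_deriv (fps_of_poly M) = fps_of_poly M * H"
    and "M \<noteq> 0" and "r > 0" and bound: "\<And>n. norm (fps_nth H n) \<le> C * r ^ n"
    and root: "poly M z = 0"
  shows "norm z \<ge> 1 / r"
proof (rule ccontr)
  assume "\<not> norm z \<ge> 1 / r"
  then have z: "norm z < 1 / r" by simp
  have "ereal (1 / r) \<le> fps_conv_radius H"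
    unfolding fps_conv_radius_def
  proof (rule conv_radius_geI_ex')
    fix x :: real assume x: "0 < x" "ereal x < ereal (1 / r)"
    have "norm (fps_nth H n * of_real x ^ n) \<le> C * (r * x) ^ n" for n
      using mult_right_mono[OF bound[of n], of "x ^ n"] x
      by (simp add: norm_mult norm_power power_mult_distrib mult.assoc)
    moreover have "summable (\<lambda>n. C * (r * x) ^ n)"
      using x \<open>r > 0\<close> by (intro summable_mult summable_geometric) (simp add: field_simps)
    ultimately show "summable (\<lambda>n. fps_nth H n * of_real x ^ n)"
      by (rule summable_comparison_test'[rotated, where N = 0])
  qed
  then have conv: "ereal (norm z) < fps_conv_radius H"
    using z by (meson ereal_less(2) less_ereal.simps(1) less_le_trans)
  \<comment> \<open>\<open>H\<close> converges at \<open>z\<close>, whereas M'/M would have a pole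
    there. To avoid dividing power series, (X - z)^(m - 1) is cancelled: what is left of M' has the
    value m W(z) \<noteq> 0 at \<open>z\<close>, and the other side vanishes.\<close>
  define m where "m = order z M"
  obtain W where W: "M = [:-z, 1:] ^ m * W" "\<not> [:-z, 1:] dvd W"
    using order_decomp[OF \<open>M \<noteq> 0\<close>, of z] unfolding m_def by blast
  have "m \<noteq> 0" using root \<open>M \<noteq> 0\<close> by (simp add: m_def order_root)
  then obtain l where l: "m = Suc l" by (cases m) auto
  define A where "A = smult (of_nat m) W + [:-z, 1:] * pderiv W"
  have "pderiv M = [:-z, 1:] ^ l * A"
  proof -
    define Y where "Y = [:-z, 1:]"
    have "pderiv Y = 1" by (simp add: Y_def pderiv_pCons)
    then have "pderiv (Y ^ Suc l * W) = Y ^ l * (smult (of_nat (Suc l)) W + Y * pderiv W)"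
      by (simp only: pderiv_mult pderiv_power_Suc) (simp add: algebra_simps)
    then show ?thesis by (simp add: W(1) l A_def Y_def)
  qed
  then have "fps_of_poly ([:-z, 1:] ^ l * A) = fps_of_poly ([:-z, 1:] ^ l * ([:-z, 1:] * W)) * H"
    using log_deriv unfolding fps_of_poly_pderiv[symmetric] W(1) l
    by (simp only: power_Suc2 mult.assoc)
  then have "fps_of_poly ([:-z, 1:] ^ l) * fps_of_poly A
      = fps_of_poly ([:-z, 1:] ^ l) * (fps_of_poly ([:-z, 1:] * W) * H)"
    by (simp only: fps_of_poly_mult mult.assoc)
  moreover have "fps_of_poly ([:-z, 1:] ^ l) \<noteq> 0" by simp
  ultimately have "fps_of_poly A = fps_of_poly ([:-z, 1:] * W) * H" by simp
  then have "poly A z = poly ([:-z, 1:] * W) z * eval_fps H z"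
    using eval_fps_mult[of z "fps_of_poly ([:-z, 1:] * W)" H] conv
    by (metis eval_fps_of_poly fps_conv_radius_fps_of_poly less_ereal.simps(4))
  then show False
    using W(2) \<open>m \<noteq> 0\<close> by (simp add: A_def poly_eq_0_iff_dvd)
qed

text \<open>The quotient of the two coefficients is minus the sum of 1/z over the zeros. Splitting
  off one zero at a time avoids forming that quotient.\<close>

lemma norm_coeff_1_le:
  fixes p :: "complex poly" and r :: real
  assumes "r > 0" and "\<And>z. poly p z = 0 \<Longrightarrow> norm z \<ge> 1 / r"
  shows "norm (coeff p 1) \<le> degree p * r * norm (coeff p 0)"
  using assms(2)
proof (induction "degree p" arbitrary: p)
  case 0
  then show ?case by (simp add: coeff_eq_0)
next
  case (Suc n)
  then have "\<not> constant (poly p)" by (simp add: constant_degree)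
  then obtain z where z: "poly p z = 0"
    using fundamental_theorem_of_algebra by blast
  then obtain s where s: "p = [:-z, 1:] * s" by (auto simp: poly_eq_0_iff_dvd dvd_def)
  then have "s \<noteq> 0" using Suc.hyps(2) by auto
  then have deg: "degree s = n" using Suc.hyps(2) s by (simp add: degree_mult_eq del: mult_pCons_left)
  have IH: "norm (coeff s 1) \<le> n * r * norm (coeff s 0)"
    using Suc.hyps(1)[of s] Suc.prems deg s by auto
  have zr: "1 \<le> norm z * r" using Suc.prems[OF z] \<open>r > 0\<close> by (simp add: field_simps)
  have "norm (coeff p 1) \<le> norm (coeff s 0) + norm z * norm (coeff s 1)"
    unfolding s by (simp add: norm_mult[symmetric] norm_triangle_ineq4)
  also have "\<dots> \<le> (norm z * r) * norm (coeff s 0) + norm z * (n * r * norm (coeff s 0))"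
    using IH mult_right_mono[OF zr, of "norm (coeff s 0)"]
    by (intro add_mono mult_left_mono) auto
  also have "\<dots> = degree p * r * norm (coeff p 0)"
    using Suc.hyps(2)[symmetric] by (simp add: s norm_mult algebra_simps)
  finally show ?case .
qed

text \<open>\<open>newton\<close> says L' = L H for L = \<Sum> c_n T^n and H = \<Sum> S_(n+1) T^n,
  and \<open>vanish\<close> makes L a polynomial. For M(T) = L(T) L(-T) the logarithmic derivative
  is H(T) - H(-T), where the terms with odd index of S cancel. So the bound for even indices
  controls the zeros of M, hence those of L.\<close>

lemma power_sum_bound_of_newton:
  fixes c S :: "nat \<Rightarrow> complex" and k :: nat and r C :: real
  assumes c0: "c 0 = 1"
    and newton: "\<And>n. of_nat (Suc n) * c (Suc n) = (\<Sum>i\<le>n. c i * S (Suc n - i))"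
    and vanish: "\<And>n. n > k \<Longrightarrow> c n = 0"
    and "r > 0" and bound: "\<And>s. s \<ge> 1 \<Longrightarrow> norm (S (2 * s)) \<le> C * r ^ (2 * s)"
  shows "norm (S 1) \<le> k * r"
proof -
  define L where "L = Poly (map c [0..<Suc k])"
  have coeff_L: "coeff L n = c n" for n
    using vanish[of n] by (auto simp: L_def nth_default_def simp del: upt_Suc)
  define L2 where "L2 = pcompose L [:0, -1:]"
  have coeff_L2: "coeff L2 n = (-1) ^ n * c n" for n
    unfolding L2_def by (simp add: coeff_pcompose_linear coeff_L)
  define H where "H = Abs_fps (\<lambda>n. S (Suc n))"
  define H2 where "H2 = Abs_fps (\<lambda>n. (-1) ^ n * S (Suc n))"
  have dL: "fps_deriv (fps_of_poly L) = fps_of_poly L * H"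
    by (rule fps_ext) (use newton in \<open>simp add: coeff_L fps_mult_nth H_def Suc_diff_le atLeast0AtMost\<close>)
  have dL2: "fps_deriv (fps_of_poly L2) = - fps_of_poly L2 * H2"
  proof (rule fps_ext)
    fix n
    have "fps_nth (fps_deriv (fps_of_poly L2)) n = - ((-1) ^ n * (\<Sum>i\<le>n. c i * S (Suc n - i)))"
      by (simp add: coeff_L2 flip: newton)
    also have "\<dots> = - (\<Sum>i\<le>n. ((-1) ^ i * c i) * ((-1) ^ (n - i) * S (Suc (n - i))))"
      unfolding sum_distrib_left
      by (intro arg_cong[where f = uminus] sum.cong refl)
         (simp add: Suc_diff_le mult_ac flip: power_add)
    also have "\<dots> = fps_nth (- fps_of_poly L2 * H2) n"
      by (simp add: coeff_L2 fps_mult_nth H2_def atLeast0AtMost)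
    finally show "fps_nth (fps_deriv (fps_of_poly L2)) n = fps_nth (- fps_of_poly L2 * H2) n" .
  qed
  define M where "M = L * L2"
  have dM: "fps_deriv (fps_of_poly M) = fps_of_poly M * (H - H2)"
    unfolding M_def fps_of_poly_mult fps_deriv_mult dL dL2 by (simp add: algebra_simps)
  have "coeff M 0 = 1" by (simp add: M_def coeff_mult coeff_L coeff_L2 c0)
  then have "M \<noteq> 0" by auto
  have "norm (fps_nth (H - H2) n) \<le> max 0 (2 * C * r) * r ^ n" for n
  proof (cases "even n")
    case True
    then show ?thesis using \<open>r > 0\<close> by (simp add: H_def H2_def)
  next
    case False
    then obtain m where m: "n = 2 * m + 1" by (elim oddE)
    have "norm (fps_nth (H - H2) n) = 2 * norm (S (2 * Suc m))"
      using m by (simp add: H_def H2_def norm_mult flip: mult_2)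
    also have "\<dots> \<le> 2 * C * r * r ^ n"
      using bound[of "Suc m"] by (simp add: m algebra_simps)
    also have "\<dots> \<le> max 0 (2 * C * r) * r ^ n"
      using \<open>r > 0\<close> by (intro mult_right_mono) auto
    finally show ?thesis .
  qed
  then have roots: "norm z \<ge> 1 / r" if "poly L z = 0" for z
    using norm_root_ge_of_log_deriv[of M "H - H2" r "max 0 (2 * C * r)" z] dM \<open>M \<noteq> 0\<close> \<open>r > 0\<close> that
    by (auto simp: M_def)
  have "degree L \<le> k"
    by (rule degree_le) (simp add: coeff_L vanish)
  have "S 1 = coeff L 1" using newton[of 0] by (simp add: coeff_L c0)
  then have "norm (S 1) \<le> degree L * r"
    using norm_coeff_1_le[OF \<open>r > 0\<close>, of L] roots by (simp add: coeff_L c0)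
  also have "\<dots> \<le> k * r"
    using \<open>degree L \<le> k\<close> \<open>r > 0\<close> by (intro mult_right_mono) auto
  finally show ?thesis .
qed

section \<open>Finite subfields of an algebraically closed field\<close>

lemma proots_prod_linear: "proots (\<Prod>x\<in>#B. [:-x, 1:]) = (B :: 'a::field multiset)"
proof -
  have "(\<Prod>x\<in>#B. [:-x, 1:]) \<noteq> (0 :: 'a poly)" for B :: "'a multiset"
    by (auto simp: prod_mset_zero_iff)
  then show ?thesis
    by (induction B) (simp_all add: proots_mult proots_linear_factor del: mult_pCons_left)
qed

lemma alg_closed_prod_proots:
  fixes p :: "'a::alg_closed_field poly"
  assumes "p \<noteq> 0"
  shows "p = smult (lead_coeff p) (\<Prod>x\<in>#proots p. [:-x, 1:])" and "size (proots p) = degree p"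
proof -
  obtain A where A: "size A = degree p" "p = smult (lead_coeff p) (\<Prod>x\<in>#A. [:-x, 1:])"
    using alg_closed_imp_factorization[OF assms] by blast
  have "proots p = proots (\<Prod>x\<in>#A. [:-x, 1:])"
    using assms by (subst A(2)) (rule proots_smult, simp)
  then have "proots p = A" by (simp only: proots_prod_linear)
  then show "p = smult (lead_coeff p) (\<Prod>x\<in>#proots p. [:-x, 1:])" "size (proots p) = degree p"
    using A by auto
qed

lemma dvd_iff_proots_subseteq:
  fixes p r :: "'a::alg_closed_field poly"
  assumes "p \<noteq> 0" "r \<noteq> 0"
  shows "p dvd r \<longleftrightarrow> proots p \<subseteq># proots r"
proof
  assume "p dvd r"
  then obtain s where s: "r = p * s" by (elim dvdE)
  with assms have "s \<noteq> 0" by auto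
  then show "proots p \<subseteq># proots r" using s assms by (simp add: proots_mult)
next
  assume "proots p \<subseteq># proots r"
  then have "(\<Prod>x\<in>#proots p. [:-x, 1:]) dvd (\<Prod>x\<in>#proots r. [:-x, 1:])"
    by (intro prod_mset_subset_imp_dvd image_mset_subseteq_mono)
  then have "smult (lead_coeff p) (\<Prod>x\<in>#proots p. [:-x, 1:])
      dvd smult (lead_coeff r) (\<Prod>x\<in>#proots r. [:-x, 1:])"
    using assms by (simp add: smult_dvd_iff dvd_smult)
  then show "p dvd r"
    unfolding alg_closed_prod_proots(1)[OF assms(1), symmetric]
      alg_closed_prod_proots(1)[OF assms(2), symmetric] .
qed

lemma sum_order_eq_degree:
  fixes p :: "'a::alg_closed_field poly"
  assumes "p \<noteq> 0"
  shows "(\<Sum>x | poly p x = 0. order x p) = degree p"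
  using alg_closed_prod_proots(2)[OF assms] assms
  by (simp add: size_multiset_overloaded_eq count_proots set_count_proots)

lemma card_roots_eq_degree:
  fixes p :: "'a::alg_closed_field poly"
  assumes "p \<noteq> 0" and "\<And>x. poly p x = 0 \<Longrightarrow> poly (pderiv p) x \<noteq> 0"
  shows "card {x. poly p x = 0} = degree p"
proof -
  have "order x p = 1" if "poly p x = 0" for x
  proof -
    have "pderiv p \<noteq> 0" using assms(2)[OF that] by auto
    have "order x p \<noteq> 0" using that assms(1) by (simp add: order_root)
    moreover have "\<not> order x p \<ge> 2"
    proof
      assume "order x p \<ge> 2"
      then have "[:-x, 1:] ^ 2 dvd p" by (meson dvd_trans le_imp_power_dvd order_1)
      then obtain s where "p = [:-x, 1:] ^ 2 * s" by (elim dvdE)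
      then have "poly (pderiv p) x = 0"
        by (simp add: power2_eq_square pderiv_mult del: mult_pCons_left mult_pCons_right)
      then show False using assms(2)[OF that] by simp
    qed
    ultimately show ?thesis by linarith
  qed
  then show ?thesis using sum_order_eq_degree[OF assms(1)] by simp
qed

lemma poly_eqI_many_roots:
  fixes p r :: "'a::idom poly"
  assumes "finite A" "degree p < card A" "degree r < card A" "\<And>x. x \<in> A \<Longrightarrow> poly p x = poly r x"
  shows "p = r"
proof (rule ccontr)
  assume "p \<noteq> r"
  then have "p - r \<noteq> 0" by simp
  have "card A \<le> card {x. poly (p - r) x = 0}"
    using \<open>p - r \<noteq> 0\<close> assms by (intro card_mono poly_roots_finite) auto
  also have "\<dots> \<le> degree (p - r)" using \<open>p - r \<noteq> 0\<close> by (rule card_poly_roots_bound)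
  also have "\<dots> < card A" using assms degree_diff_less by metis
  finally show False by simp
qed

lemma infinite_UNIV_alg_closed: "infinite (UNIV :: 'k::alg_closed_field set)"
proof
  assume fin: "finite (UNIV :: 'k set)"
  define g :: "'k poly" where "g = (\<Prod>a\<in>UNIV. [:-a, 1:])"
  have deg: "degree g = card (UNIV :: 'k set)" unfolding g_def by (subst degree_prod_eq_sum_degree) auto
  then have "degree (g + 1) > 0" using fin by (simp add: degree_add_eq_left card_gt_0_iff)
  then obtain x where "poly (g + 1) x = 0" using alg_closed_imp_poly_has_root by blast
  moreover have "poly g x = 0" using fin by (auto simp: g_def poly_prod)
  ultimately show False by simp
qed

lemma poly_eqI_alg_closed:
  fixes g u :: "'k::alg_closed_field poly"
  assumes "\<And>x. poly g x = poly u x" shows "g = u"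
proof -
  obtain B :: "'k set" where "finite B" "card B = Suc (max (degree g) (degree u))"
    using infinite_arbitrarily_large[OF infinite_UNIV_alg_closed] by blast
  then show ?thesis using assms by (intro poly_eqI_many_roots[of B]) auto
qed

text \<open>Inside an algebraically closed type all finite extensions of the field and all roots of
  polynomials over it have the same type: an extension is the set \<open>Fn n\<close> of fixed
  points of a power of Frobenius.\<close>

locale finite_subfield =
  fixes F :: "'k::alg_closed_field set"
  assumes finite_F: "finite F" and one_F: "1 \<in> F"
    and add_F: "\<lbrakk>x \<in> F; y \<in> F\<rbrakk> \<Longrightarrow> x + y \<in> F"
    and mult_F: "\<lbrakk>x \<in> F; y \<in> F\<rbrakk> \<Longrightarrow> x * y \<in> F"
    and uminus_F: "x \<in> F \<Longrightarrow> - x \<in> F"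
    and inverse_F: "x \<in> F \<Longrightarrow> inverse x \<in> F"
begin

definition q :: nat where "q = card F"

lemma zero_F: "0 \<in> F" using add_F[OF one_F uminus_F[OF one_F]] by simp

lemma q_ge_2: "q \<ge> 2"
proof -
  have "card {0, 1 :: 'k} \<le> q"
    unfolding q_def using zero_F one_F finite_F by (intro card_mono) auto
  then show ?thesis by simp
qed

lemma power_q_minus_1: assumes "x \<in> F" "x \<noteq> 0" shows "x ^ (q - 1) = 1"
proof -
  let ?G = "F - {0}"
  have "bij_betw ((*) x) ?G ?G"
  proof (rule bij_betwI[where g = "(*) (inverse x)"])
  qed (use assms mult_F inverse_F in \<open>auto simp flip: mult.assoc\<close>)
  then have "prod id ?G = (\<Prod>y\<in>?G. x * y)"
    by (metis (no_types, lifting) id_apply prod.cong prod.reindex_bij_betw)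
  also have "\<dots> = x ^ (q - 1) * prod id ?G"
    using zero_F finite_F by (simp add: prod.distrib q_def)
  finally show ?thesis using finite_F by simp
qed

lemma power_q: assumes "x \<in> F" shows "x ^ q = x"
proof -
  have "x ^ q = x * x ^ (q - 1)" using q_ge_2 by (cases q) auto
  then show ?thesis using power_q_minus_1[OF assms] by (cases "x = 0") auto
qed

lemma degree_fermat_poly: "N \<ge> 2 \<Longrightarrow> degree (monom 1 N - monom 1 1 :: 'k poly) = N"
  using degree_add_eq_left[of "- monom 1 1" "monom 1 N :: 'k poly"] by (simp add: degree_monom_eq)

lemma F_eq: "F = {x. x ^ q = x}"
proof (rule card_seteq)
  have ne: "(monom 1 q - monom 1 1 :: 'k poly) \<noteq> 0"
    using degree_fermat_poly[OF q_ge_2] q_ge_2 by auto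
  have eq: "{x::'k. x ^ q = x} = {x. poly (monom 1 q - monom 1 1) x = 0}"
    by (simp add: poly_monom)
  show "finite {x::'k. x ^ q = x}" unfolding eq by (rule poly_roots_finite[OF ne])
  show "F \<subseteq> {x. x ^ q = x}" using power_q by auto
  show "card {x::'k. x ^ q = x} \<le> card F"
    unfolding eq using card_poly_roots_bound[OF ne] degree_fermat_poly[OF q_ge_2] by (simp add: q_def)
qed

definition p :: nat where "p = CHAR('k)"

lemma prime_p: "prime p"
proof -
  have "of_nat n \<in> F" for n by (induction n) (auto simp: zero_F one_F add_F)
  then have "finite (range (of_nat :: nat \<Rightarrow> 'k))"
    using finite_F by (meson finite_subset image_subsetI)
  then have "\<not> inj (of_nat :: nat \<Rightarrow> 'k)" using finite_imageD infinite_UNIV_nat by blast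
  then obtain m n :: nat where mn: "m < n" "(of_nat m :: 'k) = of_nat n"
    unfolding inj_def by (metis linorder_neqE_nat)
  then have "(of_nat (n - m) :: 'k) = 0" by simp
  then have "CHAR('k) > 0" using mn(1) CHAR_pos_iff zero_less_diff by blast
  then show ?thesis unfolding p_def by (rule prime_CHAR_semidom)
qed

lemma of_nat_p [simp]: "(of_nat p :: 'k) = 0" by (simp add: p_def)

text \<open>No dimension over the prime field is used. The polynomial (1 + X)^q - X^q - 1 has degree
  below q and vanishes at the q elements of \<open>F\<close>, so it is 0 and p divides all inner
  binomial coefficients of q. If q = p^e u with u > 1 prime to p, the one at p^e is prime to
  p.\<close>

lemma q_eq_power: "\<exists>r>0. q = p ^ r"
proof -
  define e where "e = multiplicity p q"
  have "\<not> is_unit p" using prime_p by (simp add: prime_nat_iff)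
  obtain u where u: "q = p ^ e * u" "\<not> p dvd u"
    unfolding e_def using multiplicity_decompose'[of q p] q_ge_2 \<open>\<not> is_unit p\<close> by auto
  have "u > 0" using u q_ge_2 by (cases u) auto
  define d where "d = [:1, 1:] ^ q - monom 1 q - (1 :: 'k poly)"
  have "coeff d q = 0" using q_ge_2 by (simp add: d_def coeff_linear_power)
  moreover have "degree d \<le> q"
    unfolding d_def using degree_linear_power[of "1::'k" q]
    by (intro degree_diff_le) (auto simp: degree_monom_le)
  ultimately have "degree d < q"
    using q_ge_2 eq_zero_or_degree_less[of d q] by auto
  have "d = 0"
    by (rule poly_eqI_many_roots[OF finite_F])
       (use \<open>degree d < q\<close> power_q add_F one_F in \<open>auto simp: d_def poly_monom algebra_simps simp flip: q_def\<close>)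
  have binom: "p dvd (q choose j)" if "0 < j" "j < q" for j
  proof -
    have "coeff d j = of_nat (q choose j)"
      using that by (simp add: d_def coeff_linear_poly_power)
    then show ?thesis using \<open>d = 0\<close> by (simp add: p_def of_nat_eq_0_iff_char_dvd)
  qed
  have "q = p ^ e"
  proof (rule ccontr)
    assume "q \<noteq> p ^ e"
    then have "p ^ e < q" using u \<open>u > 0\<close> prime_gt_0_nat[OF prime_p] by (cases u) auto
    then have "p dvd (p ^ e * u choose p ^ e)"
      using binom[of "p ^ e"] prime_gt_0_nat[OF prime_p] u by simp
    moreover have "multiplicity p (p ^ e * u choose p ^ e) = multiplicity p u"
      using const_p_fac[of u p e] \<open>u > 0\<close> prime_p by simp
    moreover have "(p ^ e * u choose p ^ e) \<noteq> 0" using \<open>p ^ e < q\<close> u by simp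
    ultimately show False
      using u(2) \<open>u > 0\<close> \<open>\<not> is_unit p\<close>
      by (metis multiplicity_eq_zero_iff neq0_conv)
  qed
  moreover have "e > 0" using calculation q_ge_2 by (cases e) auto
  ultimately show ?thesis by blast
qed

lemma q_gt_0 [simp]: "q > 0" and q_neq_0 [simp]: "q \<noteq> 0" using q_ge_2 by auto

lemma q_power_eq: obtains j where "q ^ n = p ^ j"
  using q_eq_power by (metis power_mult)

lemma of_nat_q [simp]: "(of_nat q :: 'k) = 0"
proof -
  obtain r where "r > 0" "q = p ^ r" using q_eq_power by blast
  then show ?thesis by simp
qed

lemma frob_add: "(x + y :: 'k) ^ (q ^ n) = x ^ (q ^ n) + y ^ (q ^ n)"
proof -
  obtain j where "q ^ n = p ^ j" by (rule q_power_eq)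
  then show ?thesis using freshmans_dream'[of "q ^ n" j x y] prime_p by (simp add: p_def)
qed

lemma frob_sum: "(\<Sum>i\<in>I. f i :: 'k) ^ (q ^ n) = (\<Sum>i\<in>I. f i ^ (q ^ n))"
proof -
  obtain j where "q ^ n = p ^ j" by (rule q_power_eq)
  then show ?thesis using freshmans_dream_sum'[of "q ^ n" j f I] prime_p by (simp add: p_def)
qed

lemma frob_uminus: "(- x :: 'k) ^ (q ^ n) = - (x ^ (q ^ n))"
  using frob_add[of x "- x" n] by (simp add: eq_neg_iff_add_eq_0 add.commute power_0_left)

lemma frob_diff: "(x - y :: 'k) ^ (q ^ n) = x ^ (q ^ n) - y ^ (q ^ n)"
  using frob_add[of x "- y" n] by (simp add: frob_uminus)

lemma frob_inj: "(x :: 'k) ^ (q ^ n) = y ^ (q ^ n) \<Longrightarrow> x = y"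
  using frob_diff[of x y n] by simp

lemma frob_frob: "((x :: 'k) ^ (q ^ m)) ^ (q ^ n) = x ^ (q ^ (m + n))"
  by (simp only: power_add power_mult)

definition Fn :: "nat \<Rightarrow> 'k set" where "Fn n = {x. x ^ (q ^ n) = x}"

lemma F_iff: "x \<in> F \<longleftrightarrow> x ^ q = x" using F_eq by blast

lemma Fn_1: "Fn (Suc 0) = F" by (auto simp: Fn_def F_iff)

lemma Fn_add: "x \<in> Fn n \<Longrightarrow> y \<in> Fn n \<Longrightarrow> x + y \<in> Fn n"
  and Fn_mult: "x \<in> Fn n \<Longrightarrow> y \<in> Fn n \<Longrightarrow> x * y \<in> Fn n"
  and Fn_0: "0 \<in> Fn n"
  and Fn_1': "1 \<in> Fn n"
  by (auto simp: Fn_def frob_add power_mult_distrib power_0_left)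

lemma Fn_power: "x \<in> Fn n \<Longrightarrow> x ^ j \<in> Fn n"
  by (induction j) (auto simp: Fn_mult Fn_1')

lemma Fn_sum: "(\<And>i. i \<in> I \<Longrightarrow> f i \<in> Fn n) \<Longrightarrow> sum f I \<in> Fn n"
  by (induction I rule: infinite_finite_induct) (auto simp: Fn_add Fn_0)

lemma F_subset_Fn: "F \<subseteq> Fn n"
proof
  fix x assume "x \<in> F"
  then have "x ^ q ^ n = x" by (induction n) (simp_all add: power_mult power_q)
  then show "x \<in> Fn n" by (simp add: Fn_def)
qed

lemma poly_Fn: "(\<And>i. coeff g i \<in> Fn n) \<Longrightarrow> x \<in> Fn n \<Longrightarrow> poly g x \<in> Fn n"
  unfolding poly_altdef by (intro Fn_sum Fn_mult Fn_power)

lemma qn_ge_2: "n > 0 \<Longrightarrow> q ^ n \<ge> 2"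
  using q_ge_2 self_le_power[of q n] by simp

lemma finite_card_Fn: assumes "n > 0" shows "finite (Fn n)" and "card (Fn n) = q ^ n"
proof -
  define g :: "'k poly" where "g = monom 1 (q ^ n) - monom 1 1"
  have deg: "degree g = q ^ n" unfolding g_def by (rule degree_fermat_poly[OF qn_ge_2[OF assms]])
  then have "g \<noteq> 0" using qn_ge_2[OF assms] by auto
  have eq: "Fn n = {x. poly g x = 0}" by (simp add: Fn_def g_def poly_monom)
  have "pderiv g = - 1"
    using assms by (simp add: g_def pderiv_diff pderiv_monom monom_0 one_pCons power_0_left)
  then show "finite (Fn n)" "card (Fn n) = q ^ n"
    using card_roots_eq_degree[OF \<open>g \<noteq> 0\<close>] poly_roots_finite[OF \<open>g \<noteq> 0\<close>] by (auto simp: eq deg)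
qed

text \<open>The Galois action on coefficients. Polynomials over \<open>F\<close> are the fixed
  points of \<open>frobp 1\<close>, which turns claims about coefficients in \<open>F\<close> into
  identities.\<close>

definition frobp :: "nat \<Rightarrow> 'k poly \<Rightarrow> 'k poly" where "frobp n = map_poly (\<lambda>x. x ^ (q ^ n))"

lemma coeff_frobp [simp]: "coeff (frobp n g) i = coeff g i ^ (q ^ n)"
  by (simp add: frobp_def coeff_map_poly)

lemma frobp_mult: "frobp n (g * h) = frobp n g * frobp n h"
  by (rule poly_eqI) (simp add: coeff_mult frob_sum power_mult_distrib)

lemma frobp_1: "frobp n 1 = 1" by (rule poly_eqI) (simp add: coeff_pCons)

lemma frobp_power: "frobp n (g ^ j) = frobp n g ^ j"
  by (induction j) (auto simp: frobp_1 frobp_mult)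

lemma frobp_linear: "frobp n [:- x, 1:] = [:- (x ^ (q ^ n)), 1:]"
  by (rule poly_eqI) (auto simp: coeff_pCons frob_uminus split: nat.splits)

lemma frobp_prod: "frobp n (prod f I) = (\<Prod>i\<in>I. frobp n (f i))"
  by (induction I rule: infinite_finite_induct) (auto simp: frobp_1 frobp_mult)

lemma degree_frobp [simp]: "degree (frobp n g) = degree g"
  unfolding frobp_def by (rule degree_map_poly) simp

lemma poly_frobp: "poly (frobp n g) (x ^ (q ^ n)) = poly g x ^ (q ^ n)"
  unfolding poly_altdef frob_sum degree_frobp coeff_frobp power_mult_distrib
  by (intro sum.cong refl arg_cong2[where f = "(*)"]) (metis mult.commute power_mult)

definition over_F :: "'k poly \<Rightarrow> bool" where "over_F g \<longleftrightarrow> (\<forall>i. coeff g i \<in> F)"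

lemma over_F_iff: "over_F g \<longleftrightarrow> frobp 1 g = g"
  by (auto simp: over_F_def poly_eq_iff F_iff)

lemma over_F_frobp: assumes "over_F g" shows "frobp n g = g"
  by (rule poly_eqI) (use assms F_subset_Fn[of n] in \<open>auto simp: over_F_def Fn_def\<close>)

lemma over_F_mult: "over_F g \<Longrightarrow> over_F h \<Longrightarrow> over_F (g * h)"
  by (simp add: over_F_iff frobp_mult)

lemma over_F_poly: "over_F g \<Longrightarrow> poly g x ^ (q ^ n) = poly g (x ^ (q ^ n))"
  using poly_frobp[of n g x] by (simp add: over_F_frobp)

lemma over_F_coeff_Fn: "over_F g \<Longrightarrow> coeff g i \<in> Fn n"
  using F_subset_Fn by (auto simp: over_F_def)

lemma over_F_cancel: assumes "over_F g" "over_F (g * h)" "g \<noteq> 0" shows "over_F h"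
  using assms by (simp add: over_F_iff frobp_mult)

definition MP :: "nat \<Rightarrow> 'k poly set" where
  "MP n = {h. lead_coeff h = 1 \<and> degree h = n \<and> over_F h}"

lemma finite_MP: "finite (MP n)"
proof (rule finite_imageD)
  have "coeffs ` MP n \<subseteq> {xs. set xs \<subseteq> F \<and> length xs \<le> Suc n}"
    by (auto simp: MP_def over_F_def coeffs_def one_F)
  then show "finite (coeffs ` MP n)"
    using finite_lists_length_le[OF finite_F] finite_subset by blast
  show "inj_on coeffs (MP n)" by (simp add: inj_on_def coeffs_eq_iff)
qed

lemma MP_0: "MP 0 = {1}"
  by (auto simp: MP_def over_F_def one_F zero_F coeff_pCons one_pCons elim!: degree_eq_zeroE split: nat.splits)

lemma MP_mult: assumes "g \<in> MP m" "h \<in> MP n" shows "g * h \<in> MP (m + n)"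
proof -
  have "g \<noteq> 0" "h \<noteq> 0" using assms by (auto simp: MP_def)
  moreover have "lead_coeff (g * h) = 1" using assms by (auto simp: lead_coeff_mult MP_def)
  ultimately show ?thesis using assms by (auto simp: MP_def over_F_mult degree_mult_eq)
qed

text \<open>For \<open>t\<close> in the subfield \<open>Fn i\<close> of order \<open>q\<^sup>i\<close> this is a power of the minimal polynomial over \<open>F\<close>.\<close>

definition nrm :: "nat \<Rightarrow> 'k \<Rightarrow> 'k poly" where
  "nrm i t = (\<Prod>j<i. [:- (t ^ (q ^ j)), 1:])"

lemma nrm_nonzero [simp]: "nrm i t \<noteq> 0" by (simp add: nrm_def)

lemma proots_nrm: "proots (nrm i t) = (\<Sum>j<i. {#t ^ (q ^ j)#})"
  unfolding nrm_def by (subst proots_prod) (auto simp: proots_linear_factor)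

lemma prod_lessThan_shift_cyclic:
  fixes f :: "nat \<Rightarrow> 'a::comm_monoid_mult"
  assumes "f i = f 0" shows "(\<Prod>j<i. f (Suc j)) = (\<Prod>j<i. f j)"
proof (cases i)
  case (Suc m)
  show ?thesis
    using assms unfolding Suc prod.lessThan_Suc_shift[of f m] by (simp add: mult.commute)
qed simp

lemma nrm_in_MP: assumes "t \<in> Fn i" shows "nrm i t \<in> MP i"
proof -
  have "frobp 1 (nrm i t) = (\<Prod>j<i. [:- (t ^ (q ^ Suc j)), 1:])"
    unfolding nrm_def frobp_prod frobp_linear frob_frob by simp
  also have "\<dots> = nrm i t"
    unfolding nrm_def
    by (rule prod_lessThan_shift_cyclic[of "\<lambda>j. [:- (t ^ (q ^ j)), 1:]"]) (use assms in \<open>simp add: Fn_def\<close>)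
  finally have "over_F (nrm i t)" by (simp add: over_F_iff)
  moreover have "lead_coeff (nrm i t) = 1" unfolding nrm_def lead_coeff_prod by simp
  moreover have "degree (nrm i t) = i" unfolding nrm_def by (subst degree_prod_eq_sum_degree) auto
  ultimately show ?thesis by (simp add: MP_def)
qed

end

section \<open>The L-function of a multiplicative function on monic polynomials\<close>

context finite_subfield begin

section \<open>Conjugates of a root and powers of minimal polynomials\<close>

lemma order_frob_ge:
  assumes "over_F h" "h \<noteq> 0"
  shows "order (t ^ (q ^ j)) h \<ge> order t h"
proof -
  have "[:-t, 1:] ^ order t h dvd h" by (rule order_1)
  then obtain s where "h = [:-t, 1:] ^ order t h * s" by (elim dvdE)
  then have "frobp j h = [:- (t ^ (q ^ j)), 1:] ^ order t h * frobp j s"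
    by (metis frobp_linear frobp_mult frobp_power)
  then show ?thesis
    using assms by (metis dvd_triv_left order_divides over_F_frobp)
qed

text \<open>The Frobenius orbit of a root stays among the finitely many roots and must repeat; as
  Frobenius is injective, the repetition already includes \<open>t\<close> itself.\<close>

lemma root_in_Fn:
  assumes "over_F h" "h \<noteq> 0" "poly h t = 0"
  shows "\<exists>e>0. t \<in> Fn e"
proof -
  have "range (\<lambda>j. t ^ (q ^ j)) \<subseteq> {x. poly h x = 0}"
    using assms by (auto simp flip: over_F_poly simp: power_0_left)
  then have "\<not> inj (\<lambda>j. t ^ (q ^ j))"
    using poly_roots_finite[OF assms(2)] finite_subset finite_imageD infinite_UNIV_nat by metis
  then obtain a b where "a < b" "t ^ (q ^ a) = t ^ (q ^ b)"
    unfolding inj_def by (metis linorder_neqE_nat)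
  then have "(t ^ (q ^ (b - a))) ^ (q ^ a) = t ^ (q ^ a)" by (simp add: frob_frob)
  then have "t ^ (q ^ (b - a)) = t" by (rule frob_inj)
  then show ?thesis using \<open>a < b\<close> by (intro exI[of _ "b - a"]) (simp add: Fn_def)
qed

text \<open>The degree of \<open>t\<close> over \<open>F\<close>, for \<open>t\<close> in some
  \<open>Fn e\<close> with \<open>e > 0\<close>.\<close>

definition period :: "'k \<Rightarrow> nat" where "period t = (LEAST e. e > 0 \<and> t \<in> Fn e)"

lemma period: assumes "e > 0" "t \<in> Fn e" shows "period t > 0" "t \<in> Fn (period t)"
  using LeastI[of "\<lambda>e. e > 0 \<and> t \<in> Fn e" e] assms unfolding period_def by auto

lemma period_le: "e > 0 \<Longrightarrow> t \<in> Fn e \<Longrightarrow> period t \<le> e"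
  unfolding period_def by (rule Least_le) simp

lemma Fn_mult_period: "t \<in> Fn e \<Longrightarrow> t ^ (q ^ (e * j)) = t"
  by (induction j) (auto simp: Fn_def simp flip: frob_frob)

lemma in_Fn_iff_period_dvd:
  assumes "e > 0" "t \<in> Fn e" shows "t \<in> Fn i \<longleftrightarrow> period t dvd i"
proof
  assume "period t dvd i"
  then show "t \<in> Fn i" using Fn_mult_period[OF period(2)[OF assms]] by (auto simp: Fn_def elim!: dvdE)
next
  assume i: "t \<in> Fn i"
  let ?e = "period t"
  have "t = (t ^ (q ^ (?e * (i div ?e)))) ^ (q ^ (i mod ?e))"
    using i unfolding frob_frob by (simp add: Fn_def)
  then have "t \<in> Fn (i mod ?e)"
    unfolding Fn_mult_period[OF period(2)[OF assms]] by (simp add: Fn_def)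
  moreover have "i mod ?e < ?e" using period(1)[OF assms] by simp
  ultimately have "i mod ?e = 0" using period_le[of "i mod ?e" t] by (cases "i mod ?e = 0") auto
  then show "?e dvd i" by auto
qed

lemma inj_on_orbit:
  assumes "e > 0" "t \<in> Fn e" shows "inj_on (\<lambda>j. t ^ (q ^ j)) {..<period t}"
proof -
  have "False" if "a < b" "b < period t" "t ^ (q ^ a) = t ^ (q ^ b)" for a b
  proof -
    have "(t ^ (q ^ (b - a))) ^ (q ^ a) = t ^ (q ^ a)" using that by (simp add: frob_frob)
    then have "t ^ (q ^ (b - a)) = t" by (rule frob_inj)
    then have "t \<in> Fn (b - a)" by (simp add: Fn_def)
    then show False using period_le[of "b - a" t] that by simp
  qed
  then show ?thesis unfolding inj_on_def by (metis lessThan_iff linorder_neqE_nat)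
qed

lemma nrm_mult: "t \<in> Fn e \<Longrightarrow> nrm (e * j) t = nrm e t ^ j"
proof (induction j)
  case (Suc j)
  have "nrm (m + i) t = nrm m t * (\<Prod>l<i. [:- (t ^ (q ^ (m + l))), 1:])" for m i
    unfolding nrm_def
    by (induction i) (simp_all only: add_0_right add_Suc_right prod.lessThan_Suc lessThan_0 prod.empty mult_1_right mult.assoc)
  then have "nrm (e * j + e) t = nrm (e * j) t * (\<Prod>i<e. [:- (t ^ (q ^ (e * j + i))), 1:])" .
  also have "(\<Prod>i<e. [:- (t ^ (q ^ (e * j + i))), 1:]) = nrm e t"
    unfolding nrm_def using Fn_mult_period[OF Suc.prems, of j] by (simp flip: frob_frob)
  finally show ?case using Suc by (simp add: add.commute mult.commute)
qed (simp add: nrm_def)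

text \<open>\<open>nrm (period t) t\<close> is the minimal polynomial of \<open>t\<close>: its roots
  are the conjugates, pairwise distinct by \<open>inj_on_orbit\<close>. A polynomial over
  \<open>F\<close> vanishes at each conjugate at least to the order at \<open>t\<close>, so that
  order decides which powers divide it.\<close>

lemma nrm_power_dvd_iff:
  assumes "over_F h" "h \<noteq> 0" "e > 0" "t \<in> Fn e"
  shows "nrm (period t) t ^ j dvd h \<longleftrightarrow> j \<le> order t h"
proof -
  let ?O = "\<lambda>i. t ^ (q ^ i)"
  have "proots (nrm (period t) t) = image_mset ?O (mset_set {..<period t})"
    by (simp add: proots_nrm sum_unfold_sum_mset image_mset.compositionality o_def)
  also have "\<dots> = mset_set (?O ` {..<period t})"
    using inj_on_orbit[OF assms(3,4)] by (rule image_mset_mset_set)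
  finally have proots: "proots (nrm (period t) t) = mset_set (?O ` {..<period t})" .
  have t: "t \<in> ?O ` {..<period t}"
    using period(1)[OF assms(3,4)] by (intro image_eqI[of _ _ 0]) auto
  have "nrm (period t) t ^ j dvd h \<longleftrightarrow> repeat_mset j (mset_set (?O ` {..<period t})) \<subseteq># proots h"
    using assms(2) by (subst dvd_iff_proots_subseteq) (simp_all add: proots_power proots)
  also have "\<dots> \<longleftrightarrow> (\<forall>x \<in> ?O ` {..<period t}. j \<le> order x h)"
    using assms(2) by (auto simp: subseteq_mset_def count_mset_set' count_proots)
  also have "\<dots> \<longleftrightarrow> j \<le> order t h"
    using t order_frob_ge[OF assms(1,2)] order_trans by blast
  finally show ?thesis .
qed

lemma card_nrm_dvd_root:
  assumes "h \<in> MP n" "poly h t = 0"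
  shows "card {i \<in> {1..n}. t \<in> Fn i \<and> nrm i t dvd h} = order t h"
proof -
  have h: "over_F h" "h \<noteq> 0" "degree h = n" using assms(1) by (auto simp: MP_def)
  obtain e where e: "e > 0" "t \<in> Fn e" using root_in_Fn[OF h(1,2) assms(2)] by blast
  note per = period[OF e]
  have "{i \<in> {1..n}. t \<in> Fn i \<and> nrm i t dvd h} = (\<lambda>j. period t * j) ` {1..order t h}"
    (is "?L = ?R")
  proof (intro equalityI subsetI)
    fix i assume "i \<in> ?L"
    then obtain j where j: "i = period t * j" "i \<ge> 1" "nrm i t dvd h"
      by (auto simp: in_Fn_iff_period_dvd[OF e])
    then show "i \<in> ?R"
      using nrm_power_dvd_iff[OF h(1,2) e, of j] nrm_mult[OF per(2), of j] by (cases "j = 0") auto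
  next
    fix i assume "i \<in> ?R"
    then obtain j where j: "i = period t * j" "1 \<le> j" "j \<le> order t h"
      by (elim imageE) (simp only: atLeastAtMost_iff)
    then have dvd: "nrm i t dvd h"
      using nrm_power_dvd_iff[OF h(1,2) e, of j] nrm_mult[OF per(2), of j] by simp
    have "t \<in> Fn i" using j in_Fn_iff_period_dvd[OF e] by simp
    then have "degree (nrm i t) = i" using nrm_in_MP by (auto simp: MP_def)
    then have "i \<le> n" using dvd_imp_degree_le[OF dvd h(2)] h(3) by simp
    then show "i \<in> ?L" using dvd \<open>t \<in> Fn i\<close> j per(1) by auto
  qed
  then show ?thesis using per(1) by (simp add: card_image inj_on_def)
qed

text \<open>The von Mangoldt identity for polynomials, with the degree in place of the logarithm: a
  prime power of degree \<open>i\<close> equals \<open>nrm i t\<close> for as many \<open>t\<close>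
  in \<open>Fn i\<close> as the degree of its prime. Counted by roots, each root \<open>t\<close> of
  \<open>h\<close> contributes its order.\<close>

lemma count_nrm_dvd:
  assumes "h \<in> MP n"
  shows "(\<Sum>i\<in>{1..n}. card {t \<in> Fn i. nrm i t dvd h}) = n"
proof -
  have h: "h \<noteq> 0" "degree h = n" using assms by (auto simp: MP_def)
  let ?Z = "{t. poly h t = 0}"
  have fin: "finite ?Z" by (rule poly_roots_finite[OF h(1)])
  have root: "poly h t = 0" if "nrm i t dvd h" "i \<ge> 1" for i t
  proof -
    have "poly (nrm i t) t = 0" using that(2) by (auto simp: nrm_def poly_prod intro!: bexI[of _ 0])
    then show ?thesis using that(1) by (metis dvdE mult_eq_0_iff poly_mult)
  qed
  have "(\<Sum>i\<in>{1..n}. card {t \<in> Fn i. nrm i t dvd h})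
      = (\<Sum>i\<in>{1..n}. \<Sum>t\<in>?Z. if t \<in> Fn i \<and> nrm i t dvd h then 1 else 0)"
  proof (rule sum.cong[OF refl])
    fix i assume "i \<in> {1..n}"
    then have "{t \<in> Fn i. nrm i t dvd h} = {t \<in> ?Z. t \<in> Fn i \<and> nrm i t dvd h}" using root by auto
    then show "card {t \<in> Fn i. nrm i t dvd h} = (\<Sum>t\<in>?Z. if t \<in> Fn i \<and> nrm i t dvd h then 1 else 0)"
      using fin by (simp add: sum.If_cases Int_def)
  qed
  also have "\<dots> = (\<Sum>t\<in>?Z. \<Sum>i\<in>{1..n}. if t \<in> Fn i \<and> nrm i t dvd h then 1 else 0)"
    by (rule sum.swap)
  also have "\<dots> = (\<Sum>t\<in>?Z. order t h)"
    using card_nrm_dvd_root[OF assms] by (intro sum.cong refl) (simp add: sum.If_cases Int_def)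
  also have "\<dots> = n" using sum_order_eq_degree[OF h(1)] h(2) by simp
  finally show ?thesis .
qed

text \<open>Multiply the count in \<open>count_nrm_dvd\<close> by \<open>\<Lambda> h\<close>, sum
  over \<open>h\<close>, and write an \<open>h\<close> divisible by \<open>nrm i t\<close> as
  \<open>nrm i t * s\<close> with \<open>s\<close> in \<open>MP (n - i)\<close>. The result is T L'
  = L \<Sum> S_i T^i in coefficients.\<close>

lemma L_function_newton:
  fixes \<Lambda> :: "'k poly \<Rightarrow> complex"
  assumes mult: "\<And>m n g h. g \<in> MP m \<Longrightarrow> h \<in> MP n \<Longrightarrow> \<Lambda> (g * h) = \<Lambda> g * \<Lambda> h"
  shows "of_nat n * (\<Sum>h\<in>MP n. \<Lambda> h)
    = (\<Sum>i\<in>{1..n}. (\<Sum>t\<in>Fn i. \<Lambda> (nrm i t)) * (\<Sum>h\<in>MP (n - i). \<Lambda> h))"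
proof -
  have "of_nat n * (\<Sum>h\<in>MP n. \<Lambda> h)
      = (\<Sum>h\<in>MP n. \<Sum>i\<in>{1..n}. \<Sum>t\<in>Fn i. if nrm i t dvd h then \<Lambda> h else 0)"
    unfolding sum_distrib_left
  proof (rule sum.cong[OF refl])
    fix h assume h: "h \<in> MP n"
    have "of_nat n * \<Lambda> h = (\<Sum>i\<in>{1..n}. of_nat (card {t \<in> Fn i. nrm i t dvd h}) * \<Lambda> h)"
      using count_nrm_dvd[OF h] by (simp flip: sum_distrib_right of_nat_sum)
    also have "\<dots> = (\<Sum>i\<in>{1..n}. \<Sum>t\<in>Fn i. if nrm i t dvd h then \<Lambda> h else 0)"
      using finite_card_Fn(1) by (intro sum.cong refl) (simp add: sum.If_cases Int_def)
    finally show "of_nat n * \<Lambda> h = (\<Sum>i\<in>{1..n}. \<Sum>t\<in>Fn i. if nrm i t dvd h then \<Lambda> h else 0)" .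
  qed
  also have "\<dots> = (\<Sum>i\<in>{1..n}. \<Sum>t\<in>Fn i. \<Sum>h\<in>MP n. if nrm i t dvd h then \<Lambda> h else 0)"
    by (subst sum.swap) (intro sum.cong refl, rule sum.swap)
  also have "\<dots> = (\<Sum>i\<in>{1..n}. \<Sum>t\<in>Fn i. \<Lambda> (nrm i t) * (\<Sum>h\<in>MP (n - i). \<Lambda> h))"
  proof (intro sum.cong refl)
    fix i t assume i: "i \<in> {1..n}" and t: "t \<in> Fn i"
    note N = nrm_in_MP[OF t]
    have "(\<Sum>h\<in>MP n. if nrm i t dvd h then \<Lambda> h else 0) = (\<Sum>h | h \<in> MP n \<and> nrm i t dvd h. \<Lambda> h)"
      using finite_MP by (simp add: sum.If_cases Int_def)
    also have "\<dots> = (\<Sum>h\<in>MP (n - i). \<Lambda> (nrm i t * h))"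
    proof (rule sum.reindex_cong[of "\<lambda>h. nrm i t * h", OF _ _ refl])
      show "inj_on ((*) (nrm i t)) (MP (n - i))" by (simp add: inj_on_def)
      show "{h \<in> MP n. nrm i t dvd h} = (*) (nrm i t) ` MP (n - i)"
      proof (intro equalityI subsetI)
        fix h assume h: "h \<in> {h \<in> MP n. nrm i t dvd h}"
        then obtain s where s: "h = nrm i t * s" by auto
        have "s \<noteq> 0" using h s by (auto simp: MP_def)
        have "over_F s" using h N s over_F_cancel[of "nrm i t" s] by (auto simp: MP_def)
        moreover have "lead_coeff s = 1"
        proof -
          have "lead_coeff h = lead_coeff (nrm i t) * lead_coeff s" by (simp add: s lead_coeff_mult)
          moreover have "lead_coeff h = 1" "lead_coeff (nrm i t) = 1" using h N by (auto simp: MP_def)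
          ultimately show ?thesis by simp
        qed
        moreover have "degree s = n - i"
          using h N s degree_mult_eq[of "nrm i t" s] \<open>s \<noteq> 0\<close> by (auto simp: MP_def)
        ultimately show "h \<in> (*) (nrm i t) ` MP (n - i)" using s by (auto simp: MP_def)
      next
        fix h assume "h \<in> (*) (nrm i t) ` MP (n - i)"
        then show "h \<in> {h \<in> MP n. nrm i t dvd h}" using MP_mult[OF N, of _ "n - i"] i by auto
      qed
    qed
    also have "\<dots> = \<Lambda> (nrm i t) * (\<Sum>h\<in>MP (n - i). \<Lambda> h)"
      unfolding sum_distrib_left using mult[OF N] by (intro sum.cong refl) auto
    finally show "(\<Sum>h\<in>MP n. if nrm i t dvd h then \<Lambda> h else 0)
        = \<Lambda> (nrm i t) * (\<Sum>h\<in>MP (n - i). \<Lambda> h)" .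
  qed
  finally show ?thesis by (simp add: sum_distrib_right)
qed

text \<open>Only the growth rate of the even power sums enters, through a radius of convergence.
  \<open>C\<close> is absent from the conclusion and may therefore depend on
  \<open>q\<close>.\<close>

lemma character_sum_bound:
  fixes \<Lambda> :: "'k poly \<Rightarrow> complex" and k :: nat and C :: real
  assumes mult: "\<And>m n g h. g \<in> MP m \<Longrightarrow> h \<in> MP n \<Longrightarrow> \<Lambda> (g * h) = \<Lambda> g * \<Lambda> h"
    and "\<Lambda> 1 = 1"
    and vanish: "\<And>n. n > k \<Longrightarrow> (\<Sum>h\<in>MP n. \<Lambda> h) = 0"
    and bound: "\<And>s. s \<ge> 1 \<Longrightarrow> norm (\<Sum>t\<in>Fn (2 * s). \<Lambda> (nrm (2 * s) t)) \<le> C * q ^ s"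
  shows "norm (\<Sum>t\<in>F. \<Lambda> [:- t, 1:]) \<le> k * sqrt q"
proof -
  define c where "c n = (\<Sum>h\<in>MP n. \<Lambda> h)" for n
  define S where "S n = (\<Sum>t\<in>Fn n. \<Lambda> (nrm n t))" for n
  have "norm (S 1) \<le> k * sqrt q"
  proof (rule power_sum_bound_of_newton[of c S k "sqrt q" C])
    show "c 0 = 1" by (simp add: c_def MP_0 assms(2))
    show "c n = 0" if "n > k" for n using vanish[OF that] by (simp add: c_def)
    show "norm (S (2 * s)) \<le> C * sqrt q ^ (2 * s)" if "s \<ge> 1" for s
      using bound[OF that] by (simp add: S_def power_mult)
    show "of_nat (Suc n) * c (Suc n) = (\<Sum>i\<le>n. c i * S (Suc n - i))" for n
    proof -
      have "of_nat (Suc n) * c (Suc n) = (\<Sum>i\<in>{1..Suc n}. S i * c (Suc n - i))"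
        unfolding c_def S_def by (rule L_function_newton[OF mult])
      also have "\<dots> = (\<Sum>i\<le>n. c i * S (Suc n - i))"
        by (rule sum.reindex_bij_witness[of _ "\<lambda>i. Suc n - i" "\<lambda>i. Suc n - i"]) auto
      finally show ?thesis .
    qed
  qed auto
  then show ?thesis by (simp add: S_def Fn_1 nrm_def)
qed

end

section \<open>The method of Bombieri and Stepanov\<close>

text \<open>More vectors than coordinates, by Gaussian elimination of the highest coordinate. The
  linear relation supplies the coefficients of the auxiliary polynomial below.\<close>

lemma poly_family_dependent:
  fixes v :: "'i \<Rightarrow> 'a::field poly"
  assumes "finite I" "card I > N" "\<And>i j. i \<in> I \<Longrightarrow> j \<ge> N \<Longrightarrow> coeff (v i) j = 0"
  shows "\<exists>c. (\<exists>i\<in>I. c i \<noteq> 0) \<and> (\<Sum>i\<in>I. smult (c i) (v i)) = 0"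
  using assms
proof (induction N arbitrary: I v)
  case 0
  then have "v i = 0" if "i \<in> I" for i using that by (intro poly_eqI) simp
  moreover have "I \<noteq> {}" using 0 by auto
  ultimately show ?case by (intro exI[of _ "\<lambda>_. 1"]) auto
next
  case (Suc N)
  show ?case
  proof (cases "\<exists>i0\<in>I. coeff (v i0) N \<noteq> 0")
    case False
    then have "coeff (v i) j = 0" if iI: "i \<in> I" and "j \<ge> N" for i j
      using that Suc.prems(3)[of i j] by (cases "j = N") auto
    then show ?thesis using Suc.IH[of I v] Suc.prems by auto
  next
    case True
    then obtain i0 where i0: "i0 \<in> I" "coeff (v i0) N \<noteq> 0" by blast
    define r where "r i = coeff (v i) N / coeff (v i0) N" for i
    define w where "w i = v i - smult (r i) (v i0)" for i
    have w0: "coeff (w i) j = 0" if "i \<in> I - {i0}" "j \<ge> N" for i j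
      using that Suc.prems(3)[of i j] Suc.prems(3)[of i0 j] i0 by (cases "j = N") (auto simp: w_def r_def)
    have "card (I - {i0}) > N" using Suc.prems i0 by simp
    then obtain c i1 where c: "i1 \<in> I - {i0}" "c i1 \<noteq> 0" "(\<Sum>i\<in>I - {i0}. smult (c i) (w i)) = 0"
      using Suc.IH[of "I - {i0}" w] Suc.prems(1) w0 by blast
    define c' where "c' = c(i0 := - (\<Sum>i\<in>I - {i0}. c i * r i))"
    have "(\<Sum>i\<in>I. smult (c' i) (v i)) = smult (c' i0) (v i0) + (\<Sum>i\<in>I - {i0}. smult (c i) (v i))"
      using Suc.prems(1) i0 by (simp add: sum.remove[of I i0] c'_def)
    also have "(\<Sum>i\<in>I - {i0}. smult (c i) (v i))
        = (\<Sum>i\<in>I - {i0}. smult (c i) (w i)) + (\<Sum>i\<in>I - {i0}. smult (c i * r i) (v i0))"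
      by (simp add: w_def smult_diff_right sum_subtractf)
    also have "smult (c' i0) (v i0) + \<dots> = 0"
      using c(3) by (simp add: c'_def smult_sum flip: smult_add_left)
    finally show ?thesis using c by (intro exI[of _ c']) (auto simp: c'_def)
  qed
qed

text \<open>The term of largest degree cannot cancel. This serves the trace fibres; the next lemma,
  with the lowest order at a point, serves the norm fibres.\<close>

lemma sum_nonzero_distinct_degrees:
  fixes w :: "'i \<Rightarrow> 'a::idom poly"
  assumes "finite I" "inj_on (\<lambda>i. degree (w i)) I" "\<And>i. i \<in> I \<Longrightarrow> w i \<noteq> 0" "\<exists>i\<in>I. c i \<noteq> 0"
  shows "(\<Sum>i\<in>I. smult (c i) (w i)) \<noteq> 0"
proof -
  define J where "J = {i \<in> I. c i \<noteq> 0}"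
  have J: "finite J" "J \<noteq> {}" using assms by (auto simp: J_def)
  obtain i0 where i0: "i0 \<in> J" "\<And>i. i \<in> J \<Longrightarrow> degree (w i) \<le> degree (w i0)"
    using obtains_MAX[OF J, of "\<lambda>i. degree (w i)"] J(1) by (metis Max_ge finite_imageI imageI)
  have "coeff (\<Sum>i\<in>I. smult (c i) (w i)) (degree (w i0)) = (\<Sum>i\<in>I. c i * coeff (w i) (degree (w i0)))"
    by (simp add: coeff_sum)
  also have "\<dots> = (\<Sum>i\<in>{i0}. c i * coeff (w i) (degree (w i0)))"
  proof (rule sum.mono_neutral_right)
    show "\<forall>i\<in>I - {i0}. c i * coeff (w i) (degree (w i0)) = 0"
    proof
      fix i assume i: "i \<in> I - {i0}"
      show "c i * coeff (w i) (degree (w i0)) = 0"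
      proof (cases "c i = 0")
        case False
        then have "degree (w i) \<le> degree (w i0)" using i0(2)[of i] i by (auto simp: J_def)
        moreover have "degree (w i) \<noteq> degree (w i0)"
          using assms(2) i i0(1) by (auto simp: inj_on_def J_def)
        ultimately show ?thesis by (simp add: coeff_eq_0)
      qed simp
    qed
  qed (use assms i0 in \<open>auto simp: J_def\<close>)
  also have "\<dots> \<noteq> 0" using i0 assms(3) by (auto simp: J_def)
  finally show ?thesis by auto
qed

lemma sum_nonzero_distinct_orders:
  fixes w :: "'i \<Rightarrow> 'a::idom poly"
  assumes "finite I" "inj_on (\<lambda>i. order z (w i)) I" "\<And>i. i \<in> I \<Longrightarrow> w i \<noteq> 0" "\<exists>i\<in>I. c i \<noteq> 0"
  shows "(\<Sum>i\<in>I. smult (c i) (w i)) \<noteq> 0"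
proof
  assume sum0: "(\<Sum>i\<in>I. smult (c i) (w i)) = 0"
  define J where "J = {i \<in> I. c i \<noteq> 0}"
  have J: "finite J" "J \<noteq> {}" using assms by (auto simp: J_def)
  obtain i0 where i0: "i0 \<in> J" "\<And>i. i \<in> J \<Longrightarrow> order z (w i0) \<le> order z (w i)"
    using arg_min_if_finite[OF J, of "\<lambda>i. order z (w i)"] by (metis linorder_not_le)
  define n where "n = Suc (order z (w i0))"
  have "smult (c i0) (w i0) = - (\<Sum>i\<in>I - {i0}. smult (c i) (w i))"
    using sum0 assms(1) i0 by (simp add: sum.remove[of I i0] J_def eq_neg_iff_add_eq_0)
  moreover have "[:-z, 1:] ^ n dvd (\<Sum>i\<in>I - {i0}. smult (c i) (w i))"
  proof (rule dvd_sum)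
    fix i assume i: "i \<in> I - {i0}"
    show "[:-z, 1:] ^ n dvd smult (c i) (w i)"
    proof (cases "c i = 0")
      case False
      then have "order z (w i0) \<le> order z (w i)" using i0(2)[of i] i by (auto simp: J_def)
      moreover have "order z (w i0) \<noteq> order z (w i)"
        using assms(2) i i0(1) by (auto simp: inj_on_def J_def)
      ultimately have "n \<le> order z (w i)" by (simp add: n_def)
      then show ?thesis by (intro dvd_smult) (simp add: order_divides)
    qed simp
  qed
  ultimately have "[:-z, 1:] ^ n dvd smult (c i0) (w i0)" by simp
  then have "n \<le> order z (smult (c i0) (w i0))"
    using i0 assms(3) by (subst (asm) order_divides) (auto simp: J_def)
  then show False using i0 by (simp add: n_def J_def order_smult)
qed

text \<open>
  The auxiliary polynomial of Bombieri and Stepanov. On the point set, \<open>x \<mapsto> x ^ P\<close> is an involution,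
  so a polynomial of small degree in \<open>x ^ P\<close> agrees there with one of small degree in \<open>x\<close>; if the
  latter is identically zero, the former has many roots.
\<close>

lemma stepanov_bound:
  fixes A :: "'a::field set" and U B :: "'a poly" and W :: "nat \<Rightarrow> 'a poly"
  assumes invol: "\<And>x. x \<in> A \<Longrightarrow> (x ^ P) ^ P = x"
    and frob: "\<And>x. (x - z) ^ P = x ^ P - z ^ P"
    and W: "\<And>i x. i < n \<Longrightarrow> x \<in> A \<Longrightarrow> poly (W i) x = poly B x * poly U (x ^ P) ^ i"
    and B: "\<And>x. x \<in> A \<Longrightarrow> poly B x \<noteq> 0"
    and degW: "\<And>i. i < n \<Longrightarrow> degree (W i) \<le> w" and degU: "degree U \<le> u"
    and count: "P * (D - 1) + l + w < n * l * D" and "P > 0"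
    and indep: "\<And>c. \<exists>i\<in>{..<n} \<times> {..<l} \<times> {..<D}. c i \<noteq> 0 \<Longrightarrow>
      (\<Sum>i\<in>{..<n} \<times> {..<l} \<times> {..<D}. smult (c i)
        (case i of (a, b, e) \<Rightarrow> [:-z, 1:] ^ (e + P * b) * U ^ a)) \<noteq> 0"
  shows "finite A \<and> card A \<le> (D - 1) + P * (l - 1) + (n - 1) * u"
proof -
  define I where "I = {..<n} \<times> {..<l} \<times> {..<D}"
  \<comment> \<open>Put y = x ^ P. On the point set, \<open>B\<close> times (y - z)^(e + P b) U(y)^a
    takes the values of \<open>v\<close>: (y - z)^(P b) collapses to (x - z ^ P)^b, and
    \<open>W a\<close> replaces B U(y)^a. So \<open>v\<close> has small degree, and
    \<open>count\<close> provides more triples than coefficients.\<close>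
  define v where "v = (\<lambda>(a, b, e). (monom 1 P - [:z:]) ^ e * [:- (z ^ P), 1:] ^ b * W a)"
  define r where "r = (\<lambda>(a, b, e). [:-z, 1:] ^ (e + P * b) * U ^ a)"
  have deg_v: "coeff (v i) j = 0" if iI: "i \<in> I" and "j \<ge> P * (D - 1) + l + w" for i j
  proof -
    obtain a b e where i: "i = (a, b, e)" "a < n" "b < l" "e < D"
      using iI by (cases i) (auto simp: I_def)
    have "degree (monom 1 P - [:z:]) \<le> P"
      by (intro degree_diff_le) (auto simp: degree_monom_le)
    then have "degree ((monom 1 P - [:z:]) ^ e) \<le> P * e"
      by (meson degree_power_le le_trans mult_le_mono1)
    moreover have "degree ([:- (z ^ P), 1:] ^ b) = b" by (simp add: degree_linear_power)
    ultimately have "degree (v i) \<le> P * e + b + w"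
      unfolding v_def i using degW[OF i(2)]
      by (auto intro!: order_trans[OF degree_mult_le] add_mono)
    also have "P * e \<le> P * (D - 1)" using i by (intro mult_le_mono2) simp
    finally have "degree (v i) < j" using that(2) i by linarith
    then show ?thesis by (rule coeff_eq_0)
  qed
  have "finite I" "card I = n * l * D" by (simp_all add: I_def card_cartesian_product)
  then obtain c where c: "\<exists>i\<in>I. c i \<noteq> 0" "(\<Sum>i\<in>I. smult (c i) (v i)) = 0"
    using poly_family_dependent[of I "P * (D - 1) + l + w" v] deg_v count by auto
  define \<rho> where "\<rho> = (\<Sum>i\<in>I. smult (c i) (r i))"
  have "\<rho> \<noteq> 0" using indep[of c] c(1) by (simp add: \<rho>_def r_def I_def)
  have deg_\<rho>: "degree \<rho> \<le> (D - 1) + P * (l - 1) + (n - 1) * u"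
    unfolding \<rho>_def
  proof (rule degree_sum_le[OF \<open>finite I\<close>])
    fix i assume "i \<in> I"
    then obtain a b e where i: "i = (a, b, e)" "a < n" "b < l" "e < D"
      by (cases i) (auto simp: I_def)
    have "degree (r i) \<le> (e + P * b) + a * u"
    proof -
      have "degree (U ^ a) \<le> a * u"
        using order_trans[OF degree_power_le mult_le_mono1[OF degU], of a] by (simp add: mult.commute)
      then show ?thesis
        using degree_mult_le[of "[:-z, 1:] ^ (e + P * b)" "U ^ a"] degree_linear_power[of "-z" "e + P * b"]
        by (simp add: r_def i)
    qed
    also have "\<dots> \<le> (D - 1) + P * (l - 1) + (n - 1) * u"
      using i by (intro add_mono mult_le_mono) auto
    finally show "degree (smult (c i) (r i)) \<le> (D - 1) + P * (l - 1) + (n - 1) * u"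
      using degree_smult_le order_trans by blast
  qed
  have root: "poly \<rho> (x ^ P) = 0" if x: "x \<in> A" for x
  proof -
    have "poly B x * poly (r i) (x ^ P) = poly (v i) x" if iI: "i \<in> I" for i
    proof -
      obtain a b e where i: "i = (a, b, e)" "a < n" using iI by (cases i) (auto simp: I_def)
      have "(x ^ P - z) ^ (P * b) = (x - z ^ P) ^ b"
        by (simp add: power_mult frob invol[OF x])
      then show ?thesis
        unfolding r_def v_def i using W[OF i(2) x]
        by (simp add: poly_monom power_add mult_ac)
    qed
    then have "poly B x * poly \<rho> (x ^ P) = poly (\<Sum>i\<in>I. smult (c i) (v i)) x"
      by (simp add: \<rho>_def poly_sum sum_distrib_left mult.left_commute)
    then show ?thesis using B[OF x] c(2) by simp
  qed
  have inj: "inj_on (\<lambda>x. x ^ P) A" by (rule inj_on_inverseI[of A "\<lambda>x. x ^ P"]) (rule invol)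
  have sub: "(\<lambda>x. x ^ P) ` A \<subseteq> {y. poly \<rho> y = 0}" using root by auto
  have fin: "finite {y. poly \<rho> y = 0}" by (rule poly_roots_finite[OF \<open>\<rho> \<noteq> 0\<close>])
  have "card A = card ((\<lambda>x. x ^ P) ` A)" using inj by (simp add: card_image)
  also have "\<dots> \<le> card {y. poly \<rho> y = 0}" using sub fin by (rule card_mono[rotated])
  also have "\<dots> \<le> degree \<rho>" by (rule card_poly_roots_bound[OF \<open>\<rho> \<noteq> 0\<close>])
  finally show ?thesis using deg_\<rho> finite_imageD[OF finite_subset[OF sub fin] inj] by linarith
qed

lemma sum_lessThan_add:
  fixes f :: "nat \<Rightarrow> 'a::comm_monoid_add"
  shows "(\<Sum>j<m + n. f j) = (\<Sum>j<m. f j) + (\<Sum>j<n. f (m + j))"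
  by (induction n) (simp_all add: add.assoc)

lemma order_power:
  fixes f :: "'a::idom poly"
  assumes "f \<noteq> 0" shows "order z (f ^ n) = n * order z f"
  using assms by (induction n) (simp_all add: order_mult)

context finite_subfield begin

definition tr :: "nat \<Rightarrow> 'k \<Rightarrow> 'k" where "tr n y = (\<Sum>j<n. y ^ (q ^ j))"

definition nexp :: "nat \<Rightarrow> nat" where "nexp n = (\<Sum>j<n. q ^ j)"

lemma nexp_eq: "q ^ n = Suc ((q - 1) * nexp n)"
proof (induction n)
  case (Suc n)
  obtain c where "q = Suc c" using q_gt_0 by (cases q) auto
  with Suc show ?case by (simp add: nexp_def algebra_simps)
qed (simp add: nexp_def)

lemma nexp_pos: "n > 0 \<Longrightarrow> nexp n > 0"
  unfolding nexp_def by (rule sum_pos2[of _ 0]) auto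

lemma nexp_double: "nexp (2 * s) = nexp s + q ^ s * nexp s"
  unfolding nexp_def mult_2 sum_lessThan_add by (simp add: power_add sum_distrib_left)

text \<open>With P = q ^ s and y = x ^ P, the second half of the trace is U(y) and the first half is
  a polynomial in x, so U(y) = V(x) on the fibre. The degrees e + D (q b + m i) of the products are
  distinct: e is the residue modulo D, and i is determined modulo q because m is prime to q.\<close>

lemma card_trace_fibre:
  fixes G :: "'k poly"
  assumes "s \<ge> 1" and m: "degree G = m" "m \<ge> 1" and cop: "coprime m q"
  shows "q * card {x \<in> Fn (2 * s). tr (2 * s) (poly G x) = a} \<le> q ^ (2 * s) + q * (2 * m * q ^ s)"
proof -
  obtain s' where s': "s = Suc s'" using \<open>s \<ge> 1\<close> by (cases s) auto
  define D where "D = q ^ s'"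
  define P where "P = q ^ s"
  have P: "P = q * D" by (simp add: P_def D_def s')
  have "D > 0" by (simp add: D_def)
  define A where "A = {x \<in> Fn (2 * s). tr (2 * s) (poly G x) = a}"
  define V where "V = [:a:] - (\<Sum>j<s. G ^ (q ^ j))"
  define U where "U = (\<Sum>j<s. frobp s G ^ (q ^ j))"
  have deg_pow: "degree (H ^ (q ^ j)) = m * q ^ j" if "degree H = m" for H :: "'k poly" and j
    using that m(2) by (subst degree_power_eq) auto
  have deg_le: "degree (\<Sum>j<i. H ^ (q ^ j)) \<le> m * q ^ (i - 1)" if "degree H = m" for H :: "'k poly" and i
    using q_ge_2 by (intro degree_sum_le) (auto simp: deg_pow[OF that] intro!: power_increasing)
  have degV: "degree V \<le> m * D"
    unfolding V_def D_def using deg_le[OF m(1), of s] s' by (intro degree_diff_le) auto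
  have degU: "degree U = m * D"
  proof -
    have "degree (\<Sum>j<s'. frobp s G ^ (q ^ j)) < m * D"
    proof (cases s')
      case 0
      then show ?thesis using m(2) \<open>D > 0\<close> by simp
    next
      case (Suc t)
      have "degree (\<Sum>j<s'. frobp s G ^ (q ^ j)) \<le> m * q ^ t"
        using deg_le[of "frobp s G" s'] m(1) by (simp add: Suc del: sum.lessThan_Suc)
      also have "\<dots> < m * D" using m(2) q_ge_2 by (simp add: D_def Suc)
      finally show ?thesis .
    qed
    moreover have "degree (frobp s G ^ (q ^ s')) = m * D"
      using deg_pow[of "frobp s G" s'] m(1) by (simp add: D_def)
    ultimately show ?thesis unfolding U_def s' by (simp add: degree_add_eq_right)
  qed
  have "U \<noteq> 0" using degU m(2) \<open>D > 0\<close> by auto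
  \<comment> \<open>Here l = D + m. The surplus m over D = P / q makes up for the degree (q - 1) m D
    of the powers of \<open>V\<close>, and it raises the final count by no more than m P.\<close>
  have "finite A \<and> card A \<le> (D - 1) + P * (D + m - 1) + (q - 1) * (m * D)"
  proof (rule stepanov_bound[where z = 0 and B = 1 and W = "\<lambda>i. V ^ i" and U = U and w = "(q - 1) * (m * D)"])
    show "(x ^ P) ^ P = x" if "x \<in> A" for x
      using that by (simp add: A_def Fn_def P_def frob_frob mult_2)
    show "(x - 0) ^ P = x ^ P - 0 ^ P" for x :: 'k by (simp add: P_def)
    show "poly (V ^ i) x = poly 1 x * poly U (x ^ P) ^ i" if "x \<in> A" for i x
    proof -
      have "a = (\<Sum>j<s. poly G x ^ (q ^ j)) + (\<Sum>j<s. poly G x ^ (q ^ (s + j)))"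
        using that unfolding A_def tr_def mult_2 sum_lessThan_add by simp
      moreover have "poly U (x ^ P) = (\<Sum>j<s. poly G x ^ (q ^ (s + j)))"
        by (simp add: U_def poly_sum poly_power P_def poly_frobp frob_frob)
      ultimately show ?thesis by (simp add: V_def poly_sum)
    qed
    show "poly 1 x \<noteq> 0" for x :: 'k by simp
    show "degree (V ^ i) \<le> (q - 1) * (m * D)" if "i < q" for i
    proof -
      have "degree (V ^ i) \<le> m * D * i" using degree_power_le[of V i] mult_le_mono1[OF degV, of i] by linarith
      also have "\<dots> \<le> m * D * (q - 1)" using that by (intro mult_le_mono2) auto
      finally show ?thesis by (simp add: mult_ac)
    qed
    show "degree U \<le> m * D" using degU by simp
    show "P * (D - 1) + (D + m) + (q - 1) * (m * D) < q * (D + m) * D"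
    proof -
      obtain D' where "D = Suc D'" using \<open>D > 0\<close> by (cases D) auto
      moreover obtain c where "q = Suc (Suc c)" using q_ge_2 by (metis add_2_eq_Suc le_Suc_ex)
      ultimately show ?thesis unfolding P by (simp add: algebra_simps)
    qed
    show "P > 0" by (simp add: P_def)
    let ?w = "\<lambda>(a, b, e). [:-0, 1:] ^ (e + P * b) * U ^ a"
    have deg: "degree (?w (i, b, e)) = e + D * (q * b + m * i)" for i b e
      using \<open>U \<noteq> 0\<close> degU
      by (simp add: degree_mult_eq degree_power_eq degree_linear_power P algebra_simps del: mult_pCons_left)
    show "(\<Sum>i\<in>{..<q} \<times> {..<D + m} \<times> {..<D}. smult (c i) (?w i)) \<noteq> 0"
      if c: "\<exists>i\<in>{..<q} \<times> {..<D + m} \<times> {..<D}. c i \<noteq> 0" for c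
    proof (rule sum_nonzero_distinct_degrees[OF _ _ _ c])
      show "inj_on (\<lambda>i. degree (?w i)) ({..<q} \<times> {..<D + m} \<times> {..<D})"
      proof (rule inj_onI)
        fix x y assume xy: "x \<in> {..<q} \<times> {..<D + m} \<times> {..<D}" "y \<in> {..<q} \<times> {..<D + m} \<times> {..<D}"
          "degree (?w x) = degree (?w y)"
        obtain i b e i' b' e' where eq: "x = (i, b, e)" "y = (i', b', e')" by (cases x, cases y) auto
        have *: "i < q" "i' < q" "e < D" "e' < D" "e + D * (q * b + m * i) = e' + D * (q * b' + m * i')"
          using xy unfolding eq deg by auto
        have "e = (e + D * (q * b + m * i)) mod D" using *(3) by simp
        also have "\<dots> = e'" unfolding *(5) using *(4) by simp
        finally have "e = e'" .
        then have **: "q * b + m * i = q * b' + m * i'" using *(5) \<open>D > 0\<close> by simp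
        then have "int q * (int b' - int b) = int m * (int i - int i')"
          by (simp add: algebra_simps flip: of_nat_mult of_nat_add)
        then have "int q dvd int m * (int i - int i')" by (metis dvd_triv_left)
        then have "int q dvd int i - int i'"
          using cop by (simp add: coprime_dvd_mult_right_iff coprime_commute)
        then have "i = i'" using *(1,2) dvd_imp_le_int[of "int i - int i'" "int q"] by fastforce
        then show "x = y" using ** \<open>e = e'\<close> eq by simp
      qed
    qed (use \<open>U \<noteq> 0\<close> in auto)
  qed
  then have "card A \<le> (D - 1) + P * (D + m - 1) + (q - 1) * (m * D)" by blast
  also have "\<dots> \<le> P * D + 2 * m * P"
  proof -
    obtain D' where "D = Suc D'" using \<open>D > 0\<close> by (cases D) auto
    moreover obtain c where "q = Suc (Suc c)" using q_ge_2 by (metis add_2_eq_Suc le_Suc_ex)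
    ultimately show ?thesis unfolding P by (simp add: algebra_simps)
  qed
  finally have "q * card A \<le> q * (P * D + 2 * m * P)" by simp
  also have "\<dots> = q ^ (2 * s) + q * (2 * m * q ^ s)"
  proof -
    have "q ^ (2 * s) = P * P" by (simp add: P_def mult_2 power_add)
    then show ?thesis by (simp add: P algebra_simps P_def[symmetric])
  qed
  finally show ?thesis unfolding A_def .
qed

text \<open>With D = (q ^ s - 1) / (q - 1) and y = x ^ P, the norm of f(x) is f(x)^D U(y). So U(y) =
  b / f(x)^D on the fibre, and \<open>B\<close> clears the denominators of the powers used.
  Independence comes from orders at z = r ^ P: the conjugate of f has a simple zero there,
  \<open>U\<close> has order exactly D, and e + D i + P b with e < D and e + D i < P is a mixed
  radix expansion.\<close>

lemma card_norm_fibre: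
  fixes f :: "'k poly"
  assumes "s \<ge> 1" and m: "degree f = m" and "q \<ge> 3" and f: "f = [:-r, 1:] * g" "poly g r \<noteq> 0" and "b \<noteq> 0"
  shows "(q - 1) * card {x \<in> Fn (2 * s). poly f x ^ nexp (2 * s) = b} \<le> q ^ (2 * s) + (q - 1) * (2 * m * q ^ s)"
proof -
  define D where "D = nexp s"
  define P where "P = q ^ s"
  obtain c where c: "q = Suc (Suc (Suc c))" using \<open>q \<ge> 3\<close> by (metis One_nat_def Suc_1 add_Suc le_Suc_ex numeral_3_eq_3 plus_1_eq_Suc)
  have P: "P = Suc (Suc (Suc c) * D)" using nexp_eq[of s] by (simp add: P_def D_def c)
  have "D > 0" using nexp_pos[of s] \<open>s \<ge> 1\<close> by (simp add: D_def)
  then obtain D' where D': "D = Suc D'" by (cases D) auto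
  have "g \<noteq> 0" using f by auto
  then have "f \<noteq> 0" by (simp add: f(1) del: mult_pCons_left)
  have "m \<ge> 1" using m \<open>g \<noteq> 0\<close> by (simp add: f(1) degree_mult_eq del: mult_pCons_left)
  define A where "A = {x \<in> Fn (2 * s). poly f x ^ nexp (2 * s) = b}"
  define z where "z = r ^ P"
  define U where "U = frobp s f ^ D"
  have ff: "frobp s f = [:-z, 1:] * frobp s g"
    by (simp only: f(1) frobp_mult frobp_linear z_def P_def)
  have gz: "poly (frobp s g) z \<noteq> 0" using f(2) by (simp add: z_def P_def poly_frobp)
  then have "frobp s f \<noteq> 0" unfolding ff mult_eq_0_iff by auto
  then have "U \<noteq> 0" by (simp add: U_def)
  have "order z (frobp s f) = 1"
    using gz \<open>frobp s f \<noteq> 0\<close> order_power_n_n[of z 1] unfolding ff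
    by (subst order_mult) (auto simp: order_0I)
  then have order_U: "order z U = D"
    using \<open>frobp s f \<noteq> 0\<close> by (simp add: U_def order_power)
  have "finite A \<and> card A \<le> (D - 1) + P * (D + m - 1) + (q - 1 - 1) * (m * D)"
  proof (rule stepanov_bound[where z = z and B = "f ^ (D * (q - 2))" and U = U and w = "(q - 2) * (m * D)"
        and W = "\<lambda>i. smult (b ^ i) (f ^ (D * (q - 2 - i)))"])
    show "(x ^ P) ^ P = x" if "x \<in> A" for x
      using that by (simp add: A_def Fn_def P_def frob_frob mult_2)
    show "(x - z) ^ P = x ^ P - z ^ P" for x unfolding P_def by (rule frob_diff)
    have b_eq: "b = poly f x ^ D * poly U (x ^ P)" if "x \<in> A" for x
    proof -
      have "b = poly f x ^ (D + P * D)" using that by (simp add: A_def nexp_double D_def P_def)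
      then show ?thesis by (simp add: U_def P_def poly_frobp power_add power_mult)
    qed
    show "poly (smult (b ^ i) (f ^ (D * (q - 2 - i)))) x = poly (f ^ (D * (q - 2))) x * poly U (x ^ P) ^ i"
      if "i < q - 1" "x \<in> A" for i x
    proof -
      have "q - 2 = i + (q - 2 - i)" using that(1) by simp
      then have "poly (f ^ (D * (q - 2))) x = (poly f x ^ D) ^ i * poly f x ^ (D * (q - 2 - i))"
        by (metis add_mult_distrib2 poly_power power_add power_mult)
      then show ?thesis
        by (subst b_eq[OF that(2)]) (simp add: power_mult_distrib mult_ac)
    qed
    show "poly (f ^ (D * (q - 2))) x \<noteq> 0" if "x \<in> A" for x
      using b_eq[OF that] \<open>b \<noteq> 0\<close> \<open>D > 0\<close> by auto
    show "degree (smult (b ^ i) (f ^ (D * (q - 2 - i)))) \<le> (q - 2) * (m * D)" if "i < q - 1" for i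
    proof -
      have "degree (f ^ (D * (q - 2 - i))) \<le> m * (D * (q - 2 - i))"
        using degree_power_le[of f "D * (q - 2 - i)"] m by simp
      also have "\<dots> \<le> m * (D * (q - 2))" by (intro mult_le_mono2) simp
      finally show ?thesis using \<open>b \<noteq> 0\<close> by (simp add: mult_ac)
    qed
    show "degree U \<le> m * D" using degree_power_le[of "frobp s f" D] m by (simp add: U_def)
    show "P * (D - 1) + (D + m) + (q - 2) * (m * D) < (q - 1) * (D + m) * D"
      unfolding P c D' by (simp add: algebra_simps)
    show "P > 0" by (simp add: P_def)
    let ?w = "\<lambda>(a, b, e). [:-z, 1:] ^ (e + P * b) * U ^ a"
    have ord: "order z (?w (i, b, e)) = e + P * b + D * i" for i b e
      using \<open>U \<noteq> 0\<close> order_U by (simp add: order_mult order_power order_power_n_n mult.commute del: mult_pCons_left)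
    show "(\<Sum>i\<in>{..<q - 1} \<times> {..<D + m} \<times> {..<D}. smult (c i) (?w i)) \<noteq> 0"
      if c: "\<exists>i\<in>{..<q - 1} \<times> {..<D + m} \<times> {..<D}. c i \<noteq> 0" for c
    proof (rule sum_nonzero_distinct_orders[OF _ _ _ c, where z = z])
      show "inj_on (\<lambda>i. order z (?w i)) ({..<q - 1} \<times> {..<D + m} \<times> {..<D})"
      proof (rule inj_onI)
        fix x y assume xy: "x \<in> {..<q - 1} \<times> {..<D + m} \<times> {..<D}" "y \<in> {..<q - 1} \<times> {..<D + m} \<times> {..<D}"
          "order z (?w x) = order z (?w y)"
        obtain i b e i' b' e' where eq: "x = (i, b, e)" "y = (i', b', e')" by (cases x, cases y) auto
        have *: "i < q - 1" "i' < q - 1" "e < D" "e' < D" "(e + D * i) + P * b = (e' + D * i') + P * b'"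
          using xy unfolding eq ord by auto
        have lt: "j + D * l < P" if "j < D" "l < q - 1" for j l
        proof -
          have "D * l \<le> D * (q - 2)" using that(2) by (intro mult_le_mono2) simp
          then show ?thesis using that(1) unfolding P by (simp add: \<open>q = _\<close> algebra_simps)
        qed
        have "e + D * i = ((e + D * i) + P * b) mod P" using lt[OF *(3,1)] by simp
        also have "\<dots> = e' + D * i'" unfolding *(5) using lt[OF *(4,2)] by simp
        finally have **: "e + D * i = e' + D * i'" .
        have "e = (e + D * i) mod D" using *(3) by simp
        also have "\<dots> = e'" unfolding ** using *(4) by simp
        finally have "e = e'" .
        then show "x = y" using ** *(5) \<open>D > 0\<close> lt[OF *(3,1)] by (simp add: eq)
      qed
    qed (use \<open>U \<noteq> 0\<close> in auto)
  qed
  then have "(q - 1) * card A \<le> (q - 1) * ((D - 1) + P * (D + m - 1) + (q - 1 - 1) * (m * D))" by simp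
  also have "\<dots> \<le> P * P + (q - 1) * (2 * m * P)"
    unfolding P c D' by (simp add: algebra_simps)
  also have "P * P = q ^ (2 * s)" by (simp add: P_def mult_2 power_add)
  finally show ?thesis unfolding A_def P_def .
qed

end

section \<open>Characters\<close>

lemma norm_eq_1_of_power_eq_1:
  fixes z :: complex
  assumes "z ^ n = 1" "n > 0" shows "norm z = 1"
proof -
  have "norm z ^ n = 1" using assms(1) by (metis norm_one norm_power)
  then show ?thesis using assms(2) by (metis norm_ge_zero power_eq_imp_eq_base power_one zero_le_one)
qed

text \<open>As \<psi> has sum 0, the weights \<phi> may be replaced by B - \<phi>. These are
  nonnegative, so their total bounds the sum; upper bounds for \<phi> close to its average thus give
  cancellation.\<close>

lemma weighted_sum_bound_one_sided:
  fixes \<psi> :: "'a \<Rightarrow> complex" and \<phi> :: "'a \<Rightarrow> real" and B :: real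
  assumes "finite H" and "\<And>a. a \<in> H \<Longrightarrow> norm (\<psi> a) \<le> 1" and "(\<Sum>a\<in>H. \<psi> a) = 0"
    and "\<And>a. a \<in> H \<Longrightarrow> \<phi> a \<le> B"
  shows "norm (\<Sum>a\<in>H. of_real (\<phi> a) * \<psi> a) \<le> card H * B - (\<Sum>a\<in>H. \<phi> a)"
proof -
  have "(\<Sum>a\<in>H. of_real (B - \<phi> a) * \<psi> a) = of_real B * (\<Sum>a\<in>H. \<psi> a) - (\<Sum>a\<in>H. of_real (\<phi> a) * \<psi> a)"
    by (simp add: algebra_simps sum_subtractf sum_distrib_left)
  then have "norm (\<Sum>a\<in>H. of_real (\<phi> a) * \<psi> a) = norm (\<Sum>a\<in>H. of_real (B - \<phi> a) * \<psi> a)"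
    using assms(3) by (simp add: norm_minus_commute)
  also have "\<dots> \<le> (\<Sum>a\<in>H. (B - \<phi> a) * 1)"
  proof (rule sum_norm_le)
    fix a assume "a \<in> H"
    then show "norm (of_real (B - \<phi> a) * \<psi> a) \<le> (B - \<phi> a) * 1"
      unfolding norm_mult norm_of_real using assms(2,4)[of a] by (intro mult_mono) auto
  qed
  also have "\<dots> = card H * B - (\<Sum>a\<in>H. \<phi> a)" by (simp add: sum_subtractf)
  finally show ?thesis .
qed

lemma sum_comp_eq_sum_card_fibres:
  fixes \<psi> :: "'b \<Rightarrow> complex"
  assumes "finite A" "finite H" "\<And>x. x \<in> A \<Longrightarrow> T x \<in> H"
  shows "(\<Sum>x\<in>A. \<psi> (T x)) = (\<Sum>a\<in>H. of_real (card {x \<in> A. T x = a}) * \<psi> a)"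
    and "(\<Sum>a\<in>H. real (card {x \<in> A. T x = a})) = card A"
proof -
  have "(\<Sum>x\<in>A. \<psi> (T x)) = (\<Sum>a\<in>H. \<Sum>x\<in>{x \<in> A. T x = a}. \<psi> (T x))"
    using assms by (intro sum.group[symmetric]) auto
  then show "(\<Sum>x\<in>A. \<psi> (T x)) = (\<Sum>a\<in>H. of_real (card {x \<in> A. T x = a}) * \<psi> a)" by simp
  have "(\<Sum>a\<in>H. \<Sum>x\<in>{x \<in> A. T x = a}. 1 :: real) = (\<Sum>x\<in>A. 1)"
    using assms by (intro sum.group) auto
  then show "(\<Sum>a\<in>H. real (card {x \<in> A. T x = a})) = card A" by simp
qed

context finite_subfield begin

definition add_char :: "('k \<Rightarrow> complex) \<Rightarrow> bool" where
  "add_char \<psi> \<longleftrightarrow> \<psi> 0 = 1 \<and> (\<forall>x\<in>F. \<forall>y\<in>F. \<psi> (x + y) = \<psi> x * \<psi> y)"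

text \<open>The value at 0 is 0 for the trivial character too, so sums over \<open>F\<close> and
  over \<open>F - {0}\<close> agree.\<close>

definition mult_char :: "('k \<Rightarrow> complex) \<Rightarrow> bool" where
  "mult_char \<theta> \<longleftrightarrow> \<theta> 0 = 0 \<and> \<theta> 1 = 1 \<and> (\<forall>x\<in>F. \<forall>y\<in>F. \<theta> (x * y) = \<theta> x * \<theta> y)"

lemma norm_add_char: assumes "add_char \<psi>" "x \<in> F" shows "norm (\<psi> x) = 1"
proof -
  have "of_nat n * x \<in> F \<and> \<psi> (of_nat n * x) = \<psi> x ^ n" for n
    using assms by (induction n) (auto simp: add_char_def zero_F add_F algebra_simps)
  from this[of p] have "\<psi> x ^ p = 1" using assms by (simp add: add_char_def)
  then show ?thesis using prime_gt_0_nat[OF prime_p] by (rule norm_eq_1_of_power_eq_1)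
qed

lemma F_power: "x \<in> F \<Longrightarrow> x ^ n \<in> F" using Fn_power[of x "Suc 0"] by (simp add: Fn_1)

lemma mult_char_power: assumes "mult_char \<theta>" "x \<in> F" shows "\<theta> (x ^ n) = \<theta> x ^ n"
  using assms by (induction n) (auto simp: mult_char_def F_power)

lemma norm_mult_char: assumes "mult_char \<theta>" "x \<in> F" "x \<noteq> 0" shows "norm (\<theta> x) = 1"
proof -
  have "\<theta> x ^ (q - 1) = 1"
    using mult_char_power[OF assms(1,2), of "q - 1"] power_q_minus_1[OF assms(2,3)] assms(1)
    by (simp add: mult_char_def)
  then show ?thesis using q_ge_2 norm_eq_1_of_power_eq_1[of "\<theta> x" "q - 1"] by simp
qed

lemma norm_mult_char_le: assumes "mult_char \<theta>" "x \<in> F" shows "norm (\<theta> x) \<le> 1"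
  using norm_mult_char[OF assms] assms(1) by (cases "x = 0") (auto simp: mult_char_def)

lemma sum_add_char_eq_0:
  assumes "add_char \<psi>" "y \<in> F" "\<psi> y \<noteq> 1" shows "(\<Sum>x\<in>F. \<psi> x) = 0"
proof -
  have "bij_betw ((+) y) F F"
    by (rule bij_betwI[where g = "(+) (- y)"]) (use assms add_F uminus_F in auto)
  then have "(\<Sum>x\<in>F. \<psi> x) = (\<Sum>x\<in>F. \<psi> (y + x))" by (simp add: sum.reindex_bij_betw)
  also have "\<dots> = \<psi> y * (\<Sum>x\<in>F. \<psi> x)"
    using assms by (simp add: add_char_def sum_distrib_left)
  finally show ?thesis using assms(3) by simp
qed

lemma sum_mult_char_eq_0:
  assumes "mult_char \<theta>" "y \<in> F" "y \<noteq> 0" "\<theta> y \<noteq> 1" shows "(\<Sum>x\<in>F - {0}. \<theta> x) = 0"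
proof -
  have "bij_betw ((*) y) (F - {0}) (F - {0})"
    by (rule bij_betwI[where g = "(*) (inverse y)"])
       (use assms mult_F inverse_F in \<open>auto simp flip: mult.assoc\<close>)
  then have "(\<Sum>x\<in>F - {0}. \<theta> x) = (\<Sum>x\<in>F - {0}. \<theta> (y * x))" by (simp add: sum.reindex_bij_betw)
  also have "\<dots> = \<theta> y * (\<Sum>x\<in>F - {0}. \<theta> x)"
    using assms by (simp add: mult_char_def sum_distrib_left)
  finally show ?thesis using assms(4) by simp
qed

lemma tr_in_F: assumes "y \<in> Fn n" shows "tr n y \<in> F"
proof -
  have "tr n y ^ q = (\<Sum>j<n. y ^ (q ^ Suc j))"
    unfolding tr_def using frob_sum[of "\<lambda>j. y ^ (q ^ j)" "{..<n}" 1]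
    by (simp add: mult.commute flip: power_mult)
  also have "\<dots> + y = tr n y + y ^ (q ^ n)"
    unfolding tr_def using sum.lessThan_Suc_shift[of "\<lambda>j. y ^ (q ^ j)" n]
    by (simp add: add.commute)
  finally show ?thesis using assms by (simp add: F_iff Fn_def)
qed

lemma power_nexp: "y ^ nexp n = (\<Prod>j<n. y ^ (q ^ j))"
  unfolding nexp_def by (rule power_sum)

lemma power_nexp_in_F: assumes "y \<in> Fn n" shows "(y :: 'k) ^ nexp n \<in> F"
proof (cases "y = 0")
  case True
  then show ?thesis using one_F zero_F by (auto simp: power_0_left)
next
  case False
  have "(y ^ nexp n) ^ q * y = y ^ (nexp n * q + 1)" by (simp add: power_add power_mult)
  also have "nexp n * q + 1 = nexp n + q ^ n"
    using nexp_eq[of n] q_ge_2 by (cases q) (auto simp: algebra_simps)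
  also have "y ^ \<dots> = y ^ nexp n * y" using assms by (simp add: power_add Fn_def)
  finally show ?thesis using False by (simp add: F_iff)
qed

text \<open>A fibre exceeds the average q^(2 s) / q by at most 2 m q^s. The bound is the total
  excess of the q fibres.\<close>

lemma add_char_trace_sum_bound:
  assumes "s \<ge> 1" and \<psi>: "add_char \<psi>" "y \<in> F" "\<psi> y \<noteq> 1"
    and G: "\<And>i. coeff G i \<in> Fn (2 * s)" "degree G = m" "m \<ge> 1" "coprime m q"
  shows "norm (\<Sum>x\<in>Fn (2 * s). \<psi> (tr (2 * s) (poly G x))) \<le> 2 * m * q * q ^ s"
proof -
  let ?A = "Fn (2 * s)"
  have fin: "finite ?A" "card ?A = q ^ (2 * s)" using finite_card_Fn[of "2 * s"] \<open>s \<ge> 1\<close> by auto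
  have T: "tr (2 * s) (poly G x) \<in> F" if "x \<in> ?A" for x
    using that by (intro tr_in_F poly_Fn G(1))
  have fib: "(\<Sum>x\<in>?A. \<psi> (tr (2 * s) (poly G x)))
      = (\<Sum>a\<in>F. of_real (card {x \<in> ?A. tr (2 * s) (poly G x) = a}) * \<psi> a)"
    "card ?A = (\<Sum>a\<in>F. real (card {x \<in> ?A. tr (2 * s) (poly G x) = a}))"
    using sum_comp_eq_sum_card_fibres[OF fin(1) finite_F T] by auto
  have bound: "real (card {x \<in> ?A. tr (2 * s) (poly G x) = a}) \<le> real q ^ (2 * s) / q + 2 * m * q ^ s" for a
  proof -
    have "real (q * card {x \<in> ?A. tr (2 * s) (poly G x) = a}) \<le> real (q ^ (2 * s) + q * (2 * m * q ^ s))"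
      using card_trace_fibre[OF \<open>s \<ge> 1\<close> G(2-4), of a] of_nat_mono by blast
    then show ?thesis by (simp add: field_simps)
  qed
  have "norm (\<Sum>x\<in>?A. \<psi> (tr (2 * s) (poly G x))) \<le> card F * (real q ^ (2 * s) / q + 2 * m * q ^ s) - card ?A"
    unfolding fib
    by (rule weighted_sum_bound_one_sided[OF finite_F])
       (simp_all only: norm_add_char[OF \<psi>(1)] sum_add_char_eq_0[OF \<psi>] bound order_refl)
  also have "\<dots> = 2 * m * q * q ^ s" unfolding fin(2) q_def[symmetric] by (simp add: field_simps)
  finally show ?thesis by simp
qed

lemma mult_char_norm_sum_bound:
  assumes "s \<ge> 1" and \<theta>: "mult_char \<theta>" "y \<in> F" "y \<noteq> 0" "\<theta> y \<noteq> 1"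
    and f: "\<And>i. coeff f i \<in> Fn (2 * s)" "degree f = m" "f = [:-r, 1:] * g" "poly g r \<noteq> 0"
  shows "norm (\<Sum>x\<in>Fn (2 * s). \<theta> (poly f x ^ nexp (2 * s))) \<le> 2 * m * q * q ^ s"
proof -
  let ?A = "{x \<in> Fn (2 * s). poly f x \<noteq> 0}" and ?H = "F - {0}"
  have "y \<noteq> 1" using \<theta> by (auto simp: mult_char_def)
  then have "card {0, 1, y} \<le> q"
    unfolding q_def using \<theta> zero_F one_F finite_F by (intro card_mono) auto
  then have "q \<ge> 3" using \<open>y \<noteq> 1\<close> \<theta>(3) by simp
  have card_H: "card ?H = q - 1" using zero_F finite_F by (simp add: q_def)
  have "f \<noteq> 0" using f(3,4) by (metis mult_eq_0_iff pCons_eq_0_iff poly_0 zero_neq_one)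
  have fin: "finite (Fn (2 * s))" "card (Fn (2 * s)) = q ^ (2 * s)"
    using finite_card_Fn[of "2 * s"] \<open>s \<ge> 1\<close> by auto
  have T: "poly f x ^ nexp (2 * s) \<in> ?H" if "x \<in> ?A" for x
    using that power_nexp_in_F[of "poly f x" "2 * s"] poly_Fn[OF f(1)] by simp
  have fin_A: "finite ?A" using fin by simp
  have fib: "(\<Sum>x\<in>?A. \<theta> (poly f x ^ nexp (2 * s)))
      = (\<Sum>b\<in>?H. of_real (card {x \<in> ?A. poly f x ^ nexp (2 * s) = b}) * \<theta> b)"
    "card ?A = (\<Sum>b\<in>?H. real (card {x \<in> ?A. poly f x ^ nexp (2 * s) = b}))"
    using sum_comp_eq_sum_card_fibres[OF fin_A finite_Diff[OF finite_F] T] by auto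
  have bound: "real (card {x \<in> ?A. poly f x ^ nexp (2 * s) = b})
      \<le> real q ^ (2 * s) / real (q - 1) + 2 * m * q ^ s" if "b \<in> ?H" for b
  proof -
    have "card {x \<in> ?A. poly f x ^ nexp (2 * s) = b} \<le> card {x \<in> Fn (2 * s). poly f x ^ nexp (2 * s) = b}"
      using fin by (intro card_mono) auto
    then have "(q - 1) * card {x \<in> ?A. poly f x ^ nexp (2 * s) = b} \<le> q ^ (2 * s) + (q - 1) * (2 * m * q ^ s)"
      using card_norm_fibre[OF \<open>s \<ge> 1\<close> f(2) \<open>q \<ge> 3\<close> f(3,4), of b] that
      by (metis (no_types, lifting) DiffE insertI1 le_trans mult_le_mono2)
    then have "real ((q - 1) * card {x \<in> ?A. poly f x ^ nexp (2 * s) = b}) \<le> real (q ^ (2 * s) + (q - 1) * (2 * m * q ^ s))"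
      using of_nat_mono by blast
    moreover have "real (q - 1) > 0" using \<open>q \<ge> 3\<close> by simp
    ultimately show ?thesis by (simp add: field_simps)
  qed
  have "(\<Sum>x\<in>Fn (2 * s). \<theta> (poly f x ^ nexp (2 * s))) = (\<Sum>x\<in>?A. \<theta> (poly f x ^ nexp (2 * s)))"
    using fin \<theta>(1) nexp_pos[of "2 * s"] \<open>s \<ge> 1\<close>
    by (intro sum.mono_neutral_right) (auto simp: mult_char_def power_0_left)
  also have "norm \<dots> \<le> card ?H * (real q ^ (2 * s) / real (q - 1) + 2 * m * q ^ s) - card ?A"
    unfolding fib
    by (rule weighted_sum_bound_one_sided)
       (use norm_mult_char[OF \<theta>(1)] sum_mult_char_eq_0[OF \<theta>] bound in \<open>simp_all add: finite_F\<close>)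
  also have "\<dots> = real q ^ (2 * s) + real (q - 1) * (2 * m * q ^ s) - card ?A"
    using \<open>q \<ge> 3\<close> by (simp add: card_H field_simps)
  \<comment> \<open>At most m points, the zeros of \<open>f\<close>, were taken out. They are
    absorbed when the factor q - 1 is enlarged to q.\<close>
  also have "\<dots> \<le> 2 * m * q * q ^ s"
  proof -
    have "card (Fn (2 * s)) \<le> card (?A \<union> {x. poly f x = 0})"
      using fin poly_roots_finite[OF \<open>f \<noteq> 0\<close>] by (intro card_mono) auto
    also have "\<dots> \<le> card ?A + card {x. poly f x = 0}" by (rule card_Un_le)
    also have "card {x. poly f x = 0} \<le> m" using card_poly_roots_bound[OF \<open>f \<noteq> 0\<close>] f(2) by simp
    finally have "q ^ (2 * s) \<le> card ?A + m" using fin by simp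
    then have "real q ^ (2 * s) \<le> card ?A + m" by (metis of_nat_add of_nat_mono of_nat_power)
    moreover have "1 \<le> real q ^ s" using q_ge_2 by (intro one_le_power) simp
    then have "real m * 1 \<le> real m * (2 * real q ^ s)" by (intro mult_left_mono) auto
    ultimately show ?thesis using \<open>q \<ge> 3\<close> by (simp add: of_nat_diff algebra_simps)
  qed
  finally show ?thesis by simp
qed

text \<open>Every solution of t ^ nexp n = b lies in \<open>Fn n\<close>, because q ^ n = 1 + (q -
  1) nexp n and b ^ (q - 1) = 1.\<close>

lemma ex_norm_eq:
  assumes "n \<ge> 1" "b \<in> F" "b \<noteq> 0"
  obtains t where "t \<in> Fn n" "t \<noteq> 0" "t ^ nexp n = b"
proof -
  obtain t where t: "t ^ nexp n = b" using nth_root_exists[of "nexp n" b] nexp_pos[of n] assms(1) by auto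
  have "t ^ (q ^ n) = t * (t ^ nexp n) ^ (q - 1)" by (simp add: nexp_eq mult.commute power_mult)
  then have "t \<in> Fn n" using t power_q_minus_1[OF assms(2,3)] by (simp add: Fn_def)
  moreover have "t \<noteq> 0" using t assms nexp_pos[of n] by (auto simp: power_0_left)
  ultimately show ?thesis using that t by blast
qed

lemma of_nat_q_minus_1: "(of_nat (q - 1) :: 'k) = - 1"
  using q_ge_2 by (simp add: of_nat_diff)

lemma card_root_of_power: assumes "c \<noteq> (0 :: 'k)" shows "card {w. w ^ (q - 1) = c} = q - 1"
proof -
  define h :: "'k poly" where "h = monom 1 (q - 1) - [:c:]"
  have "degree h = q - 1"
    unfolding h_def diff_conv_add_uminus
    by (subst degree_add_eq_left) (use q_ge_2 in \<open>auto simp: degree_monom_eq\<close>)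
  moreover have "h \<noteq> 0" using calculation q_ge_2 by auto
  moreover have "poly (pderiv h) x \<noteq> 0" if "poly h x = 0" for x
  proof -
    have "x ^ (q - 1) = c" using that by (simp add: h_def poly_monom)
    then have "x \<noteq> 0" using assms q_ge_2 by (auto simp: power_0_left)
    then show ?thesis using of_nat_q_minus_1 by (simp add: h_def pderiv_diff pderiv_monom poly_monom)
  qed
  moreover have "{w. w ^ (q - 1) = c} = {x. poly h x = 0}" by (simp add: h_def poly_monom)
  ultimately show ?thesis using card_roots_eq_degree[of h] by simp
qed

text \<open>Hilbert 90 for finite fields: the elements of norm 1 are the powers w ^ (q - 1), each
  attained by q - 1 values of w. A norm class is t0 times these powers.\<close>

lemma sum_over_norm_class:
  fixes Y :: "'k \<Rightarrow> complex"
  assumes "n \<ge> 1" and t0: "t0 \<in> Fn n" "t0 \<noteq> 0" "t0 ^ nexp n = b"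
  shows "of_nat (q - 1) * (\<Sum>t | t \<in> Fn n \<and> t ^ nexp n = b. Y t) = (\<Sum>w\<in>Fn n - {0}. Y (t0 * w ^ (q - 1)))"
proof -
  let ?T = "{t. t \<in> Fn n \<and> t ^ nexp n = b}"
  have fin: "finite (Fn n)" using finite_card_Fn assms(1) by simp
  have pow: "(w ^ (q - 1)) ^ nexp n = 1" if "w \<in> Fn n" "w \<noteq> 0" for w
  proof -
    have "w ^ (q ^ n) = w * (w ^ (q - 1)) ^ nexp n" by (simp add: nexp_eq power_mult)
    then show ?thesis using that by (simp add: Fn_def)
  qed
  have sub: "(\<lambda>w. t0 * w ^ (q - 1)) ` (Fn n - {0}) \<subseteq> ?T"
    using t0 pow by (auto simp: Fn_mult Fn_power power_mult_distrib)
  have card: "card {w \<in> Fn n - {0}. t0 * w ^ (q - 1) = t} = q - 1" if t: "t \<in> ?T" for t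
  proof -
    have "t \<noteq> 0" using t t0 nexp_pos[of n] assms(1) by (auto simp: power_0_left)
    have "{w \<in> Fn n - {0}. t0 * w ^ (q - 1) = t} = {w. w ^ (q - 1) = t / t0}"
    proof (intro equalityI subsetI)
      fix w assume "w \<in> {w \<in> Fn n - {0}. t0 * w ^ (q - 1) = t}"
      then show "w \<in> {w. w ^ (q - 1) = t / t0}" using t0 by (auto simp: field_simps)
    next
      fix w assume "w \<in> {w. w ^ (q - 1) = t / t0}"
      then have w: "w ^ (q - 1) = t / t0" by simp
      then have "w \<noteq> 0" using \<open>t \<noteq> 0\<close> t0 q_ge_2 by (auto simp: power_0_left)
      have "w ^ (q ^ n) = w * (w ^ (q - 1)) ^ nexp n" by (simp add: nexp_eq power_mult)
      also have "(w ^ (q - 1)) ^ nexp n = 1" using t t0 unfolding w by (auto simp: power_divide)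
      finally show "w \<in> {w \<in> Fn n - {0}. t0 * w ^ (q - 1) = t}"
        using w \<open>w \<noteq> 0\<close> t0 by (simp add: Fn_def)
    qed
    then show ?thesis using card_root_of_power[of "t / t0"] \<open>t \<noteq> 0\<close> t0 by simp
  qed
  have "(\<Sum>w\<in>Fn n - {0}. Y (t0 * w ^ (q - 1)))
      = (\<Sum>t\<in>?T. \<Sum>w\<in>{w \<in> Fn n - {0}. t0 * w ^ (q - 1) = t}. Y (t0 * w ^ (q - 1)))"
    using fin sub by (intro sum.group[symmetric]) auto
  also have "\<dots> = (\<Sum>t\<in>?T. of_nat (q - 1) * Y t)"
    using card by (intro sum.cong refl) (simp del: of_nat_diff)
  finally show ?thesis by (simp add: sum_distrib_left)
qed

text \<open>This removes \<open>\<eta>\<close> from a mixed sum: it is constant on each of the q - 1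
  nonzero norm classes, and each class has a sum of size at most C / (q - 1).\<close>

lemma norm_class_sum_bound:
  fixes Y :: "'k \<Rightarrow> complex" and C :: real
  assumes "n \<ge> 1" and \<eta>: "mult_char \<eta>" and "C \<ge> 0"
    and bound: "\<And>t0. t0 \<in> Fn n \<Longrightarrow> t0 \<noteq> 0 \<Longrightarrow> norm (\<Sum>w\<in>Fn n - {0}. Y (t0 * w ^ (q - 1))) \<le> C"
  shows "norm (\<Sum>t\<in>Fn n. \<eta> (t ^ nexp n) * Y t) \<le> C"
proof -
  have fin: "finite (Fn n)" using finite_card_Fn assms(1) by simp
  have class_bound: "norm (\<Sum>t | t \<in> Fn n \<and> t ^ nexp n = b. Y t) \<le> C / real (q - 1)" if b: "b \<in> F - {0}" for b
  proof -
    obtain t0 where t0: "t0 \<in> Fn n" "t0 \<noteq> 0" "t0 ^ nexp n = b" using ex_norm_eq[OF assms(1)] b by blast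
    have "real (q - 1) * norm (\<Sum>t | t \<in> Fn n \<and> t ^ nexp n = b. Y t) \<le> C"
      using arg_cong[OF sum_over_norm_class[OF assms(1) t0, of Y], of norm] bound[OF t0(1,2)]
      by (simp add: norm_mult del: of_nat_diff)
    then show ?thesis using q_ge_2 by (simp add: field_simps)
  qed
  have "(\<Sum>t\<in>Fn n. \<eta> (t ^ nexp n) * Y t) = (\<Sum>b\<in>F. \<Sum>t\<in>{t \<in> Fn n. t ^ nexp n = b}. \<eta> (t ^ nexp n) * Y t)"
    using fin finite_F power_nexp_in_F by (intro sum.group[symmetric]) auto
  also have "\<dots> = (\<Sum>b\<in>F. \<eta> b * (\<Sum>t | t \<in> Fn n \<and> t ^ nexp n = b. Y t))"
    by (simp add: sum_distrib_left)
  also have "\<dots> = (\<Sum>b\<in>F - {0}. \<eta> b * (\<Sum>t | t \<in> Fn n \<and> t ^ nexp n = b. Y t))"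
    using \<eta> finite_F by (intro sum.mono_neutral_right) (auto simp: mult_char_def)
  also have "norm \<dots> \<le> (\<Sum>b\<in>F - {0}. 1 * (C / real (q - 1)))"
    unfolding norm_mult[symmetric]
  proof (rule sum_norm_le)
    fix b assume "b \<in> F - {0}"
    then show "norm (\<eta> b * (\<Sum>t | t \<in> Fn n \<and> t ^ nexp n = b. Y t)) \<le> 1 * (C / real (q - 1))"
      unfolding norm_mult using norm_mult_char_le[OF \<eta>] class_bound by (intro mult_mono) auto
  qed
  also have "\<dots> = C" using zero_F finite_F q_ge_2 by (simp add: card_Diff_singleton flip: q_def)
  finally show ?thesis .
qed

end

section \<open>The Weil bounds\<close>

lemma monic_prod_proots:
  fixes h :: "'a::alg_closed_field poly"
  assumes "lead_coeff h = 1" shows "h = (\<Prod>x\<in>#proots h. [:-x, 1:])"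
proof -
  have "h \<noteq> 0" using assms by auto
  from alg_closed_prod_proots(1)[OF this] show ?thesis by (simp only: assms smult_1_left)
qed

lemma poly_monic_eq_prod:
  fixes h :: "'a::alg_closed_field poly"
  assumes "lead_coeff h = 1" shows "poly h z = (\<Prod>x\<in>#proots h. z - x)"
  by (subst monic_prod_proots[OF assms]) (simp add: poly_prod_mset image_mset.compositionality o_def)

text \<open>The logarithmic derivative of \<Prod> (1 - x T): each factor contributes x T / (1 - x
  T), the series of powers of x. The fact \<open>Sx\<close> is this expansion with the denominator
  cleared.\<close>

lemma newton_identity_fps:
  fixes M :: "'a::field multiset"
  defines "E \<equiv> fps_of_poly (\<Prod>x\<in>#M. [:1, -x:])"
  shows "- fps_X * fps_deriv E = E * Abs_fps (\<lambda>m. if m = 0 then 0 else \<Sum>x\<in>#M. x ^ m)"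
  unfolding E_def
proof (induction M)
  case empty
  show ?case by (simp add: fps_zero_def[symmetric] cong: if_cong)
next
  case (add x M)
  let ?E = "fps_of_poly (\<Prod>x\<in>#M. [:1, -x:])" and ?S = "\<lambda>M. Abs_fps (\<lambda>m. if m = 0 then 0 else \<Sum>x\<in>#M. x ^ m)"
  let ?Sx = "Abs_fps (\<lambda>m. if m = 0 then 0 else x ^ m)" and ?a = "fps_const x"
  have S: "?S (add_mset x M) = ?S M + ?Sx" by (rule fps_ext) simp
  have Sx: "(1 - ?a * fps_X) * ?Sx = ?a * fps_X"
  proof (rule fps_ext)
    fix n
    show "fps_nth ((1 - ?a * fps_X) * ?Sx) n = fps_nth (?a * fps_X) n"
      by (cases n; cases "n - 1") (auto simp: left_diff_distrib mult.assoc)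
  qed
  have E: "fps_of_poly (\<Prod>x\<in>#add_mset x M. [:1, -x:]) = (1 - ?a * fps_X) * ?E"
    by (simp add: fps_of_poly_mult fps_of_poly_pCons fps_of_poly_linear fps_const_neg[symmetric] mult.commute
        del: fps_const_neg mult_pCons_left)
  have "- fps_X * fps_deriv ((1 - ?a * fps_X) * ?E)
      = ?a * fps_X * ?E + (1 - ?a * fps_X) * (- fps_X * fps_deriv ?E)"
    by (simp add: algebra_simps)
  also have "\<dots> = ((1 - ?a * fps_X) * ?Sx) * ?E + (1 - ?a * fps_X) * (?E * ?S M)"
    unfolding Sx add.IH ..
  also have "\<dots> = (1 - ?a * fps_X) * ?E * ?S (add_mset x M)"
    unfolding S by (simp add: algebra_simps)
  finally show ?case unfolding E .
qed

lemma reflect_prod_linear: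
  "reflect_poly (\<Prod>x\<in>#M. [:-x, 1:]) = (\<Prod>x\<in>#M. [:1, -x:])" for M :: "'a::field multiset"
proof (induction M)
  case (add x M)
  have "reflect_poly [:-x, 1:] = [:1, -x:]"
    by (rule poly_eqI) (auto simp: coeff_reflect_poly coeff_pCons split: nat.splits)
  then show ?case using add by (simp add: reflect_poly_mult del: mult_pCons_left)
qed simp

lemma newton_identity:
  fixes h :: "'a::alg_closed_field poly"
  assumes "lead_coeff h = 1" "degree h = n" "1 \<le> m" "m \<le> n"
  shows "(\<Sum>x\<in>#proots h. x ^ m)
    = - of_nat m * coeff h (n - m) - (\<Sum>i\<in>{1..<m}. coeff h (n - i) * (\<Sum>x\<in>#proots h. x ^ (m - i)))"
proof -
  let ?M = "proots h"
  define s where "s j = (if j = 0 then 0 else \<Sum>x\<in>#?M. x ^ j)" for j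
  let ?E = "fps_of_poly (\<Prod>x\<in>#?M. [:1, -x:])"
  have E: "fps_nth ?E i = coeff h (n - i)" if "i \<le> n" for i
    using that assms(2) unfolding fps_of_poly_nth reflect_prod_linear[symmetric] monic_prod_proots[OF assms(1), symmetric]
    by (simp add: coeff_reflect_poly)
  obtain m' where m': "m = Suc m'" using assms(3) by (cases m) auto
  have "- of_nat m * coeff h (n - m) = fps_nth (- fps_X * fps_deriv ?E) m"
    using E[OF assms(4)] by (simp add: m' algebra_simps)
  also have "\<dots> = fps_nth (?E * Abs_fps s) m"
    unfolding s_def by (subst newton_identity_fps) simp
  also have "\<dots> = (\<Sum>i\<in>{0..m}. coeff h (n - i) * s (m - i))"
    unfolding fps_mult_nth using E assms(4) by (intro sum.cong refl) auto
  also have "\<dots> = coeff h n * s m + (\<Sum>i\<in>{1..m}. coeff h (n - i) * s (m - i))"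
    by (simp add: sum.atLeast_Suc_atMost)
  also have "(\<Sum>i\<in>{1..m}. coeff h (n - i) * s (m - i)) = (\<Sum>i\<in>{1..<m}. coeff h (n - i) * s (m - i))"
    by (rule sum.mono_neutral_right) (auto simp: s_def)
  also have "\<dots> = (\<Sum>i\<in>{1..<m}. coeff h (n - i) * (\<Sum>x\<in>#?M. x ^ (m - i)))"
    by (intro sum.cong refl) (auto simp: s_def)
  also have "coeff h n * s m = (\<Sum>x\<in>#?M. x ^ m)" using assms by (auto simp: s_def)
  finally show ?thesis by (simp add: algebra_simps)
qed

text \<open>By Newton's identities the j-th power sum involves only the coefficients at n - 1, ...,
  n - j, the last one linearly with factor -j. A change at n - k is therefore first felt by the k-th
  power sum.\<close>

lemma power_sums_perturb:
  fixes h :: "'a::alg_closed_field poly" and c :: 'a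
  assumes h: "lead_coeff h = 1" "degree h = n" and k: "1 \<le> k" "k \<le> n"
  defines "h' \<equiv> h + monom c (n - k)"
  shows "lead_coeff h' = 1" and "degree h' = n"
    and "1 \<le> j \<Longrightarrow> j < k \<Longrightarrow> (\<Sum>x\<in>#proots h'. x ^ j) = (\<Sum>x\<in>#proots h. x ^ j)"
    and "(\<Sum>x\<in>#proots h'. x ^ k) = (\<Sum>x\<in>#proots h. x ^ k) - of_nat k * c"
proof -
  have deg: "degree (monom c (n - k)) < degree h"
    using degree_monom_le[of c "n - k"] h(2) k by linarith
  then show "degree h' = n" using h unfolding h'_def by (simp add: degree_add_eq_left)
  moreover have "coeff h' n = 1" using h k by (auto simp: h'_def)
  ultimately show "lead_coeff h' = 1" by simp
  note h' = this \<open>degree h' = n\<close>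
  have coeff: "coeff h' (n - i) = coeff h (n - i)" if "i < k" for i
    using that k by (simp add: h'_def)
  have coeff_k: "coeff h' (n - k) = coeff h (n - k) + c" by (simp add: h'_def)
  have low: "(\<Sum>x\<in>#proots h'. x ^ j) = (\<Sum>x\<in>#proots h. x ^ j)" if "1 \<le> j" "j < k" for j
    using that
  proof (induction j rule: less_induct)
    case (less j)
    then have jn: "j \<le> n" using k by simp
    show ?case
      unfolding newton_identity[OF h less.prems(1) jn] newton_identity[OF h' less.prems(1) jn]
      using less coeff by (intro arg_cong2[where f = minus] sum.cong) auto
  qed
  then show "1 \<le> j \<Longrightarrow> j < k \<Longrightarrow> (\<Sum>x\<in>#proots h'. x ^ j) = (\<Sum>x\<in>#proots h. x ^ j)" .
  have "(\<Sum>i\<in>{1..<k}. coeff h' (n - i) * (\<Sum>x\<in>#proots h'. x ^ (k - i)))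
      = (\<Sum>i\<in>{1..<k}. coeff h (n - i) * (\<Sum>x\<in>#proots h. x ^ (k - i)))"
    using coeff low by (intro sum.cong refl) auto
  then show "(\<Sum>x\<in>#proots h'. x ^ k) = (\<Sum>x\<in>#proots h. x ^ k) - of_nat k * c"
    unfolding newton_identity[OF h k] newton_identity[OF h' k] coeff_k by (simp add: algebra_simps)
qed

lemma sum_poly_roots:
  "(\<Sum>x\<in>#M. poly g x) = (\<Sum>j\<le>degree g. coeff g j * (\<Sum>x\<in>#M. x ^ j))"
  for g :: "'a::field poly"
  by (induction M) (auto simp: poly_altdef sum.distrib algebra_simps)

context finite_subfield begin

section \<open>The Weil bound for a multiplicative times an additive character\<close>

lemma image_frob_proots:
  assumes "over_F h" "lead_coeff h = 1"
  shows "image_mset (\<lambda>x. x ^ q) (proots h) = proots h"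
proof -
  have frob: "frobp 1 (\<Prod>x\<in>#M. [:-x, 1:]) = (\<Prod>x\<in>#image_mset (\<lambda>x. x ^ q) M. [:-x, 1:])" for M
    by (induction M) (simp_all add: frobp_1 frobp_mult frobp_linear del: mult_pCons_left One_nat_def)
  have "proots h = proots (frobp 1 h)" using assms by (simp add: over_F_iff)
  also have "\<dots> = image_mset (\<lambda>x. x ^ q) (proots h)"
    by (subst monic_prod_proots[OF assms(2)]) (simp only: frob proots_prod_linear)
  finally show ?thesis by simp
qed

text \<open>Frobenius permutes the roots of \<open>h\<close> with multiplicity, so it fixes
  symmetric expressions in values that commute with it. This puts the arguments of the characters
  into \<open>F\<close>.\<close>

lemma sum_roots_in_F:
  assumes "over_F h" "lead_coeff h = 1" "\<And>x. f x ^ q = f (x ^ q)"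
  shows "(\<Sum>x\<in>#proots h. f x) \<in> F" and "(\<Prod>x\<in>#proots h. f x) \<in> F"
proof -
  have "(\<Sum>x\<in>#M. f x) ^ q = (\<Sum>x\<in>#image_mset (\<lambda>x. x ^ q) M. f x)" for M
    using frob_add[of _ _ 1] by (induction M) (simp_all add: assms(3) power_0_left)
  from this[of "proots h"] show "(\<Sum>x\<in>#proots h. f x) \<in> F"
    unfolding image_frob_proots[OF assms(1,2)] by (simp add: F_iff)
  have "(\<Prod>x\<in>#M. f x) ^ q = (\<Prod>x\<in>#image_mset (\<lambda>x. x ^ q) M. f x)" for M
    by (induction M) (simp_all add: assms(3) power_mult_distrib)
  from this[of "proots h"] show "(\<Prod>x\<in>#proots h. f x) \<in> F"
    unfolding image_frob_proots[OF assms(1,2)] by (simp add: F_iff)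
qed

lemma over_F_poly_q: "over_F g \<Longrightarrow> poly g x ^ q = poly g (x ^ q)"
  using over_F_poly[of g x 1] by simp

lemma MP_D: assumes "h \<in> MP n" shows "lead_coeff h = 1" "degree h = n" "over_F h" "h \<noteq> 0"
  using assms by (auto simp: MP_def)

lemma over_F_add: "over_F g \<Longrightarrow> over_F h \<Longrightarrow> over_F (g + h)"
  by (simp add: over_F_def add_F)

lemma over_F_monom: "c \<in> F \<Longrightarrow> over_F (monom c n)"
  by (simp add: over_F_def zero_F)

lemma prod_roots_eq:
  assumes "lead_coeff (h :: 'k poly) = 1" shows "(\<Prod>x\<in>#proots h. x) = (- 1) ^ degree h * coeff h 0"
proof -
  have "h \<noteq> 0" using assms by auto
  have "coeff h 0 = (\<Prod>x\<in>#proots h. - x)"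
    using poly_monic_eq_prod[OF assms, of 0] by (simp add: poly_0_coeff_0)
  moreover have "(\<Prod>x\<in>#M. - x) = (- 1) ^ size M * (\<Prod>x\<in>#M. x)" for M :: "'k multiset"
    by (induction M) auto
  ultimately show ?thesis
    using alg_closed_prod_proots(2)[OF \<open>h \<noteq> 0\<close>] by (simp flip: mult.assoc power_add mult_2)
qed

text \<open>By Newton's identities, adding \<open>c X\<^bsup>n - k\<^esup>\<close> to \<open>h\<close> changes the sum of \<open>g\<close> over the roots by
  a constant multiple of \<open>c\<close> and keeps the product of the roots.\<close>

lemma mixed_L_coeff_vanish:
  assumes \<psi>: "add_char \<psi>" "y \<in> F" "\<psi> y \<noteq> 1"
    and g: "over_F g" "degree g = k" "1 \<le> k" "k < p" and n: "n > k"
  shows "(\<Sum>h\<in>MP n. \<eta> (\<Prod>x\<in>#proots h. x) * \<psi> (\<Sum>x\<in>#proots h. poly g x)) = 0"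
    (is "(\<Sum>h\<in>_. ?\<Lambda> h) = 0")
proof -
  define a where "a = - of_nat k * coeff g k"
  have "(of_nat k :: 'k) \<noteq> 0"
    using g(3,4) by (auto simp: of_nat_eq_0_iff_char_dvd p_def dest: dvd_imp_le)
  moreover have "coeff g k \<noteq> 0" using g(2,3) by (metis degree_0 leading_coeff_0_iff not_one_le_zero)
  ultimately have "a \<noteq> 0" by (simp add: a_def)
  have natF: "of_nat j \<in> F" for j by (induction j) (auto simp: zero_F one_F add_F)
  have "a \<in> F" unfolding a_def using g(1) natF by (intro mult_F uminus_F) (auto simp: over_F_def)
  \<comment> \<open>The new term changes the k-th power sum by -k c, hence the sum of g over the
    roots by a c = y. Here a \<noteq> 0 because k < p, and n > k keeps the constant term of h, hence
    the product of its roots.\<close>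
  define c where "c = y * inverse a"
  have c: "c \<in> F" unfolding c_def using \<psi>(2) \<open>a \<in> F\<close> by (intro mult_F inverse_F)
  let ?t = "\<lambda>h. h + monom c (n - k)"
  have kn: "k \<le> n" using n by simp
  have MP': "?t h \<in> MP n" if "h \<in> MP n" for h
    using power_sums_perturb(1,2)[OF MP_D(1,2)[OF that] g(3) kn, where c = c] over_F_add[OF MP_D(3)[OF that] over_F_monom[OF c]]
    by (simp add: MP_def)
  have "inj_on ?t (MP n)" by (simp add: inj_on_def)
  moreover have "?t ` MP n \<subseteq> MP n" using MP' by blast
  ultimately have "bij_betw ?t (MP n) (MP n)"
    using endo_inj_surj[OF finite_MP] by (simp add: bij_betw_def)
  then have "(\<Sum>h\<in>MP n. ?\<Lambda> h) = (\<Sum>h\<in>MP n. ?\<Lambda> (?t h))" by (rule sum.reindex_bij_betw[symmetric])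
  also have "\<dots> = (\<Sum>h\<in>MP n. \<psi> y * ?\<Lambda> h)"
  proof (rule sum.cong[OF refl])
    fix h assume h: "h \<in> MP n"
    note pp = power_sums_perturb[OF MP_D(1,2)[OF h] g(3) kn, where c = c]
    have "(\<Prod>x\<in>#proots (?t h). x) = (\<Prod>x\<in>#proots h. x)"
      unfolding prod_roots_eq[OF pp(1)] prod_roots_eq[OF MP_D(1)[OF h]] pp(2) using n MP_D(2)[OF h] by simp
    moreover have "(\<Sum>x\<in>#proots (?t h). poly g x) = y + (\<Sum>x\<in>#proots h. poly g x)"
    proof -
      have size: "size (proots (?t h)) = size (proots h)"
        using alg_closed_prod_proots(2)[OF MP_D(4)[OF MP'[OF h]]] alg_closed_prod_proots(2)[OF MP_D(4)[OF h]]
          MP_D(2)[OF MP'[OF h]] MP_D(2)[OF h] by simp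
      have low: "(\<Sum>x\<in>#proots (?t h). x ^ j) = (\<Sum>x\<in>#proots h. x ^ j)" if "j < k" for j
        using pp(3)[of j] that size by (cases j) auto
      have split: "(\<Sum>j\<le>k. f j) = (\<Sum>j<k. f j) + f k" for f :: "nat \<Rightarrow> 'k"
        by (simp flip: lessThan_Suc_atMost)
      have "(\<Sum>x\<in>#proots (?t h). poly g x) = (\<Sum>x\<in>#proots h. poly g x) - coeff g k * (of_nat k * c)"
        unfolding sum_poly_roots g(2) split pp(4) by (simp add: low algebra_simps)
      also have "- (coeff g k * (of_nat k * c)) = y" using \<open>a \<noteq> 0\<close> by (simp add: c_def a_def field_simps)
      then have "(\<Sum>x\<in>#proots h. poly g x) - coeff g k * (of_nat k * c) = y + (\<Sum>x\<in>#proots h. poly g x)"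
        by (metis add.commute add_uminus_conv_diff)
      finally show ?thesis .
    qed
    moreover have "(\<Sum>x\<in>#proots h. poly g x) \<in> F"
      using sum_roots_in_F(1)[OF MP_D(3)[OF h] MP_D(1)[OF h]] over_F_poly_q[OF g(1)] by blast
    ultimately show "?\<Lambda> (?t h) = \<psi> y * ?\<Lambda> h" using \<psi> by (simp add: add_char_def)
  qed
  also have "\<dots> = \<psi> y * (\<Sum>h\<in>MP n. ?\<Lambda> h)" by (simp add: sum_distrib_left)
  finally show ?thesis using \<psi>(3) by simp
qed

lemma coprime_q: assumes "\<not> p dvd m" shows "coprime m q"
proof -
  obtain r where "r > 0" "q = p ^ r" using q_eq_power by blast
  then show ?thesis using assms prime_p by (metis coprime_commute coprime_power_right_iff prime_imp_coprime_nat)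
qed

lemma coeff_pcompose_Fn:
  assumes "\<And>i. coeff g i \<in> Fn n" "\<And>i. coeff h i \<in> Fn n"
  shows "coeff (pcompose g h) i \<in> Fn n"
  using assms(1)
proof (induction g arbitrary: i)
  case (pCons a g)
  have "a \<in> Fn n" using pCons.prems[of 0] by simp
  moreover have "coeff g i \<in> Fn n" for i using pCons.prems[of "Suc i"] by simp
  then have "coeff (pcompose g h) i \<in> Fn n" for i using pCons.IH by blast
  moreover have "coeff (h * pcompose g h) i \<in> Fn n" for i
    unfolding coeff_mult using calculation assms(2) by (intro Fn_sum Fn_mult)
  moreover have "coeff [:a:] i \<in> Fn n"
    using calculation(1) Fn_0 by (auto simp: coeff_pCons split: nat.splits)
  ultimately show ?case unfolding pcompose_pCons coeff_add by (intro Fn_add)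
qed (simp add: Fn_0)

text \<open>\<open>\<Lambda>\<close> applies the characters to the product of the roots of
  \<open>h\<close> and to the sum of g over them. On \<open>nrm n t\<close> these are the norm of t
  and the trace of g(t), so the power sums are the character sums over the extensions.\<close>

theorem weil_mixed:
  assumes \<psi>: "add_char \<psi>" "y \<in> F" "\<psi> y \<noteq> 1" and \<eta>: "mult_char \<eta>"
    and g: "over_F g" "degree g = k" "1 \<le> k" "k < p"
  shows "norm (\<Sum>t\<in>F. \<eta> t * \<psi> (poly g t)) \<le> k * sqrt q"
proof -
  define \<Lambda> where "\<Lambda> h = \<eta> (\<Prod>x\<in>#proots h. x) * \<psi> (\<Sum>x\<in>#proots h. poly g x)" for h
  have nrm: "\<Lambda> (nrm n t) = \<eta> (t ^ nexp n) * \<psi> (tr n (poly g t))" for n t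
  proof -
    have "(\<Prod>x\<in>#proots (nrm n t). x) = t ^ nexp n"
      unfolding proots_nrm power_nexp by (induction n) auto
    moreover have "(\<Sum>x\<in>#proots (nrm n t). poly g x) = tr n (poly g t)"
      unfolding proots_nrm tr_def by (induction n) (auto simp: over_F_poly[OF g(1)])
    ultimately show ?thesis by (simp add: \<Lambda>_def)
  qed
  have "norm (\<Sum>t\<in>F. \<Lambda> [:- t, 1:]) \<le> k * sqrt q"
  \<comment> \<open>The summand 1 pays for the point w = 0, which the parametrization of norm
    classes leaves out.\<close>
  proof (rule character_sum_bound[where C = "2 * (k * (q - 1)) * q + 1"])
    show "\<Lambda> (g1 * h) = \<Lambda> g1 * \<Lambda> h" if "g1 \<in> MP m" "h \<in> MP n" for m n g1 h
    proof -
      note F1 = sum_roots_in_F[OF MP_D(3)[OF that(1)] MP_D(1)[OF that(1)]] and F2 = sum_roots_in_F[OF MP_D(3)[OF that(2)] MP_D(1)[OF that(2)]]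
      have "(\<Prod>x\<in>#proots g1. x) \<in> F" "(\<Prod>x\<in>#proots h. x) \<in> F"
        using F1(2)[of "\<lambda>x. x"] F2(2)[of "\<lambda>x. x"] by auto
      moreover have "(\<Sum>x\<in>#proots g1. poly g x) \<in> F" "(\<Sum>x\<in>#proots h. poly g x) \<in> F"
        using F1(1)[of "poly g"] F2(1)[of "poly g"] over_F_poly_q[OF g(1)] by auto
      ultimately show ?thesis
        using MP_D(4)[OF that(1)] MP_D(4)[OF that(2)] \<psi>(1) \<eta>
        by (simp add: \<Lambda>_def proots_mult add_char_def mult_char_def)
    qed
    show "\<Lambda> 1 = 1" using \<psi>(1) \<eta> by (simp add: \<Lambda>_def add_char_def mult_char_def)
    show "(\<Sum>h\<in>MP n. \<Lambda> h) = 0" if "n > k" for n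
      unfolding \<Lambda>_def by (rule mixed_L_coeff_vanish[OF \<psi> g that])
    show "norm (\<Sum>t\<in>Fn (2 * s). \<Lambda> (nrm (2 * s) t)) \<le> (2 * (k * (q - 1)) * q + 1) * real (q ^ s)" if "s \<ge> 1" for s
      unfolding nrm
    proof (rule norm_class_sum_bound[OF _ \<eta>])
      fix t0 assume t0: "t0 \<in> Fn (2 * s)" "t0 \<noteq> 0"
      define G where "G = pcompose g (monom t0 (q - 1))"
      have poly_G: "poly G w = poly g (t0 * w ^ (q - 1))" for w
        by (simp add: G_def poly_pcompose poly_monom)
      have deg_G: "degree G = k * (q - 1)" using g(2) t0(2) by (simp add: G_def degree_pcompose degree_monom_eq)
      have coeff_G: "coeff G i \<in> Fn (2 * s)" for i
        unfolding G_def using over_F_coeff_Fn[OF g(1)] t0(1) by (intro coeff_pcompose_Fn) (auto simp: Fn_0)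
      \<comment> \<open>The substitution multiplies the degree by q - 1, which is -1 modulo p. So
        the degree stays prime to q, as \<open>card_trace_fibre\<close> demands.\<close>
      have "\<not> p dvd k" using g(3,4) by (auto dest: dvd_imp_le)
      moreover have "\<not> p dvd q - 1"
        using of_nat_q_minus_1 unfolding p_def of_nat_eq_0_iff_char_dvd[symmetric] by (simp del: of_nat_diff)
      ultimately have "coprime (k * (q - 1)) q" using coprime_q prime_p by (simp add: prime_dvd_mult_iff)
      then have le: "norm (\<Sum>x\<in>Fn (2 * s). \<psi> (tr (2 * s) (poly G x))) \<le> 2 * (k * (q - 1)) * q * q ^ s"
        using add_char_trace_sum_bound[OF that \<psi> coeff_G deg_G] g(3) q_ge_2 by simp
      have diff: "(\<Sum>w\<in>Fn (2 * s) - {0}. \<psi> (tr (2 * s) (poly G w)))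
          = (\<Sum>x\<in>Fn (2 * s). \<psi> (tr (2 * s) (poly G x))) - \<psi> (tr (2 * s) (poly G 0))"
        using finite_card_Fn(1)[of "2 * s"] that Fn_0 by (simp add: sum_diff1)
      have "norm (\<psi> (tr (2 * s) (poly G 0))) = 1"
        using norm_add_char[OF \<psi>(1) tr_in_F[OF poly_Fn[OF coeff_G Fn_0]]] .
      then have "norm (\<Sum>w\<in>Fn (2 * s) - {0}. \<psi> (tr (2 * s) (poly G w))) \<le> real (2 * (k * (q - 1)) * q * q ^ s) + 1"
        unfolding diff using le norm_triangle_ineq4[of "\<Sum>x\<in>Fn (2 * s). \<psi> (tr (2 * s) (poly G x))" "\<psi> (tr (2 * s) (poly G 0))"]
        by linarith
      also have "\<dots> \<le> (2 * (k * (q - 1)) * q + 1) * real (q ^ s)" using one_le_power[of "real q" s] q_ge_2 by (simp add: distrib_right del: of_nat_diff)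
      finally show "norm (\<Sum>w\<in>Fn (2 * s) - {0}. \<psi> (tr (2 * s) (poly g (t0 * w ^ (q - 1)))))
          \<le> (2 * (k * (q - 1)) * q + 1) * real (q ^ s)"
        unfolding poly_G .
    qed (use that in auto)
  qed
  then show ?thesis by (simp add: \<Lambda>_def proots_linear_factor)
qed

section \<open>The Weil bound for two multiplicative characters\<close>

lemma interpolation_exists:
  fixes v :: "'a::field \<Rightarrow> 'a"
  assumes "finite Z"
  shows "\<exists>I. (\<forall>j\<ge>card Z. coeff I j = 0) \<and> (\<forall>z\<in>Z. poly I z = v z)"
  using assms
proof induction
  case empty
  \<comment> \<open>Without nodes the interpolant has to be 0. A condition degree < 0 could not
    express this, hence the formulation by coefficients.\<close>
  show ?case by (intro exI[of _ 0]) simp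
next
  case (insert a Z)
  then obtain I where I: "\<And>j. j \<ge> card Z \<Longrightarrow> coeff I j = 0" "\<And>z. z \<in> Z \<Longrightarrow> poly I z = v z" by blast
  define W where "W = (\<Prod>z\<in>Z. [:-z, 1:])"
  have "poly W a \<noteq> 0" using insert by (auto simp: W_def poly_prod)
  have W0: "poly W z = 0" if "z \<in> Z" for z using that insert(1) by (auto simp: W_def poly_prod)
  have "degree W = card Z" unfolding W_def by (subst degree_prod_eq_sum_degree) auto
  then have W1: "coeff W j = 0" if "j > card Z" for j using that by (simp add: coeff_eq_0)
  define J where "J = I + smult ((v a - poly I a) / poly W a) W"
  have "coeff J j = 0" if "j \<ge> card (insert a Z)" for j
    using that insert I(1)[of j] W1[of j] by (simp add: J_def)
  moreover have "poly J z = v z" if "z \<in> insert a Z" for z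
    using that I(2) W0 \<open>poly W a \<noteq> 0\<close> by (auto simp: J_def)
  ultimately show ?case by blast
qed

text \<open>Applying Frobenius to the coefficients gives another interpolant of the same data, so
  uniqueness makes the interpolant fixed.\<close>

lemma over_F_interpolation:
  assumes Z: "finite Z" "\<And>z. z \<in> Z \<Longrightarrow> z ^ q \<in> Z" and v: "\<And>z. z \<in> Z \<Longrightarrow> v (z ^ q) = v z ^ q"
    and I: "\<And>j. j \<ge> card Z \<Longrightarrow> coeff I j = 0" "\<And>z. z \<in> Z \<Longrightarrow> poly I z = v z"
  shows "over_F I"
proof -
  have "inj_on (\<lambda>z. z ^ q) Z"
  proof (rule inj_onI)
    fix x y :: 'k assume "x ^ q = y ^ q"
    then show "x = y" using frob_inj[of x 1 y] by simp
  qed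
  then have surj: "(\<lambda>z. z ^ q) ` Z = Z" using Z by (intro endo_inj_surj) auto
  show ?thesis
  proof (cases "card Z = 0")
    case True
    then have "coeff I i = 0" for i using I(1)[of i] by simp
    then show ?thesis by (simp add: over_F_def zero_F)
  next
    case False
    then have deg: "degree I < card Z" 
    proof (cases "I = 0")
      case I0: False
      then show ?thesis using I(1)[of "degree I"] by (metis leading_coeff_0_iff linorder_not_le)
    qed simp
    have "frobp 1 I = I"
    proof (rule poly_eqI_many_roots[OF Z(1)])
      fix x assume "x \<in> Z"
      then obtain z where z: "z \<in> Z" "x = z ^ q" using surj by blast
      then show "poly (frobp 1 I) x = poly I x"
        using poly_frobp[of 1 I z] I(2) v Z(2) by simp
    qed (use deg in simp_all)
    then show ?thesis by (simp add: over_F_iff)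
  qed
qed

text \<open>Both sides are the resultant of h and f, computed over the roots of h or over those of
  f.\<close>

lemma prod_poly_roots_eq:
  assumes "h \<in> MP n" "f \<noteq> (0 :: 'k poly)"
  shows "(\<Prod>x\<in>#proots h. poly f x)
    = lead_coeff f ^ n * (- 1) ^ (n * degree f) * (\<Prod>z\<in>#proots f. poly h z)"
proof -
  have f: "poly f x = lead_coeff f * (\<Prod>z\<in>#proots f. x - z)" for x
    using arg_cong[OF alg_closed_prod_proots(1)[OF assms(2)], of "\<lambda>f. poly f x"]
    by (simp add: poly_prod_mset image_mset.compositionality o_def)
  have swap: "(\<Prod>x\<in>#M. \<Prod>z\<in>#N. x - z) = (- 1) ^ (size M * size N) * (\<Prod>z\<in>#N. \<Prod>x\<in>#M. z - x)"
    for M N :: "'k multiset"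
  proof (induction M)
    case (add x M)
    have "(\<Prod>z\<in>#N. x - z) = (- 1) ^ size N * (\<Prod>z\<in>#N. z - x)"
      by (induction N) (simp_all add: algebra_simps)
    then show ?case using add by (simp add: prod_mset.distrib power_add mult_ac)
  qed simp
  have "(\<Prod>x\<in>#proots h. poly f x) = (\<Prod>x\<in>#proots h. lead_coeff f) * (\<Prod>x\<in>#proots h. \<Prod>z\<in>#proots f. x - z)"
    by (subst f) (rule prod_mset.distrib)
  also have "\<dots> = lead_coeff f ^ n * (- 1) ^ (n * degree f) * (\<Prod>z\<in>#proots f. \<Prod>x\<in>#proots h. z - x)"
    using alg_closed_prod_proots(2)[OF assms(2)] alg_closed_prod_proots(2)[OF MP_D(4)[OF assms(1)]]
      MP_D(2)[OF assms(1)] by (subst swap) (simp add: prod_mset_constant)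
  finally show ?thesis by (simp only: poly_monic_eq_prod[OF MP_D(1)[OF assms(1)]])
qed

text \<open>Multiplying the values of \<open>h\<close> at the roots of \<open>X f\<close> by such a weight permutes the monic
  polynomials of a given large degree and multiplies the character value of \<open>h\<close> by \<open>\<theta>(b)\<close>.\<close>

lemma orbit_weight_exists:
  assumes f: "over_F f" "f = [:-r, 1:] * g" "poly g r \<noteq> 0" and "r \<noteq> 0" and b: "b \<in> F" "b \<noteq> 0"
  obtains w where "w 0 = (1 :: 'k)" "\<And>z. w z \<noteq> 0" "\<And>z. w (z ^ q) = w z ^ q" "(\<Prod>z\<in>#proots f. w z) = b"
proof -
  have "g \<noteq> 0" using f by auto
  then have f0: "f \<noteq> 0" unfolding f(2) mult_eq_0_iff by simp
  have root: "poly f r = 0" by (simp add: f(2))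
  have ord: "order r f = 1"
    using order_power_n_n[of r 1] order_0I[OF f(3)] f0 unfolding f(2) by (subst order_mult) auto
  obtain e0 where e0: "e0 > 0" "r \<in> Fn e0" using root_in_Fn[OF f(1) f0 root] by blast
  define e where "e = period r"
  have e: "e > 0" "r \<in> Fn e" using period[OF e0] by (auto simp: e_def)
  \<comment> \<open>The weight will be \<omega>^(q^j) at the conjugate r^(q^j), and 1 elsewhere. It
    is well defined since \<omega> lies in \<open>Fn e\<close> with e the period of r. As r is a
    simple root, each conjugate occurs once among the roots of f, and together they contribute the
    norm of \<omega>, which is b.\<close>
  obtain \<omega> where \<omega>: "\<omega> \<in> Fn e" "\<omega> \<noteq> 0" "\<omega> ^ nexp e = b" using ex_norm_eq[of e b] e(1) b by auto
  have well: "\<omega> ^ (q ^ i) = \<omega> ^ (q ^ j)" if "r ^ (q ^ i) = r ^ (q ^ j)" for i j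
    using that
  proof (induction i j rule: linorder_wlog)
    case (le i j)
    have "(r ^ (q ^ (j - i))) ^ (q ^ i) = r ^ (q ^ i)" using le by (simp add: frob_frob)
    then have "r ^ (q ^ (j - i)) = r" by (rule frob_inj)
    then have "e dvd j - i" using in_Fn_iff_period_dvd[OF e0, of "j - i"] by (simp add: Fn_def e_def)
    then obtain l where "j - i = e * l" by (elim dvdE)
    then have "\<omega> ^ (q ^ (j - i)) = \<omega>" using Fn_mult_period[OF \<omega>(1)] by simp
    then have "(\<omega> ^ (q ^ (j - i))) ^ (q ^ i) = \<omega> ^ (q ^ i)" by simp
    then show ?case using le by (simp add: frob_frob)
  qed simp
  define w where "w z = (if \<exists>j. z = r ^ (q ^ j) then \<omega> ^ (q ^ (SOME j. z = r ^ (q ^ j))) else 1)" for z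
  have w_orbit: "w (r ^ (q ^ j)) = \<omega> ^ (q ^ j)" for j
  proof -
    have "r ^ (q ^ j) = r ^ (q ^ (SOME i. r ^ (q ^ j) = r ^ (q ^ i)))" by (rule someI[of _ j]) simp
    from well[OF this] have "\<omega> ^ (q ^ (SOME i. r ^ (q ^ j) = r ^ (q ^ i))) = \<omega> ^ (q ^ j)" ..
    moreover have "\<exists>i. r ^ (q ^ j) = r ^ (q ^ i)" by blast
    ultimately show ?thesis unfolding w_def by (simp only: if_True)
  qed
  show ?thesis
  proof
    show "w 0 = 1" using \<open>r \<noteq> 0\<close> by (auto simp: w_def)
    show "w z \<noteq> 0" for z using \<omega>(2) by (auto simp: w_def)
    show "w (z ^ q) = w z ^ q" for z
    proof (cases "\<exists>j. z = r ^ (q ^ j)")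
      case True
      then obtain j where j: "z = r ^ (q ^ j)" by blast
      then have "z ^ q = r ^ (q ^ Suc j)" using frob_frob[of r j 1] by simp
      then show ?thesis using w_orbit[of j] w_orbit[of "Suc j"] frob_frob[of \<omega> j 1] j by simp
    next
      case False
      have "\<not> (\<exists>j. z ^ q = r ^ (q ^ j))"
      proof
        assume "\<exists>j. z ^ q = r ^ (q ^ j)"
        then obtain j where j: "z ^ q = r ^ (q ^ j)" by blast
        have "r ^ (q ^ j) = r ^ (q ^ (e + j))" using e(2) by (simp add: Fn_def flip: frob_frob)
        also have "\<dots> = (r ^ (q ^ (e + j - 1))) ^ (q ^ 1)" unfolding frob_frob using e(1) by simp
        finally have "z = r ^ (q ^ (e + j - 1))" using j frob_inj[of z 1] by simp
        then show False using False by blast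
      qed
      then show ?thesis using False by (simp add: w_def)
    qed
    have inj: "inj_on (\<lambda>j. r ^ (q ^ j)) {..<e}" unfolding e_def by (rule inj_on_orbit[OF e0])
    let ?O = "(\<lambda>j. r ^ (q ^ j)) ` {..<e}"
    have count: "count (proots f) z = 1" if z: "z \<in> ?O" for z
    proof -
      obtain j where j: "z = r ^ (q ^ j)" "j < e" using z by blast
      have "z ^ (q ^ (e - j)) = r" using e(2) j by (simp add: frob_frob Fn_def)
      then show ?thesis
        using order_frob_ge[OF f(1) f0, of r j] order_frob_ge[OF f(1) f0, of z "e - j"] ord j f0
        by (simp add: count_proots)
    qed
    have sub: "mset_set ?O \<subseteq># proots f"
      using count by (auto simp: subseteq_mset_def count_mset_set')
    have "w z = 1" if z: "z \<in># proots f - mset_set ?O" for z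
    proof -
      have "z \<notin> ?O" using z count[of z] by (auto simp: in_diff_count)
      have "\<nexists>j. z = r ^ (q ^ j)"
      proof
        assume "\<exists>j. z = r ^ (q ^ j)"
        then obtain j where j: "z = r ^ (q ^ j)" by blast
        have "r ^ (q ^ j) = (r ^ (q ^ (e * (j div e)))) ^ (q ^ (j mod e))" unfolding frob_frob by simp
        also have "\<dots> = r ^ (q ^ (j mod e))" by (simp add: Fn_mult_period[OF e(2)])
        finally show False using \<open>z \<notin> ?O\<close> j e(1) by auto
      qed
      then show ?thesis by (simp add: w_def)
    qed
    then have "(\<Prod>z\<in>#proots f - mset_set ?O. w z) = 1" by (simp add: prod_mset.neutral)
    then have "(\<Prod>z\<in>#proots f. w z) = (\<Prod>z\<in>#mset_set ?O. w z)"
      using arg_cong[OF subset_mset.add_diff_inverse[OF sub], of "\<lambda>M. \<Prod>z\<in>#M. w z"]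
      by (simp only: image_mset_union prod_mset.union mult_1_right)
    also have "\<dots> = (\<Prod>j<e. \<omega> ^ (q ^ j))"
      unfolding prod_unfold_prod_mset[symmetric] prod.reindex[OF inj] by (simp only: o_def w_orbit)
    finally show "(\<Prod>z\<in>#proots f. w z) = b" using \<omega>(3) by (simp add: power_nexp)
  qed
qed

text \<open>The permutation of \<open>MP n\<close> is h \<mapsto> h + I h, where \<open>I h\<close>
  interpolates (w - 1) h on \<open>Z\<close>. As \<open>card Z\<close> is at most k + 1 \<le> n, the
  leading term is kept; w 0 = 1 keeps the constant term and so the argument of \<eta>; the resultant
  with f picks up the factor b.\<close>

lemma mult_L_coeff_vanish:
  assumes \<theta>: "mult_char \<theta>" "b \<in> F" "b \<noteq> 0" "\<theta> b \<noteq> 1"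
    and f: "over_F f" "degree f = k" "f = [:-r, 1:] * g" "poly g r \<noteq> 0" and "r \<noteq> 0" and n: "n > k"
  shows "(\<Sum>h\<in>MP n. \<theta> (\<Prod>x\<in>#proots h. poly f x) * \<eta> (\<Prod>x\<in>#proots h. x)) = 0"
    (is "(\<Sum>h\<in>_. ?\<Lambda> h) = 0")
proof -
  have "g \<noteq> 0" using f by auto
  then have f0: "f \<noteq> 0" unfolding f(3) mult_eq_0_iff by simp
  obtain w where w: "w 0 = 1" "\<And>z. w z \<noteq> 0" "\<And>z. w (z ^ q) = w z ^ q" "(\<Prod>z\<in>#proots f. w z) = b"
    using orbit_weight_exists[OF f(1,3,4) \<open>r \<noteq> 0\<close> \<theta>(2,3)] by metis
  define Z where "Z = insert 0 {z. poly f z = 0}"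
  have fin: "finite Z" using poly_roots_finite[OF f0] by (simp add: Z_def)
  have cardZ: "card Z \<le> n"
    using card_insert_le_m1[of "Suc k" "{z. poly f z = 0}" 0] card_poly_roots_bound[OF f0] f(2) n
    by (simp add: Z_def card_insert_if poly_roots_finite[OF f0])
  have ZF: "z ^ q \<in> Z" if "z \<in> Z" for z
    using that over_F_poly_q[OF f(1), of z] by (auto simp: Z_def power_0_left)
  define I where "I h = (SOME I. (\<forall>j\<ge>card Z. coeff I j = 0) \<and> (\<forall>z\<in>Z. poly I z = (w z - 1) * poly h z))" for h
  have "(\<forall>j\<ge>card Z. coeff (I h) j = 0) \<and> (\<forall>z\<in>Z. poly (I h) z = (w z - 1) * poly h z)" for h
    unfolding I_def by (rule someI_ex[OF interpolation_exists[OF fin]])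
  then have I: "j \<ge> card Z \<Longrightarrow> coeff (I h) j = 0" "z \<in> Z \<Longrightarrow> poly (I h) z = (w z - 1) * poly h z" for h j z
    by blast+
  let ?t = "\<lambda>h. h + I h"
  have tz: "poly (?t h) z = w z * poly h z" if "z \<in> Z" for h z
    using I(2)[OF that, of h] by (simp add: algebra_simps)
  have MP': "?t h \<in> MP n" if h: "h \<in> MP n" for h
  proof -
    have "over_F (I h)"
    proof (rule over_F_interpolation[OF fin ZF])
      show "(w (z ^ q) - 1) * poly h (z ^ q) = ((w z - 1) * poly h z) ^ q" for z
        using frob_diff[of "w z" 1 1] by (simp add: w(3) power_mult_distrib over_F_poly_q[OF MP_D(3)[OF h]])
    qed (use I in auto)
    moreover have "coeff (?t h) j = coeff h j" if "j \<ge> n" for j using I(1)[of j h] cardZ that by simp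
    then have "degree (?t h) = n" "coeff (?t h) n = 1"
      using MP_D(1,2)[OF h] degree_le[of n "?t h"] le_degree[of "?t h" n] by (auto simp: coeff_eq_0)
    ultimately show ?thesis using over_F_add MP_D(3)[OF h] by (simp add: MP_def)
  qed
  have "inj_on ?t (MP n)"
  proof (rule inj_onI)
    fix h1 h2 assume eq: "?t h1 = ?t h2"
    \<comment> \<open>Dividing by w recovers the values on \<open>Z\<close>, and \<open>I h\<close>
      depends on h only through these values.\<close>
    have "poly h1 z = poly h2 z" if "z \<in> Z" for z
      using tz[OF that, of h1] tz[OF that, of h2] w(2)[of z] eq by simp
    then have "I h1 = I h2" unfolding I_def by (metis (no_types, lifting))
    then show "h1 = h2" using eq by simp
  qed
  moreover have "?t ` MP n \<subseteq> MP n" using MP' by blast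
  ultimately have "bij_betw ?t (MP n) (MP n)"
    using endo_inj_surj[OF finite_MP] by (simp add: bij_betw_def)
  then have "(\<Sum>h\<in>MP n. ?\<Lambda> h) = (\<Sum>h\<in>MP n. ?\<Lambda> (?t h))" by (rule sum.reindex_bij_betw[symmetric])
  also have "\<dots> = (\<Sum>h\<in>MP n. \<theta> b * ?\<Lambda> h)"
  proof (rule sum.cong[OF refl])
    fix h assume h: "h \<in> MP n"
    have "coeff (?t h) 0 = coeff h 0"
      using tz[of 0 h] w(1) by (simp add: Z_def poly_0_coeff_0 del: coeff_add)
    then have "(\<Prod>x\<in>#proots (?t h). x) = (\<Prod>x\<in>#proots h. x)"
      unfolding prod_roots_eq[OF MP_D(1)[OF MP'[OF h]]] prod_roots_eq[OF MP_D(1)[OF h]]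
        MP_D(2)[OF h] MP_D(2)[OF MP'[OF h]] by simp
    moreover have "(\<Prod>x\<in>#proots (?t h). poly f x) = b * (\<Prod>x\<in>#proots h. poly f x)"
    proof -
      have "(\<Prod>z\<in>#proots f. poly (?t h) z) = (\<Prod>z\<in>#proots f. w z * poly h z)"
      proof (intro arg_cong[where f = prod_mset] image_mset_cong)
        fix z assume "z \<in># proots f"
        then have "z \<in> Z" using f0 by (simp add: Z_def set_count_proots)
        then show "poly (?t h) z = w z * poly h z" by (rule tz)
      qed
      also have "\<dots> = b * (\<Prod>z\<in>#proots f. poly h z)" by (simp add: prod_mset.distrib w(4))
      finally show ?thesis
        unfolding prod_poly_roots_eq[OF MP'[OF h] f0] prod_poly_roots_eq[OF h f0]
        by (simp only: mult.assoc mult.left_commute)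
    qed
    moreover have "(\<Prod>x\<in>#proots h. poly f x) \<in> F"
      using sum_roots_in_F(2)[OF MP_D(3)[OF h] MP_D(1)[OF h]] over_F_poly_q[OF f(1)] by blast
    ultimately show "?\<Lambda> (?t h) = \<theta> b * ?\<Lambda> h" using \<theta> by (simp add: mult_char_def)
  qed
  also have "\<dots> = \<theta> b * (\<Sum>h\<in>MP n. ?\<Lambda> h)" by (simp add: sum_distrib_left)
  finally show ?thesis using \<theta>(4) by simp
qed

theorem weil_mult:
  assumes \<theta>: "mult_char \<theta>" "b \<in> F" "b \<noteq> 0" "\<theta> b \<noteq> 1" and \<eta>: "mult_char \<eta>"
    and f: "over_F f" "degree f = k" "f = [:-r, 1:] * g" "poly g r \<noteq> 0" and "r \<noteq> 0"
  shows "norm (\<Sum>t\<in>F. \<theta> (poly f t) * \<eta> t) \<le> k * sqrt q"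
proof -
  define \<Lambda> where "\<Lambda> h = \<theta> (\<Prod>x\<in>#proots h. poly f x) * \<eta> (\<Prod>x\<in>#proots h. x)" for h
  have nrm: "\<Lambda> (nrm n t) = \<eta> (t ^ nexp n) * \<theta> (poly f t ^ nexp n)" for n t
  proof -
    have "(\<Prod>x\<in>#proots (nrm n t). x) = t ^ nexp n"
      unfolding proots_nrm power_nexp by (induction n) auto
    moreover have "(\<Prod>x\<in>#proots (nrm n t). poly f x) = poly f t ^ nexp n"
      unfolding proots_nrm power_nexp by (induction n) (auto simp: over_F_poly[OF f(1)])
    ultimately show ?thesis by (simp add: \<Lambda>_def)
  qed
  have "norm (\<Sum>t\<in>F. \<Lambda> [:- t, 1:]) \<le> k * sqrt q"
  proof (rule character_sum_bound[where C = "2 * (k * (q - 1)) * q + 1"])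
    show "\<Lambda> (g1 * h) = \<Lambda> g1 * \<Lambda> h" if "g1 \<in> MP m" "h \<in> MP n" for m n g1 h
    proof -
      note F1 = sum_roots_in_F(2)[OF MP_D(3)[OF that(1)] MP_D(1)[OF that(1)]]
        and F2 = sum_roots_in_F(2)[OF MP_D(3)[OF that(2)] MP_D(1)[OF that(2)]]
      have "(\<Prod>x\<in>#proots g1. x) \<in> F" "(\<Prod>x\<in>#proots h. x) \<in> F"
        using F1[of "\<lambda>x. x"] F2[of "\<lambda>x. x"] by auto
      moreover have "(\<Prod>x\<in>#proots g1. poly f x) \<in> F" "(\<Prod>x\<in>#proots h. poly f x) \<in> F"
        using F1[of "poly f"] F2[of "poly f"] over_F_poly_q[OF f(1)] by auto
      ultimately show ?thesis
        using MP_D(4)[OF that(1)] MP_D(4)[OF that(2)] \<theta>(1) \<eta>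
        by (simp add: \<Lambda>_def proots_mult mult_char_def)
    qed
    show "\<Lambda> 1 = 1" using \<theta>(1) \<eta> by (simp add: \<Lambda>_def mult_char_def)
    show "(\<Sum>h\<in>MP n. \<Lambda> h) = 0" if "n > k" for n
      unfolding \<Lambda>_def by (rule mult_L_coeff_vanish[OF \<theta> f \<open>r \<noteq> 0\<close> that])
    show "norm (\<Sum>t\<in>Fn (2 * s). \<Lambda> (nrm (2 * s) t)) \<le> (2 * (k * (q - 1)) * q + 1) * real (q ^ s)" if "s \<ge> 1" for s
      unfolding nrm
    proof (rule norm_class_sum_bound[OF _ \<eta>])
      fix t0 assume t0: "t0 \<in> Fn (2 * s)" "t0 \<noteq> 0"
      define T where "T = monom t0 (q - 1)"
      define G where "G = pcompose f T"
      have poly_G: "poly G w = poly f (t0 * w ^ (q - 1))" for w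
        by (simp add: G_def T_def poly_pcompose poly_monom)
      have deg_G: "degree G = k * (q - 1)" using f(2) t0(2) by (simp add: G_def T_def degree_pcompose degree_monom_eq)
      have coeff_G: "coeff G i \<in> Fn (2 * s)" for i
        unfolding G_def T_def using over_F_coeff_Fn[OF f(1)] t0(1) by (intro coeff_pcompose_Fn) (auto simp: Fn_0)
      \<comment> \<open>The norm fibre estimate asks for a simple root of f(t0 X^(q - 1)). A
        preimage \<rho> of r is one: it is nonzero with r, so the derivative of t0 X^(q - 1), whose
        factor q - 1 is -1 in the field, does not vanish there.\<close>
      obtain \<rho> where \<rho>: "\<rho> ^ (q - 1) = r / t0" using nth_root_exists[of "q - 1" "r / t0"] q_ge_2 by auto
      then have "\<rho> \<noteq> 0" using \<open>r \<noteq> 0\<close> t0(2) q_ge_2 by (auto simp: power_0_left)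
      have T\<rho>: "poly T \<rho> = r" using \<rho> t0(2) by (simp add: T_def poly_monom)
      then have "poly (T - [:r:]) \<rho> = 0" by simp
      then have "[:-\<rho>, 1:] dvd T - [:r:]" using poly_eq_0_iff_dvd by blast
      then obtain S where S: "T - [:r:] = [:-\<rho>, 1:] * S" by (elim dvdE)
      have "poly S \<rho> = poly (pderiv T) \<rho>"
        using arg_cong[OF S, of "\<lambda>g. poly (pderiv g) \<rho>"]
        by (simp add: pderiv_mult pderiv_diff pderiv_pCons del: mult_pCons_left)
      also have "\<dots> \<noteq> 0"
        using of_nat_q_minus_1 t0(2) \<open>\<rho> \<noteq> 0\<close> by (simp add: T_def pderiv_monom poly_monom)
      finally have "poly S \<rho> \<noteq> 0" .
      have "[:-r, 1:] \<circ>\<^sub>p T = T - [:r:]" by (simp add: pcompose_pCons)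
      then have "G = [:-\<rho>, 1:] * (S * pcompose g T)"
        unfolding G_def by (subst f(3)) (simp only: pcompose_mult S mult.assoc)
      moreover have "poly (S * pcompose g T) \<rho> \<noteq> 0"
        using \<open>poly S \<rho> \<noteq> 0\<close> f(4) T\<rho> by (simp add: poly_pcompose)
      ultimately have le: "norm (\<Sum>x\<in>Fn (2 * s). \<theta> (poly G x ^ nexp (2 * s))) \<le> 2 * (k * (q - 1)) * q * q ^ s"
        using mult_char_norm_sum_bound[OF that \<theta> coeff_G deg_G] by blast
      have diff: "(\<Sum>w\<in>Fn (2 * s) - {0}. \<theta> (poly G w ^ nexp (2 * s)))
          = (\<Sum>x\<in>Fn (2 * s). \<theta> (poly G x ^ nexp (2 * s))) - \<theta> (poly G 0 ^ nexp (2 * s))"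
        using finite_card_Fn(1)[of "2 * s"] that Fn_0 by (simp add: sum_diff1)
      have "norm (\<theta> (poly G 0 ^ nexp (2 * s))) \<le> 1"
        using norm_mult_char_le[OF \<theta>(1) power_nexp_in_F[OF poly_Fn[OF coeff_G Fn_0]]] .
      then have "norm (\<Sum>w\<in>Fn (2 * s) - {0}. \<theta> (poly G w ^ nexp (2 * s))) \<le> real (2 * (k * (q - 1)) * q * q ^ s) + 1"
        unfolding diff using le norm_triangle_ineq4[of "\<Sum>x\<in>Fn (2 * s). \<theta> (poly G x ^ nexp (2 * s))" "\<theta> (poly G 0 ^ nexp (2 * s))"]
        by linarith
      also have "\<dots> \<le> (2 * (k * (q - 1)) * q + 1) * real (q ^ s)"
        using one_le_power[of "real q" s] q_ge_2 by (simp add: distrib_right del: of_nat_diff)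
      finally show "norm (\<Sum>w\<in>Fn (2 * s) - {0}. \<theta> (poly f (t0 * w ^ (q - 1)) ^ nexp (2 * s)))
          \<le> (2 * (k * (q - 1)) * q + 1) * real (q ^ s)"
        unfolding poly_G .
    qed (use that in auto)
  qed
  then show ?thesis by (simp add: \<Lambda>_def proots_linear_factor)
qed

end

section \<open>Expander mixing\<close>

text \<open>A dual group in coordinates: the characters are indexed by \<open>J\<close>, and
  orthogonality is summed over the characters, which gives Fourier inversion and Parseval on subsets
  of \<open>G\<close>. \<open>card J\<close> stands for the group order.\<close>

definition orth_chars ::
  "'g set \<Rightarrow> ('g \<Rightarrow> 'g \<Rightarrow> 'g) \<Rightarrow> 'j set \<Rightarrow> ('j \<Rightarrow> 'g \<Rightarrow> complex) \<Rightarrow> 'j \<Rightarrow> bool" where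
  "orth_chars G opr J ch j0 \<longleftrightarrow> finite J \<and> j0 \<in> J \<and> (\<forall>x\<in>G. ch j0 x = 1) \<and>
    (\<forall>j\<in>J. \<forall>x\<in>G. \<forall>y\<in>G. ch j (opr x y) = ch j x * ch j y) \<and>
    (\<forall>x\<in>G. \<forall>y\<in>G. (\<Sum>j\<in>J. ch j x * cnj (ch j y)) = (if x = y then of_nat (card J) else 0))"

lemma orth_chars_prod:
  assumes "orth_chars G1 op1 J1 c1 a" "orth_chars G2 op2 J2 c2 b"
  shows "orth_chars (G1 \<times> G2) (\<lambda>x y. (op1 (fst x) (fst y), op2 (snd x) (snd y))) (J1 \<times> J2)
    (\<lambda>j x. c1 (fst j) (fst x) * c2 (snd j) (snd x)) (a, b)"
proof -
  have "(\<Sum>j\<in>J1 \<times> J2. (c1 (fst j) (fst x) * c2 (snd j) (snd x)) * cnj (c1 (fst j) (fst y) * c2 (snd j) (snd y)))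
      = (\<Sum>i\<in>J1. c1 i (fst x) * cnj (c1 i (fst y))) * (\<Sum>j\<in>J2. c2 j (snd x) * cnj (c2 j (snd y)))" for x y
    unfolding sum_product sum.cartesian_product by (intro sum.cong) auto
  then show ?thesis using assms unfolding orth_chars_def by (auto simp: card_cartesian_product prod_eq_iff)
qed

lemma parseval:
  assumes "orth_chars G opr J ch j0" "U \<subseteq> G" "finite U"
  shows "(\<Sum>j\<in>J. (norm (\<Sum>u\<in>U. ch j u))\<^sup>2) = card J * card U"
proof -
  have "complex_of_real (\<Sum>j\<in>J. (norm (\<Sum>u\<in>U. ch j u))\<^sup>2)
      = (\<Sum>j\<in>J. \<Sum>u\<in>U. \<Sum>u'\<in>U. ch j u * cnj (ch j u'))"
    by (simp only: of_real_sum complex_norm_square cnj_sum sum_product)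
  also have "\<dots> = (\<Sum>u\<in>U. \<Sum>u'\<in>U. \<Sum>j\<in>J. ch j u * cnj (ch j u'))"
    by (subst sum.swap, intro sum.cong refl, rule sum.swap)
  also have "\<dots> = (\<Sum>u\<in>U. \<Sum>u'\<in>U. if u = u' then of_nat (card J) else 0)"
    using assms by (intro sum.cong refl) (auto simp: orth_chars_def subset_iff)
  also have "\<dots> = of_real (card J * card U)" using assms(3) by simp
  finally show ?thesis using of_real_eq_iff by blast
qed

text \<open>Fourier expansion of the edge count. The trivial character gives the main term; the
  other eigenvalues \<open>S j\<close> are at most C, and Cauchy-Schwarz with Parseval bounds their
  total contribution.\<close>

lemma expander_mixing:
  fixes C :: real
  assumes ch: "orth_chars G opr J ch j0" and U: "U \<subseteq> G" "finite U" and V: "V \<subseteq> G" "finite V"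
    and D: "finite D" "\<And>t. t \<in> D \<Longrightarrow> \<Phi> t \<in> G" and cl: "\<And>x y. x \<in> G \<Longrightarrow> y \<in> G \<Longrightarrow> opr x y \<in> G"
    and bound: "\<And>j. j \<in> J - {j0} \<Longrightarrow> norm (\<Sum>t\<in>D. ch j (\<Phi> t)) \<le> C" and "C \<ge> 0"
  shows "card {(v, t). v \<in> V \<and> t \<in> D \<and> opr v (\<Phi> t) \<in> U}
    \<le> real (card U) * card V * card D / card J + C * sqrt (card U * card V)"
proof -
  define Uh where "Uh j = (\<Sum>u\<in>U. ch j u)" for j
  define Vh where "Vh j = (\<Sum>v\<in>V. ch j v)" for j
  define S where "S j = (\<Sum>t\<in>D. ch j (\<Phi> t))" for j
  define N where "N = card {(v, t). v \<in> V \<and> t \<in> D \<and> opr v (\<Phi> t) \<in> U}"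
  have J: "finite J" "j0 \<in> J" "\<And>x. x \<in> G \<Longrightarrow> ch j0 x = 1" using ch by (auto simp: orth_chars_def)
  have cardJ: "real (card J) > 0" using J by (auto simp: card_gt_0_iff)
  have N: "N = (\<Sum>x\<in>V \<times> D. if opr (fst x) (\<Phi> (snd x)) \<in> U then 1 else 0)"
  proof -
    have "{(v, t). v \<in> V \<and> t \<in> D \<and> opr v (\<Phi> t) \<in> U} = {x \<in> V \<times> D. opr (fst x) (\<Phi> (snd x)) \<in> U}" by auto
    then show ?thesis using V D by (simp add: N_def sum.If_cases Int_def)
  qed
  have ind: "of_nat (card J) * (if x \<in> U then 1 else 0) = (\<Sum>u\<in>U. \<Sum>j\<in>J. ch j x * cnj (ch j u))"
    if "x \<in> G" for x
  proof -
    have "(\<Sum>u\<in>U. \<Sum>j\<in>J. ch j x * cnj (ch j u)) = (\<Sum>u\<in>U. if x = u then of_nat (card J) else 0)"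
      using ch U(1) that by (intro sum.cong refl) (auto simp: orth_chars_def subset_iff)
    then show ?thesis using U(2) by simp
  qed
  have "of_nat (card J) * of_nat N
      = (\<Sum>x\<in>V \<times> D. \<Sum>u\<in>U. \<Sum>j\<in>J. ch j (opr (fst x) (\<Phi> (snd x))) * cnj (ch j u))"
    unfolding N of_nat_sum sum_distrib_left
  proof (rule sum.cong[OF refl])
    fix x assume "x \<in> V \<times> D"
    then have "opr (fst x) (\<Phi> (snd x)) \<in> G" using V D cl by auto
    from ind[OF this] show "of_nat (card J) * of_nat (if opr (fst x) (\<Phi> (snd x)) \<in> U then 1 else 0)
      = (\<Sum>u\<in>U. \<Sum>j\<in>J. ch j (opr (fst x) (\<Phi> (snd x))) * cnj (ch j u))" by auto
  qed
  also have "\<dots> = (\<Sum>x\<in>V \<times> D. \<Sum>j\<in>J. \<Sum>u\<in>U. (ch j (fst x) * ch j (\<Phi> (snd x))) * cnj (ch j u))"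
  proof (intro sum.cong refl, subst sum.swap, intro sum.cong refl)
    fix x j u assume "x \<in> V \<times> D" "j \<in> J"
    then show "ch j (opr (fst x) (\<Phi> (snd x))) * cnj (ch j u) = (ch j (fst x) * ch j (\<Phi> (snd x))) * cnj (ch j u)"
      using ch V(1) D(2) by (auto simp: orth_chars_def subset_iff)
  qed
  also have "\<dots> = (\<Sum>j\<in>J. \<Sum>x\<in>V \<times> D. \<Sum>u\<in>U. (ch j (fst x) * ch j (\<Phi> (snd x))) * cnj (ch j u))"
    by (rule sum.swap)
  also have "\<dots> = (\<Sum>j\<in>J. Vh j * S j * cnj (Uh j))"
  proof (rule sum.cong[OF refl])
    fix j
    have "(\<Sum>x\<in>V \<times> D. \<Sum>u\<in>U. (ch j (fst x) * ch j (\<Phi> (snd x))) * cnj (ch j u))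
        = (\<Sum>x\<in>V \<times> D. ch j (fst x) * ch j (\<Phi> (snd x))) * cnj (Uh j)"
      unfolding Uh_def cnj_sum sum_distrib_right by (simp only: sum_distrib_left)
    also have "(\<Sum>x\<in>V \<times> D. ch j (fst x) * ch j (\<Phi> (snd x))) = Vh j * S j"
      unfolding Vh_def S_def sum_product sum.cartesian_product by (simp add: case_prod_unfold)
    finally show "(\<Sum>x\<in>V \<times> D. \<Sum>u\<in>U. (ch j (fst x) * ch j (\<Phi> (snd x))) * cnj (ch j u))
        = Vh j * S j * cnj (Uh j)" .
  qed
  also have "\<dots> = Vh j0 * S j0 * cnj (Uh j0) + (\<Sum>j\<in>J - {j0}. Vh j * S j * cnj (Uh j))"
    using J by (simp add: sum.remove)
  also have "Vh j0 = card V" using J(3) V(1) by (simp add: Vh_def subset_iff)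
  also have "S j0 = card D" using J(3) D(2) by (simp add: S_def)
  also have "Uh j0 = card U" using J(3) U(1) by (simp add: Uh_def subset_iff)
  finally have eq: "of_nat (card J) * of_nat N
      = complex_of_real (real (card V) * card D * card U) + (\<Sum>j\<in>J - {j0}. Vh j * S j * cnj (Uh j))" by simp
  have "real (card J) * N = norm (complex_of_real (real (card V) * card D * card U) + (\<Sum>j\<in>J - {j0}. Vh j * S j * cnj (Uh j)))"
    unfolding eq[symmetric] by (simp add: norm_mult)
  also have "\<dots> \<le> real (card V) * card D * card U + norm (\<Sum>j\<in>J - {j0}. Vh j * S j * cnj (Uh j))"
    using norm_triangle_ineq[of "complex_of_real (real (card V) * card D * card U)"] by (simp add: norm_mult)
  also have "norm (\<Sum>j\<in>J - {j0}. Vh j * S j * cnj (Uh j)) \<le> (\<Sum>j\<in>J - {j0}. C * (norm (Vh j) * norm (Uh j)))"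
  proof (rule sum_norm_le)
    fix j assume "j \<in> J - {j0}"
    then have "norm (S j) \<le> C" using bound by (simp add: S_def)
    then have "norm (S j) * (norm (Vh j) * norm (Uh j)) \<le> C * (norm (Vh j) * norm (Uh j))"
      by (rule mult_right_mono) simp
    then show "norm (Vh j * S j * cnj (Uh j)) \<le> C * (norm (Vh j) * norm (Uh j))"
      by (simp add: norm_mult mult_ac)
  qed
  also have "\<dots> \<le> (\<Sum>j\<in>J. C * (norm (Vh j) * norm (Uh j)))"
    using J \<open>C \<ge> 0\<close> by (intro sum_mono2) auto
  also have "\<dots> \<le> C * (L2_set (\<lambda>j. norm (Vh j)) J * L2_set (\<lambda>j. norm (Uh j)) J)"
    unfolding sum_distrib_left[symmetric]
    using L2_set_mult_ineq[of "\<lambda>j. norm (Vh j)" "\<lambda>j. norm (Uh j)" J] \<open>C \<ge> 0\<close>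
    by (intro mult_left_mono) auto
  also have "L2_set (\<lambda>j. norm (Vh j)) J * L2_set (\<lambda>j. norm (Uh j)) J = card J * sqrt (card U * card V)"
    unfolding L2_set_def Vh_def Uh_def parseval[OF ch U] parseval[OF ch V]
    by (simp add: real_sqrt_mult)
  finally have "real (card J) * N \<le> real (card V) * card D * card U + C * (card J * sqrt (card U * card V))" by simp
  then have "real N \<le> (real (card V) * card D * card U + C * (card J * sqrt (card U * card V))) / card J"
    using cardJ by (simp add: pos_le_divide_eq mult.commute)
  also have "\<dots> = real (card U) * card V * card D / card J + C * sqrt (card U * card V)"
    using cardJ by (simp add: field_simps)
  finally show ?thesis unfolding N_def .
qed

text \<open>All \<open>card V * card A\<close> pairs are edges, so one of the two terms of the
  mixing bound is at least half of that number. Squaring the second alternative produces the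
  4.\<close>

lemma incidence_dichotomy:
  fixes C :: real
  assumes ch: "orth_chars G opr J ch j0" and U: "U \<subseteq> G" "finite U" and V: "V \<subseteq> G" "finite V" "V \<noteq> {}"
    and D: "finite D" "\<And>t. t \<in> D \<Longrightarrow> \<Phi> t \<in> G" and cl: "\<And>x y. x \<in> G \<Longrightarrow> y \<in> G \<Longrightarrow> opr x y \<in> G"
    and bound: "\<And>j. j \<in> J - {j0} \<Longrightarrow> norm (\<Sum>t\<in>D. ch j (\<Phi> t)) \<le> C" and "C \<ge> 0"
    and A: "A \<subseteq> D" "\<And>v t. v \<in> V \<Longrightarrow> t \<in> A \<Longrightarrow> opr v (\<Phi> t) \<in> U"
  shows "real (card A) * card J \<le> 2 * real (card D) * card U \<or> (real (card A))\<^sup>2 * card V \<le> 4 * C\<^sup>2 * card U"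
proof (rule ccontr)
  assume neg: "\<not> ?thesis"
  have J: "real (card J) > 0" using ch by (auto simp: orth_chars_def card_gt_0_iff)
  have Vpos: "real (card V) > 0" using V by (simp add: card_gt_0_iff)
  have "card (V \<times> A) \<le> card {(v, t). v \<in> V \<and> t \<in> D \<and> opr v (\<Phi> t) \<in> U}"
  proof (rule card_mono)
    show "finite {(v, t). v \<in> V \<and> t \<in> D \<and> opr v (\<Phi> t) \<in> U}"
      by (rule finite_subset[of _ "V \<times> D"]) (use V D in auto)
  qed (use A in auto)
  then have "real (card V) * card A \<le> card {(v, t). v \<in> V \<and> t \<in> D \<and> opr v (\<Phi> t) \<in> U}"
    by (simp add: card_cartesian_product flip: of_nat_mult)
  also have "\<dots> \<le> real (card U) * card V * card D / card J + C * sqrt (card U * card V)"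
    by (rule expander_mixing[OF ch U V(1,2) D cl bound \<open>C \<ge> 0\<close>])
  also have "real (card U) * card V * card D / card J < card V * card A / 2"
  proof -
    have "card V * (2 * real (card D) * card U) < card V * (real (card A) * card J)"
      using neg Vpos by (intro mult_strict_left_mono) auto
    then show ?thesis using J by (simp add: field_simps)
  qed
  also have "C * sqrt (card U * card V) \<le> card V * card A / 2"
  proof (rule power2_le_imp_le)
    have "(C * sqrt (card U * card V))\<^sup>2 = C\<^sup>2 * card U * card V" by (simp add: power_mult_distrib)
    also have "\<dots> \<le> (card V * card A / 2)\<^sup>2"
    proof -
      have "card V * (4 * C\<^sup>2 * card U) \<le> card V * ((real (card A))\<^sup>2 * card V)"
        using neg Vpos by (intro mult_left_mono) auto
      then show ?thesis by (simp add: power2_eq_square field_simps)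
    qed
    finally show "(C * sqrt (card U * card V))\<^sup>2 \<le> (card V * card A / 2)\<^sup>2" .
  qed simp
  finally show False by simp
qed

section \<open>Construction of the characters of a finite field\<close>

definition unity_root :: "nat \<Rightarrow> nat \<Rightarrow> complex" where
  "unity_root n j = exp (2 * of_real pi * \<i> * of_nat j / of_nat n)"

lemma unity_root_add: "unity_root n (i + j) = unity_root n i * unity_root n j"
  by (simp add: unity_root_def distrib_left add_divide_distrib exp_add)

lemma unity_root_eq_iff: "n \<ge> 1 \<Longrightarrow> unity_root n i = unity_root n j \<longleftrightarrow> i mod n = j mod n"
  unfolding unity_root_def by (rule complex_root_unity_eq)

lemma unity_root_0 [simp]: "unity_root n 0 = 1"
  by (simp add: unity_root_def)

lemma cnj_eq_of_norm_1: assumes "norm z = 1" "z * w = 1" shows "cnj z = w"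
proof -
  have "z * cnj z = 1" using assms(1) by (simp add: complex_norm_square[symmetric])
  then have "z * cnj z = z * w" using assms(2) by simp
  moreover have "z \<noteq> 0" using assms by auto
  ultimately show ?thesis by simp
qed

context finite_subfield begin

lemma fixed_by_p_eq_of_nat: assumes "(x :: 'k) ^ p = x" obtains n where "x = of_nat n"
proof -
  have pow: "(of_nat n :: 'k) ^ p = of_nat n" for n
    using prime_gt_0_nat[OF prime_p] prime_p
    by (induction n) (auto simp: freshmans_dream p_def power_0_left)
  define h :: "'k poly" where "h = monom 1 p - monom 1 1"
  have p2: "p \<ge> 2" using prime_p by (rule prime_ge_2_nat)
  have deg: "degree h = p" unfolding h_def by (rule degree_fermat_poly[OF p2])
  then have "h \<noteq> 0" using p2 by auto
  have sub: "of_nat ` {..<p} \<subseteq> {x. poly h x = 0}" using pow by (auto simp: h_def poly_monom)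
  have "inj_on (of_nat :: nat \<Rightarrow> 'k) {..<p}"
  proof (rule inj_onI)
    fix i j assume ij: "i \<in> {..<p}" "j \<in> {..<p}" "(of_nat i :: 'k) = of_nat j"
    then show "i = j"
    proof (induction i j rule: linorder_wlog)
      case (le i j)
      then have "(of_nat (j - i) :: 'k) = 0" by simp
      then have "p dvd j - i" by (simp add: of_nat_eq_0_iff_char_dvd p_def)
      moreover have "j - i < p" using le by simp
      ultimately show ?case using le nat_dvd_not_less[of "j - i" p] by (cases "i = j") auto
    qed simp
  qed
  then have "card {x. poly h x = 0} \<le> card ((of_nat :: nat \<Rightarrow> 'k) ` {..<p})"
    using card_poly_roots_bound[OF \<open>h \<noteq> 0\<close>] deg by (simp add: card_image)
  then have "(of_nat :: nat \<Rightarrow> 'k) ` {..<p} = {x. poly h x = 0}"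
    using sub poly_roots_finite[OF \<open>h \<noteq> 0\<close>] by (intro card_seteq)
  moreover have "poly h x = 0" using assms by (simp add: h_def poly_monom)
  ultimately show ?thesis using that by blast
qed

text \<open>The absolute trace to the prime field, followed by a primitive p-th root of unity. The
  trace is a polynomial of degree p^(r - 1) < q, so it cannot vanish on all of
  \<open>F\<close>.\<close>

lemma ex_add_char: obtains \<psi> y where "add_char \<psi>" "y \<in> F" "\<psi> y \<noteq> 1"
proof -
  obtain r where r: "r > 0" "q = p ^ r" using q_eq_power by blast
  have p2: "p \<ge> 2" using prime_p by (rule prime_ge_2_nat)
  define T where "T x = (\<Sum>i<r. x ^ (p ^ i))" for x :: 'k
  have dream: "(x + y :: 'k) ^ p ^ i = x ^ p ^ i + y ^ p ^ i" for x y i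
    using freshmans_dream'[of "p ^ i" i x y] prime_p by (simp add: p_def)
  have T_add: "T (x + y) = T x + T y" for x y by (simp add: T_def dream sum.distrib)
  have T_p: "\<exists>n. T x = of_nat n" if "x \<in> F" for x
  proof -
    have "T x ^ p = (\<Sum>i<r. x ^ (p ^ Suc i))"
      unfolding T_def using freshmans_dream_sum'[of "p" 1 "\<lambda>i. x ^ (p ^ i)" "{..<r}"] prime_p
      by (simp add: p_def mult.commute flip: power_mult)
    also have "\<dots> + x = T x + x ^ (p ^ r)"
      unfolding T_def using sum.lessThan_Suc_shift[of "\<lambda>j. x ^ (p ^ j)" r] by (simp add: add.commute)
    finally have "T x ^ p = T x" using that r(2) by (simp add: F_iff)
    then show ?thesis using fixed_by_p_eq_of_nat by metis
  qed
  \<comment> \<open>\<open>ix x\<close> is an arbitrary natural number that represents the trace;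
    the fact \<open>eq\<close> shows that the root of unity does not depend on the choice.\<close>
  define ix where "ix x = (SOME n. T x = of_nat n)" for x
  have ix: "T x = of_nat (ix x)" if "x \<in> F" for x unfolding ix_def using T_p[OF that] by (rule someI_ex)
  define \<psi> where "\<psi> x = unity_root p (ix x)" for x
  have eq: "unity_root p i = unity_root p j" if "(of_nat i :: 'k) = of_nat j" for i j
  proof -
    have "i mod p = j mod p" using that
    proof (induction i j rule: linorder_wlog)
      case (le i j)
      then have "(of_nat (j - i) :: 'k) = 0" by simp
      then have "p dvd j - i" by (simp add: of_nat_eq_0_iff_char_dvd p_def)
      then show ?case using le mod_eq_dvd_iff_nat[of i j p] by simp
    qed simp
    then show ?thesis using p2 by (simp add: unity_root_eq_iff)
  qed
  have "\<psi> (x + y) = \<psi> x * \<psi> y" if "x \<in> F" "y \<in> F" for x y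
    unfolding \<psi>_def unity_root_add[symmetric]
    by (rule eq) (use ix[OF add_F[OF that]] ix[OF that(1)] ix[OF that(2)] in \<open>simp add: T_add\<close>)
  moreover have "\<psi> 0 = 1"
  proof -
    have "T 0 = 0" using T_add[of 0 0] by (simp only: add_0_left add_cancel_right_right)
    then have "unity_root p (ix 0) = unity_root p 0" using ix[OF zero_F] by (intro eq) simp
    then show ?thesis by (simp add: \<psi>_def)
  qed
  ultimately have ac: "add_char \<psi>" by (simp add: add_char_def)
  have "\<exists>y\<in>F. T y \<noteq> 0"
  proof (rule ccontr)
    assume "\<not> ?thesis"
    then have T0: "T y = 0" if "y \<in> F" for y using that by blast
    obtain r' where r': "r = Suc r'" using r by (cases r) auto
    define g :: "'k poly" where "g = (\<Sum>i<r. monom 1 (p ^ i))"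
    have "degree g \<le> p ^ r'"
      unfolding g_def using p2 r'
      by (intro degree_sum_le) (auto simp: degree_monom_eq intro!: power_increasing)
    also have "\<dots> < q" using p2 r r' by simp
    finally have "degree g < card F" by (simp add: q_def)
    then have "g = 0"
      using T0 by (intro poly_eqI_many_roots[OF finite_F]) (auto simp: g_def T_def poly_sum poly_monom)
    moreover have "coeff g 1 = 1"
    proof -
      have "coeff g 1 = (\<Sum>i<r. if i = 0 then 1 else 0)"
        unfolding g_def coeff_sum using p2
        by (intro sum.cong refl) (auto simp: power_eq_1_iff)
      then show ?thesis using r(1) by simp
    qed
    ultimately show False by simp
  qed
  then obtain y where y: "y \<in> F" "T y \<noteq> 0" by blast
  have "\<psi> y \<noteq> 1"
  proof
    assume "\<psi> y = 1"
    then have "unity_root p (ix y) = unity_root p 0" by (simp add: \<psi>_def)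
    then have "ix y mod p = 0 mod p" using p2 by (subst (asm) unity_root_eq_iff) auto
    then have "p dvd ix y" by (simp add: mod_eq_0_iff_dvd)
    then have "T y = 0" using ix[OF y(1)] by (simp add: of_nat_eq_0_iff_char_dvd p_def)
    then show False using y by simp
  qed
  then show ?thesis using that ac y by blast
qed

lemma ex_generator: obtains a where "a \<in> F" "a \<noteq> 0" "\<And>x. x \<in> F \<Longrightarrow> x \<noteq> 0 \<Longrightarrow> \<exists>i::nat. x = a ^ i"
proof -
  define R :: "'k ring" where "R = \<lparr>carrier = F, monoid.mult = (*), one = 1, ring.zero = 0, add = (+)\<rparr>"
  have inv: "\<exists>y\<in>F. x * y = 1" if "x \<in> F" "x \<noteq> 0" for x
    using inverse_F[OF that(1)] that(2) by (intro bexI[of _ "inverse x"]) auto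
  have "field R"
  proof -
    have "\<exists>y\<in>F. x + y = 0" if "x \<in> F" for x
      using uminus_F[OF that] by (intro bexI[of _ "- x"]) auto
    then show ?thesis
      unfolding R_def
      by unfold_locales
         (auto simp: add_F mult_F zero_F one_F algebra_simps Units_def dest: inv)
  qed
  then obtain a where a: "a \<in> carrier (mult_of R)" "carrier (mult_of R) = {a [^]\<^bsub>R\<^esub> i |i::nat. i \<in> UNIV}"
    using field.finite_field_mult_group_has_gen[of R] finite_F by (auto simp: R_def)
  have pow: "a [^]\<^bsub>R\<^esub> (i::nat) = a ^ i" for i
    by (induction i) (simp_all add: R_def nat_pow_def mult.commute)
  show ?thesis
  proof
    show "a \<in> F" "a \<noteq> 0" using a(1) by (auto simp: R_def)
    show "\<exists>i. x = a ^ i" if "x \<in> F" "x \<noteq> 0" for x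
    proof -
      have "x \<in> carrier (mult_of R)" using that by (simp add: R_def)
      then show ?thesis unfolding a(2) pow by blast
    qed
  qed
qed

text \<open>A generator goes to a primitive root of unity of order q - 1. Being faithful,
  \<open>\<theta>\<close> yields all multiplicative characters as its powers.\<close>

lemma ex_mult_char:
  obtains \<theta> where "mult_char \<theta>" "\<And>x. x \<in> F \<Longrightarrow> x \<noteq> 0 \<Longrightarrow> \<theta> x = 1 \<Longrightarrow> x = 1"
proof -
  obtain a where a: "a \<in> F" "a \<noteq> 0" "\<And>x. x \<in> F \<Longrightarrow> x \<noteq> 0 \<Longrightarrow> \<exists>i::nat. x = a ^ i"
    by (rule ex_generator) blast
  have q1: "q - 1 \<ge> 1" using q_ge_2 by simp
  have pow_mod: "a ^ i = a ^ (i mod (q - 1))" for i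
  proof -
    have "a ^ i = a ^ ((q - 1) * (i div (q - 1)) + i mod (q - 1))" by simp
    also have "\<dots> = a ^ (i mod (q - 1))"
      unfolding power_add power_mult power_q_minus_1[OF a(1,2)] by simp
    finally show ?thesis .
  qed
  have "F - {0} \<subseteq> (\<lambda>i. a ^ i) ` {..<q - 1}"
  proof
    fix x assume "x \<in> F - {0}"
    then obtain i :: nat where "x = a ^ i" using a(3) by auto
    then show "x \<in> (\<lambda>i. a ^ i) ` {..<q - 1}" using pow_mod[of i] q1 by auto
  qed
  then have "card {..<q - 1} \<le> card ((\<lambda>i. a ^ i) ` {..<q - 1})"
    using card_mono[of "(\<lambda>i. a ^ i) ` {..<q - 1}" "F - {0}"] finite_F zero_F by (simp add: q_def)
  then have "inj_on (\<lambda>i. a ^ i) {..<q - 1}"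
    by (intro eq_card_imp_inj_on antisym card_image_le) auto
  then have eq: "a ^ i = a ^ j \<longleftrightarrow> i mod (q - 1) = j mod (q - 1)" for i j
    using pow_mod[of i] pow_mod[of j] q1 by (auto simp: inj_on_def)
  define ix where "ix x = (SOME i. x = a ^ i)" for x
  have ix: "x = a ^ ix x" if "x \<in> F" "x \<noteq> 0" for x
    unfolding ix_def using a(3)[OF that] by (rule someI_ex)
  define \<theta> where "\<theta> x = (if x = 0 then 0 else unity_root (q - 1) (ix x))" for x
  have "\<theta> (x * y) = \<theta> x * \<theta> y" if "x \<in> F" "y \<in> F" for x y
  proof (cases "x = 0 \<or> y = 0")
    case False
    then have "a ^ ix (x * y) = a ^ (ix x + ix y)"
      unfolding power_add using ix that mult_F[OF that] by (metis mult_eq_0_iff)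
    then have "unity_root (q - 1) (ix (x * y)) = unity_root (q - 1) (ix x + ix y)"
      unfolding eq by (simp only: unity_root_eq_iff[OF q1])
    then show ?thesis using False by (simp add: \<theta>_def unity_root_add)
  qed (auto simp: \<theta>_def)
  moreover have *: "x = 1" if "x \<in> F" "x \<noteq> 0" "\<theta> x = 1" for x
  proof -
    have "unity_root (q - 1) (ix x) = unity_root (q - 1) 0" using that by (simp add: \<theta>_def)
    then have "a ^ ix x = a ^ 0" unfolding eq by (simp only: unity_root_eq_iff[OF q1])
    then show ?thesis using ix[OF that(1,2)] by simp
  qed
  moreover have "\<theta> 1 = 1"
  proof -
    have "a ^ ix 1 = a ^ 0" using ix[OF one_F] by simp
    then have "unity_root (q - 1) (ix 1) = unity_root (q - 1) 0" unfolding eq by (simp only: unity_root_eq_iff[OF q1])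
    then show ?thesis by (simp add: \<theta>_def)
  qed
  ultimately show ?thesis using that[of \<theta>] by (auto simp: mult_char_def \<theta>_def)
qed

lemma orth_chars_add:
  assumes \<psi>: "add_char \<psi>" "y \<in> F" "\<psi> y \<noteq> 1"
  shows "orth_chars F (+) F (\<lambda>\<alpha> x. \<psi> (\<alpha> * x)) 0"
proof -
  have cnj: "cnj (\<psi> x) = \<psi> (- x)" if "x \<in> F" for x
    using \<psi>(1) that uminus_F[OF that] norm_add_char[OF \<psi>(1) that]
    by (intro cnj_eq_of_norm_1) (auto simp: add_char_def, metis add.right_inverse)
  have orth: "(\<Sum>\<alpha>\<in>F. \<psi> (\<alpha> * u) * cnj (\<psi> (\<alpha> * v))) = (if u = v then of_nat (card F) else 0)"
    if uv: "u \<in> F" "v \<in> F" for u v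
  proof -
    have z: "u - v \<in> F" using add_F[OF uv(1) uminus_F[OF uv(2)]] by simp
    have "(\<Sum>\<alpha>\<in>F. \<psi> (\<alpha> * u) * cnj (\<psi> (\<alpha> * v))) = (\<Sum>\<alpha>\<in>F. \<psi> (\<alpha> * (u - v)))"
    proof (rule sum.cong[OF refl])
      fix \<alpha> assume \<alpha>: "\<alpha> \<in> F"
      have "\<psi> (\<alpha> * u + - (\<alpha> * v)) = \<psi> (\<alpha> * u) * \<psi> (- (\<alpha> * v))"
        using \<psi>(1) mult_F[OF \<alpha> uv(1)] uminus_F[OF mult_F[OF \<alpha> uv(2)]] unfolding add_char_def by blast
      then show "\<psi> (\<alpha> * u) * cnj (\<psi> (\<alpha> * v)) = \<psi> (\<alpha> * (u - v))"
        using cnj mult_F[OF \<alpha> uv(2)] by (simp add: right_diff_distrib)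
    qed
    also have "\<dots> = (if u = v then of_nat (card F) else 0)"
    proof (cases "u = v")
      case False
      have "bij_betw (\<lambda>\<alpha>. \<alpha> * (u - v)) F F"
        by (rule bij_betwI[where g = "\<lambda>\<alpha>. \<alpha> * inverse (u - v)"]) (use False z mult_F inverse_F in auto)
      then have "(\<Sum>\<alpha>\<in>F. \<psi> (\<alpha> * (u - v))) = (\<Sum>x\<in>F. \<psi> x)" by (rule sum.reindex_bij_betw)
      then show ?thesis using sum_add_char_eq_0[OF \<psi>] False by simp
    qed (use \<psi>(1) in \<open>simp add: add_char_def\<close>)
    finally show ?thesis .
  qed
  show ?thesis
    unfolding orth_chars_def using finite_F zero_F \<psi>(1) orth mult_F
    by (auto simp: add_char_def distrib_left)
qed

text \<open>For j = 0 a plain power would be 1 at x = 0. The case distinction lets the trivial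
  character vanish there, as \<open>mult_char\<close> requires.\<close>

definition pow_char :: "('k \<Rightarrow> complex) \<Rightarrow> nat \<Rightarrow> 'k \<Rightarrow> complex" where
  "pow_char \<theta> j x = (if x = 0 then 0 else \<theta> x ^ j)"

lemma mult_char_pow: "mult_char \<theta> \<Longrightarrow> mult_char (pow_char \<theta> j)"
  by (auto simp: mult_char_def pow_char_def power_mult_distrib)

lemma orth_chars_mult:
  assumes \<theta>: "mult_char \<theta>" "\<And>x. x \<in> F \<Longrightarrow> x \<noteq> 0 \<Longrightarrow> \<theta> x = 1 \<Longrightarrow> x = 1"
  shows "orth_chars (F - {0}) (*) {..<q - 1} (pow_char \<theta>) 0"
proof -
  have orth: "(\<Sum>j<q - 1. pow_char \<theta> j u * cnj (pow_char \<theta> j v)) = (if u = v then of_nat (card {..<q - 1}) else 0)"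
    if uv: "u \<in> F - {0}" "v \<in> F - {0}" for u v
  proof -
    define z where "z = u * inverse v"
    have z: "z \<in> F" "z \<noteq> 0" "z * v = u" using uv mult_F inverse_F by (auto simp: z_def)
    have \<theta>u: "\<theta> u = \<theta> z * \<theta> v" using \<theta>(1) z uv by (auto simp: mult_char_def)
    have "\<theta> v * cnj (\<theta> v) = 1"
      using norm_mult_char[OF \<theta>(1), of v] uv by (simp add: complex_norm_square[symmetric])
    then have "\<theta> u * cnj (\<theta> v) = \<theta> z" by (simp add: \<theta>u mult.assoc)
    then have "(\<Sum>j<q - 1. pow_char \<theta> j u * cnj (pow_char \<theta> j v)) = (\<Sum>j<q - 1. \<theta> z ^ j)"
      using uv by (simp add: pow_char_def flip: power_mult_distrib)
    also have "\<dots> = (if u = v then of_nat (card {..<q - 1}) else 0)"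
    proof (cases "u = v")
      case True
      then have "z = 1" using uv by (simp add: z_def)
      then show ?thesis using True \<theta>(1) by (simp add: mult_char_def)
    next
      case False
      then have "\<theta> z \<noteq> 1" using \<theta>(2)[of z] z by auto
      moreover have "\<theta> z ^ (q - 1) = 1"
        using mult_char_power[OF \<theta>(1) z(1), of "q - 1"] power_q_minus_1[OF z(1,2)] \<theta>(1)
        by (simp add: mult_char_def)
      ultimately show ?thesis using False by (simp add: geometric_sum)
    qed
    finally show ?thesis .
  qed
  show ?thesis
    unfolding orth_chars_def
  proof (intro conjI ballI)
    show "pow_char \<theta> j (x * y) = pow_char \<theta> j x * pow_char \<theta> j y" if "x \<in> F - {0}" "y \<in> F - {0}" for j x y
      using mult_char_pow[OF \<theta>(1), of j] that by (simp add: mult_char_def)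
  qed (use q_ge_2 orth in \<open>simp_all add: pow_char_def\<close>)
qed

end

section \<open>Growth of sets in a finite field\<close>

context finite_subfield begin

text \<open>The outcome of \<open>incidence_dichotomy\<close> for the eigenvalue bound (k + 1) sqrt
  q. In the first alternative 4 = 2 * 2, where the second factor comes from
  \<open>q * card D \<le> 2 * card J\<close>; this leaves room for q - 1 in place of q in the
  multiplicative cases.\<close>

definition dichotomy :: "nat \<Rightarrow> nat \<Rightarrow> nat \<Rightarrow> nat \<Rightarrow> bool" where
  "dichotomy k a u v \<longleftrightarrow> real q * a \<le> 4 * real u \<or> (real a)\<^sup>2 * v \<le> 4 * (real k + 1)\<^sup>2 * q * u"

lemma dichotomy_of_incidence:
  fixes C :: real
  assumes "orth_chars G opr J ch j0" "U \<subseteq> G" "finite U" "V \<subseteq> G" "finite V" "V \<noteq> {}"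
    "finite D" "\<And>t. t \<in> D \<Longrightarrow> \<Phi> t \<in> G" "\<And>x y. x \<in> G \<Longrightarrow> y \<in> G \<Longrightarrow> opr x y \<in> G"
    and bound: "\<And>j. j \<in> J - {j0} \<Longrightarrow> norm (\<Sum>t\<in>D. ch j (\<Phi> t)) \<le> (real k + 1) * sqrt q"
    and A: "A \<subseteq> D" "\<And>v t. v \<in> V \<Longrightarrow> t \<in> A \<Longrightarrow> opr v (\<Phi> t) \<in> U"
    and DJ: "q * card D \<le> 2 * card J"
  shows "dichotomy k (card A) (card U) (card V)"
proof -
  have "real (card A) * card J \<le> 2 * real (card D) * card U
      \<or> (real (card A))\<^sup>2 * card V \<le> 4 * ((real k + 1) * sqrt q)\<^sup>2 * card U"
    by (rule incidence_dichotomy[OF assms(1-9) bound _ A]) auto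
  then show ?thesis
  proof
    assume le: "real (card A) * card J \<le> 2 * real (card D) * card U"
    have "real (card J) > 0" using assms(1) by (auto simp: orth_chars_def card_gt_0_iff)
    have "(q * real (card A)) * card J \<le> 2 * (q * real (card D)) * card U"
      using mult_left_mono[OF le, of "real q"] by (simp add: mult_ac)
    also have "q * real (card D) \<le> 2 * real (card J)" using DJ by (metis of_nat_mono of_nat_mult of_nat_numeral)
    finally have "(q * real (card A)) * card J \<le> (4 * real (card U)) * card J" by (simp add: mult_ac mult_right_mono)
    then have "q * real (card A) \<le> 4 * real (card U)"
      using \<open>real (card J) > 0\<close> by (rule mult_right_le_imp_le)
    then show ?thesis by (simp add: dichotomy_def)
  next
    assume "(real (card A))\<^sup>2 * card V \<le> 4 * ((real k + 1) * sqrt q)\<^sup>2 * card U"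
    then show ?thesis by (simp add: dichotomy_def power_mult_distrib)
  qed
qed

lemma add_char_hom: "add_char \<psi> \<Longrightarrow> x \<in> F \<Longrightarrow> y \<in> F \<Longrightarrow> \<psi> (x + y) = \<psi> x * \<psi> y"
  by (simp add: add_char_def)

lemma sqrt_q_ge_1: "sqrt q \<ge> 1"
  using q_ge_2 by simp

lemma over_F_poly_in_F: "over_F f \<Longrightarrow> t \<in> F \<Longrightarrow> poly f t \<in> F"
  using poly_Fn[of f "Suc 0" t] by (simp add: Fn_1 over_F_def)

lemma over_F_smult: "c \<in> F \<Longrightarrow> over_F f \<Longrightarrow> over_F (smult c f)"
  by (simp add: over_F_def mult_F)

lemma mult_char_trivial: "mult_char (\<lambda>x. if x = 0 then 0 else 1)"
  by (simp add: mult_char_def)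

lemma sum_scaled_add_char_eq_0:
  assumes \<psi>: "add_char \<psi>" "y \<in> F" "\<psi> y \<noteq> 1" and "\<beta> \<in> F" "\<beta> \<noteq> 0"
  shows "(\<Sum>t\<in>F. \<psi> (\<beta> * t)) = 0"
proof -
  have "add_char (\<lambda>t. \<psi> (\<beta> * t))" using \<psi>(1) \<open>\<beta> \<in> F\<close> mult_F by (auto simp: add_char_def distrib_left)
  moreover have "y * inverse \<beta> \<in> F" using \<psi>(2) assms(4) by (intro mult_F inverse_F)
  moreover have "\<psi> (\<beta> * (y * inverse \<beta>)) \<noteq> 1"
  proof -
    have "\<beta> * (y * inverse \<beta>) = y" using assms(5) by simp
    then show ?thesis using \<psi>(3) by (simp only: not_False_eq_True)
  qed
  ultimately show ?thesis by (rule sum_add_char_eq_0)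
qed

text \<open>For \<beta> \<noteq> 0 the polynomial \<beta> f + \<alpha> X still has degree k because
  k \<ge> 2. For linear f it could be constant, and there would be no cancellation.\<close>

lemma dichotomy_add_add:
  assumes f: "over_F f" "degree f = k" "2 \<le> k" "k < p"
    and sub: "U1 \<subseteq> F" "U2 \<subseteq> F" "V1 \<subseteq> F" "V2 \<subseteq> F" "A \<subseteq> F" and ne: "V1 \<noteq> {}" "V2 \<noteq> {}"
    and U1: "\<And>v t. v \<in> V1 \<Longrightarrow> t \<in> A \<Longrightarrow> v + t \<in> U1"
    and U2: "\<And>v t. v \<in> V2 \<Longrightarrow> t \<in> A \<Longrightarrow> v + poly f t \<in> U2"
  shows "dichotomy k (card A) (card U1 * card U2) (card V1 * card V2)"
proof -
  obtain \<psi> y where \<psi>: "add_char \<psi>" "y \<in> F" "\<psi> y \<noteq> 1" by (rule ex_add_char)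
  note oc = orth_chars_prod[OF orth_chars_add[OF \<psi>] orth_chars_add[OF \<psi>]]
  have "dichotomy k (card A) (card (U1 \<times> U2)) (card (V1 \<times> V2))"
  proof (rule dichotomy_of_incidence[OF oc, where D = F and \<Phi> = "\<lambda>t. (t, poly f t)"])
    fix j assume "j \<in> F \<times> F - {(0, 0)}"
    then obtain \<alpha> \<beta> where j: "j = (\<alpha>, \<beta>)" "\<alpha> \<in> F" "\<beta> \<in> F" "\<alpha> \<noteq> 0 \<or> \<beta> \<noteq> 0" by auto
    show "norm (\<Sum>t\<in>F. \<psi> (fst j * fst (t, poly f t)) * \<psi> (snd j * snd (t, poly f t))) \<le> (real k + 1) * sqrt q"
    proof (cases "\<beta> = 0")
      case True
      then show ?thesis
        using sum_scaled_add_char_eq_0[OF \<psi> j(2)] j \<psi>(1) by (simp add: add_char_def)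
    next
      case False
      define g where "g = smult \<beta> f + [:0, \<alpha>:]"
      have g: "over_F g" unfolding g_def using j f(1)
        by (intro over_F_add over_F_smult) (auto simp: over_F_def zero_F coeff_pCons split: nat.splits)
      have "degree [:0, \<alpha>:] < degree (smult \<beta> f)" using False f(2,3) by simp
      then have deg: "degree g = k" unfolding g_def using False f(2) by (simp add: degree_add_eq_left)
      have "\<psi> (\<alpha> * t) * \<psi> (\<beta> * poly f t) = \<psi> (poly g t)" if "t \<in> F" for t
        using add_char_hom[OF \<psi>(1) mult_F[OF j(2) that] mult_F[OF j(3) over_F_poly_in_F[OF f(1) that]]]
        by (simp add: g_def algebra_simps)
      then have "(\<Sum>t\<in>F. \<psi> (\<alpha> * t) * \<psi> (\<beta> * poly f t)) = (\<Sum>t\<in>F. \<psi> (poly g t))"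
        by (intro sum.cong refl)
      \<comment> \<open>\<open>weil_mixed\<close> with the trivial multiplicative character omits t
        = 0. This point costs 1, which is why \<open>dichotomy\<close> has k + 1 in place of
        k.\<close>
      also have "\<dots> = \<psi> (poly g 0) + (\<Sum>t\<in>F. (if t = 0 then 0 else 1) * \<psi> (poly g t))"
        using finite_F zero_F by (simp add: sum.remove[of F 0])
      also have "norm \<dots> \<le> 1 + k * sqrt q"
        using norm_triangle_le[OF add_mono[OF eq_refl[OF norm_add_char[OF \<psi>(1) over_F_poly_in_F[OF g zero_F]]]
            weil_mixed[OF \<psi> mult_char_trivial g deg _ f(4)]]] f(3) by simp
      also have "\<dots> \<le> (real k + 1) * sqrt q" using sqrt_q_ge_1 by (simp add: algebra_simps)
      finally show ?thesis by (simp add: j)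
    qed
  qed (use sub ne U1 U2 finite_F add_F over_F_poly_in_F[OF f(1)]
       in \<open>auto simp: card_cartesian_product mem_Times_iff finite_subset simp flip: q_def\<close>)
  then show ?thesis by (simp add: card_cartesian_product)
qed

text \<open>A faithful character takes q - 1 distinct values on nonzero elements, but z ^ i = 1 has
  only i < q - 1 solutions.\<close>

lemma ex_pow_char_nontrivial:
  assumes \<theta>: "mult_char \<theta>" "\<And>x. x \<in> F \<Longrightarrow> x \<noteq> 0 \<Longrightarrow> \<theta> x = 1 \<Longrightarrow> x = 1" and i: "i \<noteq> 0" "i < q - 1"
  shows "\<exists>b\<in>F. b \<noteq> 0 \<and> pow_char \<theta> i b \<noteq> 1"
proof (rule ccontr)
  assume "\<not> ?thesis"
  then have sub: "\<theta> ` (F - {0}) \<subseteq> {z. z ^ i = 1}" by (auto simp: pow_char_def)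
  have "inj_on \<theta> (F - {0})"
  proof (rule inj_onI)
    fix x y assume xy: "x \<in> F - {0}" "y \<in> F - {0}" "\<theta> x = \<theta> y"
    have z: "x * inverse y \<in> F" using xy by (intro mult_F inverse_F) auto
    have "\<theta> (x * inverse y * y) = \<theta> (x * inverse y) * \<theta> y" using \<theta>(1) z xy unfolding mult_char_def by blast
    moreover have "\<theta> y \<noteq> 0" using norm_mult_char[OF \<theta>(1), of y] xy by auto
    moreover have "x * inverse y * y = x" using xy by simp
    ultimately have "\<theta> (x * inverse y) = 1" using xy(3) by simp
    then have "x * inverse y = 1" using \<theta>(2)[OF z] xy by simp
    then show "x = y" using xy by (simp add: field_simps)
  qed
  then have "q - 1 = card (\<theta> ` (F - {0}))" using zero_F finite_F by (simp add: card_image q_def)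
  also have "\<dots> \<le> card {z::complex. z ^ i = 1}"
    using sub i by (intro card_mono finite_roots_unity) auto
  also have "\<dots> \<le> i" using card_roots_unity[of i, where 'a = complex] i by simp
  finally show False using i by simp
qed

lemma dichotomy_mult_add:
  assumes f: "over_F f" "degree f = k" "1 \<le> k" "k < p"
    and sub: "U1 \<subseteq> F - {0}" "U2 \<subseteq> F" "V1 \<subseteq> F - {0}" "V2 \<subseteq> F" "A \<subseteq> F - {0}" and ne: "V1 \<noteq> {}" "V2 \<noteq> {}"
    and U1: "\<And>v t. v \<in> V1 \<Longrightarrow> t \<in> A \<Longrightarrow> v * t \<in> U1"
    and U2: "\<And>v t. v \<in> V2 \<Longrightarrow> t \<in> A \<Longrightarrow> v + poly f t \<in> U2"
  shows "dichotomy k (card A) (card U1 * card U2) (card V1 * card V2)"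
proof -
  obtain \<psi> y where \<psi>: "add_char \<psi>" "y \<in> F" "\<psi> y \<noteq> 1" by (rule ex_add_char)
  obtain \<theta> where \<theta>: "mult_char \<theta>" "\<And>x. x \<in> F \<Longrightarrow> x \<noteq> 0 \<Longrightarrow> \<theta> x = 1 \<Longrightarrow> x = 1" by (rule ex_mult_char) blast
  note om = orth_chars_mult[OF \<theta>]
  note oc = orth_chars_prod[OF om orth_chars_add[OF \<psi>]]
  have card_D: "card (F - {0}) = q - 1" using zero_F finite_F by (simp add: q_def)
  have "dichotomy k (card A) (card (U1 \<times> U2)) (card (V1 \<times> V2))"
  proof (rule dichotomy_of_incidence[OF oc, where D = "F - {0}" and \<Phi> = "\<lambda>t. (t, poly f t)"])
    fix j assume "j \<in> {..<q - 1} \<times> F - {(0, 0)}"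
    then obtain i \<beta> where j: "j = (i, \<beta>)" "i < q - 1" "\<beta> \<in> F" "i \<noteq> 0 \<or> \<beta> \<noteq> 0" by (cases j) auto
    note mc = mult_char_pow[OF \<theta>(1), of i]
    show "norm (\<Sum>t\<in>F - {0}. pow_char \<theta> (fst j) (fst (t, poly f t)) * \<psi> (snd j * snd (t, poly f t)))
        \<le> (real k + 1) * sqrt q"
    proof (cases "\<beta> = 0")
      case True
      then have "i \<noteq> 0" using j by simp
      have "(\<Sum>t\<in>F - {0}. pow_char \<theta> i t) = 0"
        using ex_pow_char_nontrivial[OF \<theta> \<open>i \<noteq> 0\<close> j(2)] sum_mult_char_eq_0[OF mc] by blast
      then show ?thesis using True j \<psi>(1) by (simp add: add_char_def)
    next
      case False
      have g: "over_F (smult \<beta> f)" "degree (smult \<beta> f) = k" using over_F_smult[OF j(3) f(1)] False f(2) by auto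
      have "(\<Sum>t\<in>F - {0}. pow_char \<theta> i t * \<psi> (\<beta> * poly f t)) = (\<Sum>t\<in>F. pow_char \<theta> i t * \<psi> (poly (smult \<beta> f) t))"
        using finite_F by (intro sum.mono_neutral_cong_left) (auto simp: pow_char_def)
      also have "norm \<dots> \<le> k * sqrt q" by (rule weil_mixed[OF \<psi> mc g f(3,4)])
      also have "\<dots> \<le> (real k + 1) * sqrt q" by (simp add: algebra_simps)
      finally show ?thesis by (simp add: j)
    qed
  qed (use sub ne U1 U2 finite_F add_F mult_F over_F_poly_in_F[OF f(1)] card_D
       in \<open>auto simp: card_cartesian_product mem_Times_iff finite_subset simp flip: q_def\<close>)
  then show ?thesis by (simp add: card_cartesian_product)
qed

lemma dichotomy_mult_mult:
  assumes f: "over_F f" "degree f = k" "f = [:-r, 1:] * g" "poly g r \<noteq> 0" "r \<noteq> 0"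
    and sub: "U1 \<subseteq> F - {0}" "U2 \<subseteq> F - {0}" "V1 \<subseteq> F - {0}" "V2 \<subseteq> F - {0}"
      "A \<subseteq> {t \<in> F - {0}. poly f t \<noteq> 0}" and ne: "V1 \<noteq> {}" "V2 \<noteq> {}"
    and U1: "\<And>v t. v \<in> V1 \<Longrightarrow> t \<in> A \<Longrightarrow> v * t \<in> U1"
    and U2: "\<And>v t. v \<in> V2 \<Longrightarrow> t \<in> A \<Longrightarrow> v * poly f t \<in> U2"
  shows "dichotomy k (card A) (card U1 * card U2) (card V1 * card V2)"
proof -
  obtain \<theta> where \<theta>: "mult_char \<theta>" "\<And>x. x \<in> F \<Longrightarrow> x \<noteq> 0 \<Longrightarrow> \<theta> x = 1 \<Longrightarrow> x = 1" by (rule ex_mult_char) blast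
  note om = orth_chars_mult[OF \<theta>]
  note oc = orth_chars_prod[OF om om]
  let ?D = "{t \<in> F - {0}. poly f t \<noteq> 0}"
  have card_F: "card (F - {0}) = q - 1" using zero_F finite_F by (simp add: q_def)
  have f0: "f \<noteq> 0" using f(3,4) by (metis mult_eq_0_iff pCons_eq_0_iff poly_0 zero_neq_one)
  have "dichotomy k (card A) (card (U1 \<times> U2)) (card (V1 \<times> V2))"
  proof (rule dichotomy_of_incidence[OF oc, where D = ?D and \<Phi> = "\<lambda>t. (t, poly f t)"])
    fix j assume "j \<in> {..<q - 1} \<times> {..<q - 1} - {(0, 0)}"
    then obtain i l where j: "j = (i, l)" "i < q - 1" "l < q - 1" "i \<noteq> 0 \<or> l \<noteq> 0" by (cases j) auto
    note mi = mult_char_pow[OF \<theta>(1), of i] and ml = mult_char_pow[OF \<theta>(1), of l]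
    have "norm (\<Sum>t\<in>?D. pow_char \<theta> i t * pow_char \<theta> l (poly f t)) \<le> (real k + 1) * sqrt q"
    proof (cases "l = 0")
      case True
      then have "i \<noteq> 0" using j by simp
      \<comment> \<open>Over all of \<open>F - {0}\<close> the nontrivial character sums to 0. What
        remains is minus its sum over the zeros of f, of size at most k.\<close>
      let ?Z = "{t \<in> F - {0}. poly f t = 0}"
      have "(\<Sum>t\<in>?D. pow_char \<theta> i t * pow_char \<theta> l (poly f t)) = (\<Sum>t\<in>?D. pow_char \<theta> i t)"
        using True by (intro sum.cong refl) (auto simp: pow_char_def)
      also have "\<dots> = (\<Sum>t\<in>F - {0}. pow_char \<theta> i t) - (\<Sum>t\<in>?Z. pow_char \<theta> i t)"
      proof -
        have eq: "F - {0} = ?D \<union> ?Z" by auto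
        have "sum (pow_char \<theta> i) (?D \<union> ?Z) = sum (pow_char \<theta> i) ?D + sum (pow_char \<theta> i) ?Z"
          using finite_F by (intro sum.union_disjoint) auto
        then show ?thesis by (subst eq) simp
      qed
      also have "(\<Sum>t\<in>F - {0}. pow_char \<theta> i t) = 0"
        using ex_pow_char_nontrivial[OF \<theta> \<open>i \<noteq> 0\<close> j(2)] sum_mult_char_eq_0[OF mi] by blast
      also have "norm (0 - (\<Sum>t\<in>?Z. pow_char \<theta> i t)) \<le> (\<Sum>t\<in>?Z. 1)"
        using norm_mult_char_le[OF mi] by (simp only: diff_0 norm_minus_cancel) (intro sum_norm_le, auto)
      also have "\<dots> \<le> real (card {t. poly f t = 0})"
        using card_mono[OF poly_roots_finite[OF f0], of ?Z] by auto
      also have "\<dots> \<le> real k" using card_poly_roots_bound[OF f0] f(2) by simp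
      also have "\<dots> \<le> (real k + 1) * sqrt q"
        using mult_mono[of "real k" "real k + 1" 1 "sqrt q"] sqrt_q_ge_1 by simp
      finally show ?thesis .
    next
      case False
      obtain b where b: "b \<in> F" "b \<noteq> 0" "pow_char \<theta> l b \<noteq> 1" using ex_pow_char_nontrivial[OF \<theta> False j(3)] by blast
      have "(\<Sum>t\<in>?D. pow_char \<theta> i t * pow_char \<theta> l (poly f t)) = (\<Sum>t\<in>F. pow_char \<theta> l (poly f t) * pow_char \<theta> i t)"
        using finite_F by (intro sum.mono_neutral_cong_left) (auto simp: pow_char_def)
      also have "norm \<dots> \<le> k * sqrt q" by (rule weil_mult[OF ml b mi f])
      also have "\<dots> \<le> (real k + 1) * sqrt q" by (simp add: algebra_simps)
      finally show ?thesis .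
    qed
    then show "norm (\<Sum>t\<in>?D. pow_char \<theta> (fst j) (fst (t, poly f t)) * pow_char \<theta> (snd j) (snd (t, poly f t)))
        \<le> (real k + 1) * sqrt q" by (simp add: j)
  next
    have "card ?D \<le> q - 1" unfolding card_F[symmetric] using finite_F by (intro card_mono) auto
    moreover have "q \<le> 2 * (q - 1)" using q_ge_2 by simp
    ultimately have "q * card ?D \<le> (2 * (q - 1)) * (q - 1)" by (rule mult_le_mono[rotated])
    then show "q * card ?D \<le> 2 * card ({..<q - 1} \<times> {..<q - 1})" by (simp add: card_cartesian_product mult.assoc)
  qed (use sub ne U1 U2 finite_F mult_F over_F_poly_in_F[OF f(1)]
       in \<open>auto simp: mem_Times_iff finite_subset\<close>)
  then show ?thesis by (simp add: card_cartesian_product)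
qed

end

section \<open>Iteration over the number of summands or factors\<close>

lemma growth_iterate:
  fixes n :: "nat \<Rightarrow> real" and a S q \<kappa> :: real
  assumes pos: "a > 0" "S > 0" "q > 0" "\<kappa> \<ge> 1"
    and base: "a \<le> \<kappa> * n 1" and mono: "\<And>d. d \<ge> 1 \<Longrightarrow> n d \<le> n (Suc d)"
    and step: "\<And>d. d \<ge> 1 \<Longrightarrow> q * a \<le> \<kappa> * (n (Suc d) * S) \<or> a ^ 3 * n d \<le> \<kappa> * q * (n (Suc d) * S)"
    and "d \<ge> 1"
  shows "min (q * a / S) (a * (a ^ 3 / (q * S)) ^ (d - 1)) \<le> \<kappa> ^ d * n d"
  using \<open>d \<ge> 1\<close>
\<comment> \<open>Each step multiplies the size by at least \<rho> / \<kappa>, unless it reaches B /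
  \<kappa> at once. A bound by B is kept from then on because n is nondecreasing. One factor
  \<kappa> per step makes \<kappa> ^ d.\<close>
proof (induction d rule: dec_induct)
  case base
  then show ?case using assms(5) by simp
next
  case (step d)
  define B where "B = q * a / S"
  define \<rho> where "\<rho> = a ^ 3 / (q * S)"
  have \<rho>: "\<rho> \<ge> 0" using pos by (simp add: \<rho>_def)
  have n_nonneg: "n d \<ge> 0"
  proof -
    have "0 < \<kappa> * n 1" using assms(1,5) by linarith
    then have "n 1 > 0" using pos(4) by (simp add: zero_less_mult_iff)
    moreover have "n 1 \<le> n d" using \<open>1 \<le> d\<close> by (induction d rule: dec_induct) (use mono order_trans in blast)+
    ultimately show ?thesis by simp
  qed
  have \<kappa>pow: "\<kappa> ^ d \<ge> 1" using pos(4) by simp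
  have IH: "min B (a * \<rho> ^ (d - 1)) \<le> \<kappa> ^ d * n d" using step.IH by (simp add: B_def \<rho>_def)
  have "min B (a * \<rho> ^ d) \<le> \<kappa> ^ Suc d * n (Suc d)"
  proof (cases "q * a \<le> \<kappa> * (n (Suc d) * S)")
    case True
    then have "B \<le> \<kappa> * n (Suc d)" using pos by (simp add: B_def field_simps)
    also have "\<dots> \<le> \<kappa> ^ d * (\<kappa> * n (Suc d))"
      using mult_right_mono[OF \<kappa>pow, of "\<kappa> * n (Suc d)"] n_nonneg mono[OF \<open>1 \<le> d\<close>] pos(4) by simp
    finally show ?thesis by (simp add: min_le_iff_disj mult_ac)
  next
    case False
    then have "a ^ 3 * n d \<le> \<kappa> * q * (n (Suc d) * S)" using assms(7)[OF \<open>1 \<le> d\<close>] by blast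
    then have st: "\<rho> * n d \<le> \<kappa> * n (Suc d)" using pos by (simp add: \<rho>_def field_simps)
    show ?thesis
    proof (cases "B \<le> a * \<rho> ^ (d - 1)")
      case True
      then have "B \<le> \<kappa> ^ d * n d" using IH by simp
      also have "\<dots> \<le> \<kappa> ^ Suc d * n (Suc d)"
        using mono[OF \<open>1 \<le> d\<close>] n_nonneg pos(4) by (intro mult_mono power_increasing) auto
      finally show ?thesis by (simp add: min_le_iff_disj)
    next
      case False
      then have "a * \<rho> ^ (d - 1) \<le> \<kappa> ^ d * n d" using IH by simp
      then have "\<rho> * (a * \<rho> ^ (d - 1)) \<le> \<kappa> ^ d * (\<rho> * n d)"
        using mult_left_mono[OF _ \<rho>] by (metis mult.left_commute)
      also have "\<dots> \<le> \<kappa> ^ d * (\<kappa> * n (Suc d))" using st \<kappa>pow by (intro mult_left_mono) auto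
      also have "\<rho> * (a * \<rho> ^ (d - 1)) = a * \<rho> ^ d" using \<open>1 \<le> d\<close> by (cases d) auto
      finally show ?thesis by (simp add: min_le_iff_disj mult_ac)
    qed
  qed
  then show ?case by (simp add: B_def \<rho>_def)
qed

text \<open>Per step: 4 (k + 1)^2 from \<open>dichotomy\<close>, and 8 = 2^3 for passing to a subset
  of at least half the size. The third factor k + 1 lets the same constant cover sets of at most 2
  (k + 1) elements.\<close>

definition growth_const :: "nat \<Rightarrow> nat \<Rightarrow> real" where
  "growth_const k d = 1 / (32 * (real k + 1) ^ 3) ^ d"

lemma growth_const_pos: "growth_const k d > 0" by (simp add: growth_const_def add_nonneg_pos)

text \<open>For so small a set the second entry of the minimum is at most (2 (k + 1))^(3 d). The
  claimed bound is then met by any nonempty set.\<close>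

lemma growth_bound_small:
  assumes "real a \<le> 2 * (real k + 1)" "q \<ge> 1" "d \<ge> 1"
  shows "growth_const k d * growth_bound q d a s \<le> 1"
proof -
  define m where "m = 2 * (real k + 1)"
  have m: "m \<ge> 1" by (simp add: m_def)
  have "real a ^ 3 / (real q * real s) \<le> real a ^ 3"
  proof (cases "s = 0")
    case False
    then have "1 \<le> real q * real s" using \<open>q \<ge> 1\<close> mult_mono[of 1 "real q" 1 "real s"] by simp
    then show ?thesis by (simp add: divide_le_eq mult_left_le_one_le mult_le_cancel_left1)
  qed simp
  also have "\<dots> \<le> m ^ 3" using assms(1) by (intro power_mono) (auto simp: m_def)
  finally have "(real a ^ 3 / (real q * real s)) ^ (d - 1) \<le> (m ^ 3) ^ (d - 1)" by (intro power_mono) auto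
  moreover have "real a \<le> m ^ 3" using assms(1) self_le_power[of m 3] m by (simp add: m_def)
  ultimately have "real a * (real a ^ 3 / (real q * real s)) ^ (d - 1) \<le> m ^ 3 * (m ^ 3) ^ (d - 1)"
    using m by (intro mult_mono) auto
  also have "\<dots> = (m ^ 3) ^ d" using \<open>d \<ge> 1\<close> by (cases d) auto
  also have "\<dots> \<le> (32 * (real k + 1) ^ 3) ^ d"
    using m unfolding m_def power_mult_distrib[of 2] by (intro power_mono) auto
  finally have "growth_bound q d a s \<le> (32 * (real k + 1) ^ 3) ^ d"
    unfolding growth_bound_def by (rule min.coboundedI2)
  moreover have "(32 * (real k + 1) ^ 3) ^ d > 0" by (simp add: add_nonneg_pos)
  ultimately show ?thesis by (simp add: growth_const_def)
qed

lemma growth_bound_compare: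
  fixes a' S :: nat
  assumes "a \<le> 2 * a'" "0 < S" "S \<le> s" "q \<ge> 1" "d \<ge> 1"
  shows "growth_bound q d a s \<le> 8 ^ d * min (real q * a' / S) (a' * (real a' ^ 3 / (real q * S)) ^ (d - 1))"
proof -
  have a: "real a \<le> 2 * real a'" using assms(1) by linarith
  have 8: "(2::real) \<le> 8 ^ d" using self_le_power[of "8::real" d] assms(5) by simp
  have "real q * real a / real s \<le> real q * (2 * real a') / real S"
    using a assms by (intro frac_le mult_left_mono) auto
  also have "\<dots> = 2 * (real q * a' / S)" by simp
  also have "\<dots> \<le> 8 ^ d * (real q * a' / S)" using 8 by (intro mult_right_mono) auto
  finally have 1: "real q * real a / real s \<le> 8 ^ d * (real q * a' / S)" .
  have "real a ^ 3 / (real q * real s) \<le> (2 * real a') ^ 3 / (real q * real S)"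
    using a assms by (intro frac_le power_mono mult_left_mono mult_pos_pos) auto
  then have "(real a ^ 3 / (real q * real s)) ^ (d - 1) \<le> (8 * (real a' ^ 3 / (real q * real S))) ^ (d - 1)"
    by (intro power_mono) (auto simp: power_mult_distrib)
  then have "real a * (real a ^ 3 / (real q * real s)) ^ (d - 1)
      \<le> (8 * real a') * (8 * (real a' ^ 3 / (real q * real S))) ^ (d - 1)"
    using a by (intro mult_mono) auto
  also have "\<dots> = 8 ^ d * (a' * (real a' ^ 3 / (real q * S)) ^ (d - 1))"
    using \<open>d \<ge> 1\<close> unfolding power_mult_distrib by (cases d) auto
  finally have 2: "real a * (real a ^ 3 / (real q * real s)) ^ (d - 1) \<le> \<dots>" .
  show ?thesis
    unfolding growth_bound_def using min.mono[OF 1 2] by (simp add: min_mult_distrib_left)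
qed

text \<open>\<open>n d\<close> is the size of the d-fold set and \<open>S\<close> that of the other
  one. The starting vertices form the product of the d-fold set with the subset of size a', so the
  square in \<open>dichotomy\<close> becomes a'^3.\<close>

lemma (in finite_subfield) growth_conclusion:
  fixes n :: "nat \<Rightarrow> nat" and S a' N :: nat
  assumes "a \<le> 2 * a'" "0 < a'" "0 < S" "S \<le> s" "d \<ge> 1" "n d \<le> N" and base: "a' \<le> (k + 1) * n 1"
    and mono: "\<And>d. d \<ge> 1 \<Longrightarrow> n d \<le> n (Suc d)"
    and step: "\<And>d. d \<ge> 1 \<Longrightarrow> dichotomy k a' (n (Suc d) * S) (n d * a')"
  shows "growth_const k d * growth_bound q d a s \<le> N"
proof -
  define \<kappa> where "\<kappa> = 4 * (real k + 1)\<^sup>2"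
  have k1: "(real k + 1)\<^sup>2 \<ge> 1" by simp
  then have "\<kappa> \<ge> 1" unfolding \<kappa>_def by linarith
  have "min (real q * a' / S) (a' * (real a' ^ 3 / (real q * S)) ^ (d - 1)) \<le> \<kappa> ^ d * n d"
  proof (rule growth_iterate[where n = "\<lambda>d. real (n d)"])
    have "real a' \<le> (real k + 1) * n 1" using base by (metis of_nat_1 of_nat_add of_nat_mono of_nat_mult)
    also have "\<dots> \<le> \<kappa> * n 1"
      unfolding \<kappa>_def power2_eq_square by (intro mult_right_mono) (auto simp: algebra_simps)
    finally show "real a' \<le> \<kappa> * n 1" .
    show "real q * a' \<le> \<kappa> * (n (Suc d) * real S) \<or> real a' ^ 3 * n d \<le> \<kappa> * real q * (n (Suc d) * real S)" if d: "d \<ge> 1" for d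
    proof -
      consider "real q * a' \<le> 4 * real (n (Suc d) * S)" | "(real a')\<^sup>2 * (n d * a') \<le> 4 * (real k + 1)\<^sup>2 * q * (n (Suc d) * S)"
        using step[OF d] unfolding dichotomy_def by blast
      then show ?thesis
      proof cases
        case 1
        also have "4 * real (n (Suc d) * S) \<le> \<kappa> * (n (Suc d) * real S)"
          unfolding \<kappa>_def using k1 by (simp add: mult_right_mono)
        finally show ?thesis by simp
      next
        case 2
        then show ?thesis by (simp add: \<kappa>_def power2_eq_square power3_eq_cube mult_ac)
      qed
    qed
  qed (use assms \<open>\<kappa> \<ge> 1\<close> in auto)
  then have "8 ^ d * min (real q * a' / S) (a' * (real a' ^ 3 / (real q * S)) ^ (d - 1)) \<le> 8 ^ d * (\<kappa> ^ d * n d)"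
    by (rule mult_left_mono) simp
  then have "growth_bound q d a s \<le> 8 ^ d * (\<kappa> ^ d * n d)"
    using growth_bound_compare[OF assms(1,3,4) _ \<open>d \<ge> 1\<close>, of q] q_ge_2 by linarith
  also have "\<dots> = (8 * \<kappa>) ^ d * n d" by (simp only: power_mult_distrib mult.assoc)
  also have "8 * \<kappa> = 32 * (real k + 1)\<^sup>2" by (simp add: \<kappa>_def)
  also have "(32 * (real k + 1)\<^sup>2) ^ d * n d \<le> (32 * (real k + 1) ^ 3) ^ d * N"
  proof (rule mult_mono)
    have "(real k + 1)\<^sup>2 \<le> (real k + 1) ^ 3" by (rule power_increasing) auto
    then show "(32 * (real k + 1)\<^sup>2) ^ d \<le> (32 * (real k + 1) ^ 3) ^ d" by (intro power_mono) auto
  qed (use assms(6) in auto)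
  finally have "growth_bound q d a s \<le> (32 * (real k + 1) ^ 3) ^ d * N" .
  moreover have "(32 * (real k + 1) ^ 3) ^ d > 0" by (simp add: add_nonneg_pos)
  ultimately show ?thesis by (simp add: growth_const_def pos_divide_le_eq mult.commute)
qed

section \<open>Finite fields with a carrier set\<close>

lemma (in ring) poly_eval_hom:
  fixes h :: "'a \<Rightarrow> 'c::comm_ring_1"
  assumes h: "h \<zero> = 0" "h \<one> = 1"
    "\<And>x y. \<lbrakk>x \<in> carrier R; y \<in> carrier R\<rbrakk> \<Longrightarrow> h (x \<oplus> y) = h x + h y"
    "\<And>x y. \<lbrakk>x \<in> carrier R; y \<in> carrier R\<rbrakk> \<Longrightarrow> h (x \<otimes> y) = h x * h y"
    and "set f \<subseteq> carrier R" "x \<in> carrier R"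
  shows "poly (Poly (rev (map h f))) (h x) = h (eval f x)"
proof -
  have pow: "h (x [^] (n::nat)) = h x ^ n" for n
    using \<open>x \<in> carrier R\<close> by (induction n) (simp_all add: h mult.commute)
  show ?thesis
    using assms(5,6)
    by (induction f) (simp_all add: h pow Poly_append poly_monom eval_in_carrier add.commute mult.commute)
qed

text \<open>The bridge from a field with a carrier set to \<open>finite_subfield\<close>, whose
  results live in a type. Being injective, \<open>h\<close> preserves all cardinalities.\<close>

locale finite_field_embedding = field R for R :: "('a, 'b) ring_scheme" (structure) +
  fixes h :: "'a \<Rightarrow> 'k::alg_closed_field"
  assumes finite_carrier: "finite (carrier R)"
    and h_add: "\<lbrakk>x \<in> carrier R; y \<in> carrier R\<rbrakk> \<Longrightarrow> h (x \<oplus> y) = h x + h y"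
    and h_mult: "\<lbrakk>x \<in> carrier R; y \<in> carrier R\<rbrakk> \<Longrightarrow> h (x \<otimes> y) = h x * h y"
    and h_one: "h \<one> = 1"
    and h_inj: "inj_on h (carrier R)"
begin

lemma h_zero: "h \<zero> = 0"
  using h_add[of \<zero> \<zero>] by (simp only: zero_closed r_zero add_cancel_right_right)

lemma h_eq_0_iff: "x \<in> carrier R \<Longrightarrow> h x = 0 \<longleftrightarrow> x = \<zero>"
  using h_inj h_zero by (metis inj_on_eq_iff zero_closed)

lemma h_nat: "h ([n] \<cdot> \<one>) = of_nat n" for n :: nat
  by (induction n) (auto simp: h_zero h_one h_add add.commute)

sublocale FS: finite_subfield "h ` carrier R"
proof
  show "finite (h ` carrier R)" using finite_carrier by simp
  show "1 \<in> h ` carrier R" using h_one by (metis image_eqI one_closed)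
  show "x + y \<in> h ` carrier R" if "x \<in> h ` carrier R" "y \<in> h ` carrier R" for x y
    using that by (auto simp flip: h_add)
  show "x * y \<in> h ` carrier R" if "x \<in> h ` carrier R" "y \<in> h ` carrier R" for x y
    using that by (auto simp flip: h_mult)
  show "- x \<in> h ` carrier R" if x: "x \<in> h ` carrier R" for x
  proof -
    obtain a where a: "a \<in> carrier R" "x = h a" using x by blast
    have "h (\<ominus> a) + h a = 0" using a by (simp add: l_neg h_zero flip: h_add)
    then have "- x = h (\<ominus> a)" using a(2) by (metis add_eq_0_iff2)
    then show ?thesis using a(1) by simp
  qed
  show "inverse x \<in> h ` carrier R" if x: "x \<in> h ` carrier R" for x
  proof -
    obtain a where a: "a \<in> carrier R" "x = h a" using x by blast
    show ?thesis
    proof (cases "a = \<zero>")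
      case True
      then show ?thesis using a h_zero by (metis image_eqI inverse_zero zero_closed)
    next
      case False
      then have u: "a \<in> Units R" using a by (simp add: field_Units)
      then have "h a * h (inv a) = 1" using a h_mult[of a "inv a"] h_one by simp
      then have "inverse x = h (inv a)" using a(2) inverse_unique by blast
      then show ?thesis using u by simp
    qed
  qed
qed

lemma card_image_h: "B \<subseteq> carrier R \<Longrightarrow> card (h ` B) = card B"
  using h_inj by (meson card_image inj_on_subset)

lemma q_eq: "FS.q = card (carrier R)" unfolding FS.q_def by (simp add: card_image_h)

text \<open>This turns the hypothesis that the degree is below the characteristic into
  \<open>k < FS.p\<close>.\<close>

lemma characteristic_le: "characteristic R \<le> FS.p"
proof -
  have "h ([FS.p] \<cdot> \<one>) = h \<zero>" by (simp add: h_nat h_zero)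
  then have "[FS.p] \<cdot> \<one> = \<zero>" using h_inj by (auto dest: inj_onD)
  then have "group.ord (add_monoid R) \<one> dvd FS.p"
    using add.pow_eq_id[of \<one> FS.p] by (simp add: add_pow_def)
  then show ?thesis unfolding characteristic_def using prime_gt_0_nat[OF FS.prime_p] by (rule dvd_imp_le)
qed

definition hpoly :: "'a list \<Rightarrow> 'k poly" where "hpoly f = Poly (rev (map h f))"

lemma poly_hpoly: "set f \<subseteq> carrier R \<Longrightarrow> x \<in> carrier R \<Longrightarrow> poly (hpoly f) (h x) = h (eval f x)"
  unfolding hpoly_def by (rule poly_eval_hom) (simp_all add: h_zero h_one h_add h_mult)

lemma over_F_hpoly: "set f \<subseteq> carrier R \<Longrightarrow> FS.over_F (hpoly f)"
  unfolding FS.over_F_def hpoly_def coeff_Poly_eq nth_default_def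
  using FS.zero_F by (auto simp: rev_nth subset_iff intro!: imageI)

lemma degree_hpoly:
  assumes "f \<in> carrier (poly_ring R)" "f \<noteq> []"
  shows "degree (hpoly f) = length f - 1" and "hpoly f \<noteq> 0"
proof -
  have f: "set f \<subseteq> carrier R" "hd f \<noteq> \<zero>"
    using assms by (auto simp: univ_poly_carrier[symmetric] polynomial_def)
  have hd: "hd f \<in> carrier R" using f(1) assms(2) by auto
  have "poly.coeff (hpoly f) (length f - 1) = h (hd f)"
    using assms(2) by (cases f) (auto simp: hpoly_def coeff_Poly_eq nth_default_def nth_append)
  then have ne: "poly.coeff (hpoly f) (length f - 1) \<noteq> 0" using f(2) hd h_eq_0_iff by simp
  then show "hpoly f \<noteq> 0" by auto
  have "poly.coeff (hpoly f) i = 0" if "i > length f - 1" for i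
    using that assms(2) by (auto simp: hpoly_def coeff_Poly_eq nth_default_def)
  then have "degree (hpoly f) \<le> length f - 1" by (intro degree_le) auto
  then show "degree (hpoly f) = length f - 1" using ne le_degree by (intro antisym)
qed

lemma set_add_eq: "B <+>\<^bsub>R\<^esub> C = {b \<oplus> c | b c. b \<in> B \<and> c \<in> C}"
  by (auto simp: set_add_def set_mult_def)

lemma set_mult_eq: "B <#>\<^bsub>R\<^esub> C = {b \<otimes> c | b c. b \<in> B \<and> c \<in> C}"
  by (auto simp: set_mult_def)

lemma set_add_subset: "B \<subseteq> carrier R \<Longrightarrow> C \<subseteq> carrier R \<Longrightarrow> B <+>\<^bsub>R\<^esub> C \<subseteq> carrier R"
  by (auto simp: set_add_eq)

lemma set_mult_subset: "B \<subseteq> carrier R \<Longrightarrow> C \<subseteq> carrier R \<Longrightarrow> B <#>\<^bsub>R\<^esub> C \<subseteq> carrier R"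
  by (auto simp: set_mult_eq)

lemma set_mult_nonzero:
  "B \<subseteq> carrier R - {\<zero>} \<Longrightarrow> C \<subseteq> carrier R - {\<zero>} \<Longrightarrow> B <#>\<^bsub>R\<^esub> C \<subseteq> carrier R - {\<zero>}"
  by (auto simp: set_mult_eq integral_iff subset_iff)

lemma nfold_sum_props:
  assumes "B \<subseteq> carrier R"
  shows "nfold_sum R d B \<subseteq> carrier R" and "B \<noteq> {} \<Longrightarrow> nfold_sum R d B \<noteq> {}"
    and "nfold_sum R (Suc 0) B = B" and "B \<noteq> {} \<Longrightarrow> card (nfold_sum R d B) \<le> card (nfold_sum R (Suc d) B)"
proof -
  show sub: "nfold_sum R d B \<subseteq> carrier R" for d
    by (induction d) (auto simp: set_add_subset[OF assms])
  show "B \<noteq> {} \<Longrightarrow> nfold_sum R d B \<noteq> {}" by (induction d) (auto simp: set_add_eq)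
  show "nfold_sum R (Suc 0) B = B" using assms by (auto simp: set_add_eq) (metis r_zero subsetD)
  show "card (nfold_sum R d B) \<le> card (nfold_sum R (Suc d) B)" if ne: "B \<noteq> {}"
  proof -
    obtain b where b: "b \<in> B" "b \<in> carrier R" using ne assms by blast
    show ?thesis
    proof (rule card_inj_on_le[of "\<lambda>x. b \<oplus> x"])
      show "inj_on (\<lambda>x. b \<oplus> x) (nfold_sum R d B)" using b sub by (auto simp: inj_on_def subset_iff)
      show "(\<lambda>x. b \<oplus> x) ` nfold_sum R d B \<subseteq> nfold_sum R (Suc d) B" using b by (auto simp: set_add_eq)
      show "finite (nfold_sum R (Suc d) B)" using sub finite_carrier finite_subset by blast
    qed
  qed
qed

lemma nfold_prod_props:
  assumes "B \<subseteq> carrier R"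
  shows "nfold_prod R d B \<subseteq> carrier R" and "B \<noteq> {} \<Longrightarrow> nfold_prod R d B \<noteq> {}"
    and "nfold_prod R (Suc 0) B = B"
    and "\<zero> \<notin> B \<Longrightarrow> nfold_prod R d B \<subseteq> carrier R - {\<zero>}"
    and "B \<noteq> {} \<Longrightarrow> \<zero> \<notin> B \<Longrightarrow> card (nfold_prod R d B) \<le> card (nfold_prod R (Suc d) B)"
proof -
  show sub: "nfold_prod R d B \<subseteq> carrier R" for d
    by (induction d) (auto simp: set_mult_subset[OF assms])
  show "B \<noteq> {} \<Longrightarrow> nfold_prod R d B \<noteq> {}" by (induction d) (auto simp: set_mult_eq)
  show "nfold_prod R (Suc 0) B = B" using assms by (auto simp: set_mult_eq) (metis r_one subsetD)
  show "nfold_prod R d B \<subseteq> carrier R - {\<zero>}" if "\<zero> \<notin> B" for d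
  proof (induction d)
    case (Suc d)
    have "B \<subseteq> carrier R - {\<zero>}" using that assms by blast
    then show ?case using set_mult_nonzero[OF _ Suc.IH] by simp
  qed simp
  show "card (nfold_prod R d B) \<le> card (nfold_prod R (Suc d) B)" if ne: "B \<noteq> {}" "\<zero> \<notin> B"
  proof -
    obtain b where b: "b \<in> B" "b \<in> carrier R" "b \<noteq> \<zero>" using ne assms by blast
    show ?thesis
    proof (rule card_inj_on_le[of "\<lambda>x. b \<otimes> x"])
      show "inj_on (\<lambda>x. b \<otimes> x) (nfold_prod R d B)" using b sub by (auto simp: inj_on_def subset_iff m_lcancel)
      show "(\<lambda>x. b \<otimes> x) ` nfold_prod R d B \<subseteq> nfold_prod R (Suc d) B" using b by (auto simp: set_mult_eq)
      show "finite (nfold_prod R (Suc d) B)" using sub finite_carrier finite_subset by blast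
    qed
  qed
qed

lemma nfold_mono:
  assumes "B \<subseteq> C"
  shows "nfold_sum R d B \<subseteq> nfold_sum R d C" and "nfold_prod R d B \<subseteq> nfold_prod R d C"
proof -
  show "nfold_sum R d B \<subseteq> nfold_sum R d C"
    using assms by (induction d) (simp_all add: set_add_eq, blast)
  show "nfold_prod R d B \<subseteq> nfold_prod R d C"
    using assms by (induction d) (simp_all add: set_mult_eq, blast)
qed

lemma h_add_mem:
  "x \<in> B \<Longrightarrow> y \<in> C \<Longrightarrow> B \<subseteq> carrier R \<Longrightarrow> C \<subseteq> carrier R \<Longrightarrow> h x + h y \<in> h ` (C <+>\<^bsub>R\<^esub> B)"
  unfolding set_add_eq by (rule image_eqI[of _ _ "y \<oplus> x"]) (auto simp: h_add subset_iff add.commute)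

lemma h_mult_mem:
  "x \<in> B \<Longrightarrow> y \<in> C \<Longrightarrow> B \<subseteq> carrier R \<Longrightarrow> C \<subseteq> carrier R \<Longrightarrow> h x * h y \<in> h ` (C <#>\<^bsub>R\<^esub> B)"
  unfolding set_mult_eq by (rule image_eqI[of _ _ "y \<otimes> x"]) (auto simp: h_mult subset_iff mult.commute)

definition eval_image :: "'a list \<Rightarrow> 'a set \<Rightarrow> 'a set" where "eval_image f B = eval f ` B"

lemma eval_image_subset: "set f \<subseteq> carrier R \<Longrightarrow> B \<subseteq> carrier R \<Longrightarrow> eval_image f B \<subseteq> carrier R"
  unfolding eval_image_def using eval_in_carrier by blast

lemma card_le_eval_image:
  assumes f: "f \<in> carrier (poly_ring R)" "length f - 1 = k" "k \<ge> 1" and B: "B \<subseteq> carrier R"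
  shows "card B \<le> k * card (eval_image f B)"
proof -
  have fs: "set f \<subseteq> carrier R" using f(1) by (auto simp: univ_poly_carrier[symmetric] polynomial_def)
  have deg: "degree (hpoly f) = k" using degree_hpoly(1)[OF f(1)] f(2,3) by (cases "f = []") auto
  have finB: "finite B" using B finite_carrier finite_subset by blast
  have "card B = (\<Sum>y\<in>eval_image f B. card {x \<in> B. eval f x = y})"
    unfolding eval_image_def using sum.image_gen[OF finB, of "\<lambda>_. 1::nat" "eval f"] by simp
  also have "\<dots> \<le> (\<Sum>y\<in>eval_image f B. k)"
  proof (rule sum_mono)
    fix y assume "y \<in> eval_image f B"
    then have y: "y \<in> carrier R" using eval_image_subset[OF fs B] by blast
    define g where "g = hpoly f - [:h y:]"
    have "poly.coeff g k = poly.coeff (hpoly f) k" using f(3) by (simp add: g_def coeff_pCons split: nat.split)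
    also have "\<dots> \<noteq> 0" using deg f(3) by (metis degree_0 leading_coeff_0_iff not_one_le_zero)
    finally have g0: "g \<noteq> 0" by auto
    have "degree g \<le> k" unfolding g_def using deg by (intro degree_diff_le) auto
    have "card {x \<in> B. eval f x = y} = card (h ` {x \<in> B. eval f x = y})"
      using B by (subst card_image_h) auto
    also have "\<dots> \<le> card {z. poly g z = 0}"
      using poly_hpoly[OF fs] B by (intro card_mono poly_roots_finite[OF g0]) (auto simp: g_def subset_iff)
    also have "\<dots> \<le> k" using card_poly_roots_bound[OF g0] \<open>degree g \<le> k\<close> by simp
    finally show "card {x \<in> B. eval f x = y} \<le> k" .
  qed
  finally show ?thesis by (simp add: mult.commute)
qed

text \<open>The multiplicative graphs need sets without 0 and without zeros of f, which are at most
  k + 1 points. A set of more than 2 (k + 1) elements keeps at least half of them; for a smaller one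
  the bound is at most 1.\<close>

lemma growth_wrap:
  assumes f: "f \<in> carrier (poly_ring R)" "f \<noteq> []" "length f - 1 = k" and A: "A \<subseteq> carrier R" and "d \<ge> 1"
    and N: "A \<noteq> {} \<Longrightarrow> N \<ge> 1"
    and big: "\<And>A'. A' \<subseteq> A \<Longrightarrow> A' \<noteq> {} \<Longrightarrow> card A \<le> 2 * card A' \<Longrightarrow>
      (\<And>x. x \<in> A' \<Longrightarrow> x \<noteq> \<zero> \<and> eval f x \<noteq> \<zero>) \<Longrightarrow> growth_const k d * growth_bound FS.q d (card A) s \<le> real N"
  shows "real N \<ge> growth_const k d * growth_bound (card (carrier R)) d (card A) s"
proof -
  have fs: "set f \<subseteq> carrier R" using f(1) by (auto simp: univ_poly_carrier[symmetric] polynomial_def)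
  have finA: "finite A" using A finite_carrier finite_subset by blast
  have "growth_const k d * growth_bound FS.q d (card A) s \<le> real N"
  proof (cases "card A \<le> 2 * (k + 1)")
    case True
    show ?thesis
    proof (cases "A = {}")
      case False
      have "real (card A) \<le> real (2 * (k + 1))" using True by (rule of_nat_mono)
      then have "real (card A) \<le> 2 * (real k + 1)" by simp
      then have "growth_const k d * growth_bound FS.q d (card A) s \<le> 1"
        using FS.q_ge_2 \<open>d \<ge> 1\<close> by (intro growth_bound_small) auto
      also have "1 \<le> real N" using N[OF False] by simp
      finally show ?thesis .
    qed (simp add: growth_bound_def)
  next
    case False
    define Z where "Z = {x \<in> carrier R. x = \<zero> \<or> eval f x = \<zero>}"
    have "card Z = card (h ` Z)" by (subst card_image_h) (auto simp: Z_def)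
    also have "\<dots> \<le> card (insert 0 {z. poly (hpoly f) z = 0})"
      using poly_roots_finite[OF degree_hpoly(2)[OF f(1,2)]] poly_hpoly[OF fs]
      by (intro card_mono) (auto simp: Z_def h_zero)
    also have "\<dots> \<le> Suc (card {z. poly (hpoly f) z = 0})" by (rule card_insert_le_m1) auto
    also have "card {z. poly (hpoly f) z = 0} \<le> k"
      using card_poly_roots_bound[OF degree_hpoly(2)[OF f(1,2)]] degree_hpoly(1)[OF f(1,2)] f(3) by simp
    finally have "card Z \<le> k + 1" by simp
    then have "card A - (k + 1) \<le> card (A - Z)"
      using diff_card_le_card_Diff[of Z A] finite_carrier by (simp add: Z_def)
    then have c: "card A \<le> 2 * card (A - Z)" using False by arith
    have "A - Z \<noteq> {}"
    proof
      assume "A - Z = {}"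
      then show False using c False by (simp only: card.empty)
    qed
    then show ?thesis by (rule big[rotated]) (use A c in \<open>auto simp: Z_def\<close>)
  qed
  then show ?thesis by (simp add: q_eq)
qed

definition good :: "'a list \<Rightarrow> 'a set \<Rightarrow> bool" where
  "good f B \<longleftrightarrow> B \<subseteq> carrier R \<and> B \<noteq> {} \<and> (\<forall>x\<in>B. x \<noteq> \<zero> \<and> eval f x \<noteq> \<zero>)"

text \<open>The frame of all six estimates: \<open>T d B\<close> is the d-fold set that grows and
  \<open>Y B\<close> the set in the denominator. The particular graph enters through
  \<open>dich\<close>, with edges from \<open>T d B\<close> and \<open>B\<close> to
  \<open>T (Suc d) B\<close> and \<open>Y B\<close>.\<close>

lemma growth_generic:
  fixes T :: "nat \<Rightarrow> 'a set \<Rightarrow> 'a set" and Y :: "'a set \<Rightarrow> 'a set"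
  assumes f: "f \<in> carrier (poly_ring R)" "f \<noteq> []" "length f - 1 = k" and A: "A \<subseteq> carrier R" and d: "d \<ge> 1"
    and TR: "\<And>B d. B \<subseteq> carrier R \<Longrightarrow> T d B \<subseteq> carrier R"
    and Tne: "\<And>B d. B \<subseteq> carrier R \<Longrightarrow> B \<noteq> {} \<Longrightarrow> T d B \<noteq> {}"
    and Tmono: "\<And>B C d. B \<subseteq> C \<Longrightarrow> T d B \<subseteq> T d C"
    and YR: "\<And>B. B \<subseteq> carrier R \<Longrightarrow> Y B \<subseteq> carrier R" and Yne: "\<And>B. B \<noteq> {} \<Longrightarrow> Y B \<noteq> {}"
    and Ymono: "\<And>B C. B \<subseteq> C \<Longrightarrow> Y B \<subseteq> Y C"
    and T1: "\<And>B. good f B \<Longrightarrow> card B \<le> (k + 1) * card (T 1 B)"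
    and Tcard: "\<And>B d. good f B \<Longrightarrow> card (T d B) \<le> card (T (Suc d) B)"
    and dich: "\<And>B d. good f B \<Longrightarrow> FS.dichotomy k (card (h ` B)) (card (h ` T (Suc d) B) * card (h ` Y B))
      (card (h ` T d B) * card (h ` B))"
  shows "real (card (T d A)) \<ge> growth_const k d * growth_bound (card (carrier R)) d (card A) (card (Y A))"
proof (rule growth_wrap[OF f A d])
  have fin: "finite B" if "B \<subseteq> carrier R" for B using that finite_carrier finite_subset by blast
  show "card (T d A) \<ge> 1" if "A \<noteq> {}"
    using TR[OF A] Tne[OF A that] fin by (metis One_nat_def Suc_leI card_gt_0_iff)
  fix B assume B: "B \<subseteq> A" "B \<noteq> {}" "card A \<le> 2 * card B" "\<And>x. x \<in> B \<Longrightarrow> x \<noteq> \<zero> \<and> eval f x \<noteq> \<zero>"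
  then have BR: "B \<subseteq> carrier R" using A by blast
  then have good: "good f B" using B by (simp add: good_def)
  show "growth_const k d * growth_bound FS.q d (card A) (card (Y A)) \<le> card (T d A)"
  proof (rule FS.growth_conclusion[where n = "\<lambda>d. card (T d B)" and S = "card (Y B)", OF B(3) _ _ _ d])
    show "card B > 0" using B(2) fin[OF BR] by (simp add: card_gt_0_iff)
    show "card (Y B) > 0" using Yne[OF B(2)] fin[OF YR[OF BR]] by (simp add: card_gt_0_iff)
    show "card (Y B) \<le> card (Y A)" by (intro card_mono fin YR A Ymono B)
    show "card (T d B) \<le> card (T d A)" by (intro card_mono fin TR A Tmono B)
    show "card B \<le> (k + 1) * card (T 1 B)" by (rule T1[OF good])
    show "card (T d B) \<le> card (T (Suc d) B)" for d by (rule Tcard[OF good])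
    show "FS.dichotomy k (card B) (card (T (Suc d) B) * card (Y B)) (card (T d B) * card B)" for d
      using dich[OF good, of d] BR TR[OF BR] YR[OF BR] by (simp only: card_image_h)
  qed
qed

section \<open>The six growth estimates for an embedded field\<close>

context
  fixes f :: "'a list" and k d :: nat and A :: "'a set"
  assumes f: "f \<in> carrier (poly_ring R)" "length f - 1 = k" "k \<ge> 1" and A: "A \<subseteq> carrier R" and d: "d \<ge> 1"
begin

lemma f_ne: "f \<noteq> []" using f by auto

lemma fs: "set f \<subseteq> carrier R" using f(1) by (auto simp: univ_poly_carrier[symmetric] polynomial_def)

lemma deg_f: "degree (hpoly f) = k" using degree_hpoly(1)[OF f(1) f_ne] f(2) by simp

lemma goodD:
  assumes "good f B"
  shows "B \<subseteq> carrier R" "B \<noteq> {}" "\<zero> \<notin> B" "eval_image f B \<subseteq> carrier R" "eval_image f B \<noteq> {}" "\<zero> \<notin> eval_image f B"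
  using assms eval_image_subset[OF fs] by (auto simp: good_def eval_image_def)

lemma h_image_nonzero: "C \<subseteq> carrier R - {\<zero>} \<Longrightarrow> h ` C \<subseteq> h ` carrier R - {0}"
  by (auto simp: subset_iff h_eq_0_iff)

lemma good_h_image: assumes "good f B" shows "h ` B \<subseteq> {t \<in> h ` carrier R - {0}. poly (hpoly f) t \<noteq> 0}"
proof
  fix t assume "t \<in> h ` B"
  then obtain x where x: "x \<in> B" "t = h x" by blast
  then have "x \<in> carrier R" "x \<noteq> \<zero>" "eval f x \<noteq> \<zero>" using assms by (auto simp: good_def)
  then show "t \<in> {t \<in> h ` carrier R - {0}. poly (hpoly f) t \<noteq> 0}"
    using x eval_in_carrier[OF fs] by (simp add: poly_hpoly[OF fs] h_eq_0_iff)
qed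

lemma poly_mem: "t \<in> B \<Longrightarrow> B \<subseteq> carrier R \<Longrightarrow> poly (hpoly f) (h t) = h (eval f t) \<and> eval f t \<in> eval_image f B"
  using poly_hpoly[OF fs] by (auto simp: eval_image_def)

lemma set_add_mono: "B \<subseteq> C \<Longrightarrow> B' \<subseteq> C' \<Longrightarrow> B <+>\<^bsub>R\<^esub> B' \<subseteq> C <+>\<^bsub>R\<^esub> C'"
  unfolding set_add_eq by blast

lemma set_mult_mono: "B \<subseteq> C \<Longrightarrow> B' \<subseteq> C' \<Longrightarrow> B <#>\<^bsub>R\<^esub> B' \<subseteq> C <#>\<^bsub>R\<^esub> C'"
  unfolding set_mult_eq by blast

lemma set_add_ne: "B \<noteq> {} \<Longrightarrow> C \<noteq> {} \<Longrightarrow> B <+>\<^bsub>R\<^esub> C \<noteq> {}" unfolding set_add_eq by blast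

lemma set_mult_ne: "B \<noteq> {} \<Longrightarrow> C \<noteq> {} \<Longrightarrow> B <#>\<^bsub>R\<^esub> C \<noteq> {}" unfolding set_mult_eq by blast

lemma eval_image_mono: "B \<subseteq> C \<Longrightarrow> eval_image f B \<subseteq> eval_image f C" by (auto simp: eval_image_def)

lemma eval_image_ne: "B \<noteq> {} \<Longrightarrow> eval_image f B \<noteq> {}" by (simp add: eval_image_def)

lemma card_le_mult_eval_image: "good f B \<Longrightarrow> card B \<le> (k + 1) * card (eval_image f B)"
  using card_le_eval_image[OF f] goodD(1) by (metis le_add1 le_trans mult_le_mono1)

lemmas bound_rules = set_add_subset set_mult_subset set_add_mono set_mult_mono set_add_ne set_mult_ne
  eval_image_mono eval_image_ne eval_image_subset[OF fs] nfold_mono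

text \<open>The edges (v1, v2) \<mapsto> (v1 + t, v2 + f(t)) lead from dB \<times> B to (d + 1)B
  \<times> (f(B) + B).\<close>

lemma growth_sum_A:
  assumes "k \<ge> 2" "k < FS.p"
  shows "real (card (nfold_sum R d A)) \<ge>
    growth_const k d * growth_bound (card (carrier R)) d (card A) (card (eval_image f A <+>\<^bsub>R\<^esub> A))"
proof (rule growth_generic[where T = "\<lambda>d. nfold_sum R d" and Y = "\<lambda>B. eval_image f B <+>\<^bsub>R\<^esub> B", OF f(1) f_ne f(2) A d])
  fix B d assume g: "good f B"
  note B = goodD[OF g] and T = nfold_sum_props[OF goodD(1)[OF g]]
  show "card B \<le> (k + 1) * card (nfold_sum R 1 B)" using T(3) by simp
  show "card (nfold_sum R d B) \<le> card (nfold_sum R (Suc d) B)" by (rule T(4)[OF B(2)])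
  show "FS.dichotomy k (card (h ` B)) (card (h ` nfold_sum R (Suc d) B) * card (h ` (eval_image f B <+>\<^bsub>R\<^esub> B)))
      (card (h ` nfold_sum R d B) * card (h ` B))"
  proof (rule FS.dichotomy_add_add[OF over_F_hpoly[OF fs] deg_f assms])
    show "v + t \<in> h ` nfold_sum R (Suc d) B" if "v \<in> h ` nfold_sum R d B" "t \<in> h ` B" for v t
      using that h_add_mem[OF _ _ T(1) B(1)] by auto
    show "v + poly (hpoly f) t \<in> h ` (eval_image f B <+>\<^bsub>R\<^esub> B)" if "v \<in> h ` B" "t \<in> h ` B" for v t
      using that poly_mem[OF _ B(1)] h_add_mem[OF _ _ B(1,4)] by auto
  qed (use T(1,2) B in \<open>simp_all add: bound_rules image_mono\<close>)
qed (simp_all add: bound_rules nfold_sum_props)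

text \<open>Here the second coordinate grows: the edges lead from B \<times> df(B) to (B + B)
  \<times> (d + 1)f(B). Commutativity at the end restores the order of the factors.\<close>

lemma growth_sum_fA:
  assumes "k \<ge> 2" "k < FS.p"
  shows "real (card (nfold_sum R d (eval_image f A))) \<ge>
    growth_const k d * growth_bound (card (carrier R)) d (card A) (card (A <+>\<^bsub>R\<^esub> A))"
proof (rule growth_generic[where T = "\<lambda>d B. nfold_sum R d (eval_image f B)" and Y = "\<lambda>B. B <+>\<^bsub>R\<^esub> B", OF f(1) f_ne f(2) A d])
  fix B d assume g: "good f B"
  note B = goodD[OF g] and T = nfold_sum_props[OF goodD(4)[OF g]]
  show "card B \<le> (k + 1) * card (nfold_sum R 1 (eval_image f B))"
    using card_le_mult_eval_image[OF g] T(3) by simp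
  show "card (nfold_sum R d (eval_image f B)) \<le> card (nfold_sum R (Suc d) (eval_image f B))" by (rule T(4)[OF B(5)])
  have "FS.dichotomy k (card (h ` B)) (card (h ` (B <+>\<^bsub>R\<^esub> B)) * card (h ` nfold_sum R (Suc d) (eval_image f B)))
      (card (h ` B) * card (h ` nfold_sum R d (eval_image f B)))"
  proof (rule FS.dichotomy_add_add[OF over_F_hpoly[OF fs] deg_f assms])
    show "v + t \<in> h ` (B <+>\<^bsub>R\<^esub> B)" if "v \<in> h ` B" "t \<in> h ` B" for v t
      using that h_add_mem[OF _ _ B(1,1)] by auto
    show "v + poly (hpoly f) t \<in> h ` nfold_sum R (Suc d) (eval_image f B)"
      if "v \<in> h ` nfold_sum R d (eval_image f B)" "t \<in> h ` B" for v t
      using that poly_mem[OF _ B(1)] h_add_mem[OF _ _ T(1) B(4)] by auto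
  qed (use T(1,2) B in \<open>simp_all add: bound_rules image_mono\<close>)
  then show "FS.dichotomy k (card (h ` B)) (card (h ` nfold_sum R (Suc d) (eval_image f B)) * card (h ` (B <+>\<^bsub>R\<^esub> B)))
      (card (h ` nfold_sum R d (eval_image f B)) * card (h ` B))" by (simp only: mult.commute)
qed (simp_all add: bound_rules nfold_sum_props)

lemma growth_prod_A_sum:
  assumes "k < FS.p"
  shows "real (card (nfold_prod R d A)) \<ge>
    growth_const k d * growth_bound (card (carrier R)) d (card A) (card (eval_image f A <+>\<^bsub>R\<^esub> A))"
proof (rule growth_generic[where T = "\<lambda>d. nfold_prod R d" and Y = "\<lambda>B. eval_image f B <+>\<^bsub>R\<^esub> B", OF f(1) f_ne f(2) A d])
  fix B d assume g: "good f B"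
  note B = goodD[OF g] and T = nfold_prod_props[OF goodD(1)[OF g]]
  show "card B \<le> (k + 1) * card (nfold_prod R 1 B)" using T(3) by simp
  show "card (nfold_prod R d B) \<le> card (nfold_prod R (Suc d) B)" by (rule T(5)[OF B(2,3)])
  show "FS.dichotomy k (card (h ` B)) (card (h ` nfold_prod R (Suc d) B) * card (h ` (eval_image f B <+>\<^bsub>R\<^esub> B)))
      (card (h ` nfold_prod R d B) * card (h ` B))"
  proof (rule FS.dichotomy_mult_add[OF over_F_hpoly[OF fs] deg_f f(3) assms])
    show "v * t \<in> h ` nfold_prod R (Suc d) B" if "v \<in> h ` nfold_prod R d B" "t \<in> h ` B" for v t
      using that h_mult_mem[OF _ _ T(1) B(1)] by auto
    show "v + poly (hpoly f) t \<in> h ` (eval_image f B <+>\<^bsub>R\<^esub> B)" if "v \<in> h ` B" "t \<in> h ` B" for v t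
      using that poly_mem[OF _ B(1)] h_add_mem[OF _ _ B(1,4)] by auto
    show "h ` nfold_prod R (Suc d) B \<subseteq> h ` carrier R - {0}" "h ` nfold_prod R d B \<subseteq> h ` carrier R - {0}"
      by (intro h_image_nonzero T(4)[OF B(3)])+
    show "h ` B \<subseteq> h ` carrier R - {0}" using good_h_image[OF g] by blast
  qed (use T(1,2) B in \<open>simp_all add: bound_rules image_mono\<close>)
qed (simp_all add: bound_rules nfold_prod_props)

lemma growth_sum_fA_prod:
  assumes "k < FS.p"
  shows "real (card (nfold_sum R d (eval_image f A))) \<ge>
    growth_const k d * growth_bound (card (carrier R)) d (card A) (card (A <#>\<^bsub>R\<^esub> A))"
proof (rule growth_generic[where T = "\<lambda>d B. nfold_sum R d (eval_image f B)" and Y = "\<lambda>B. B <#>\<^bsub>R\<^esub> B", OF f(1) f_ne f(2) A d])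
  fix B d assume g: "good f B"
  note B = goodD[OF g] and T = nfold_sum_props[OF goodD(4)[OF g]]
  show "card B \<le> (k + 1) * card (nfold_sum R 1 (eval_image f B))"
    using card_le_mult_eval_image[OF g] T(3) by simp
  show "card (nfold_sum R d (eval_image f B)) \<le> card (nfold_sum R (Suc d) (eval_image f B))" by (rule T(4)[OF B(5)])
  have "FS.dichotomy k (card (h ` B)) (card (h ` (B <#>\<^bsub>R\<^esub> B)) * card (h ` nfold_sum R (Suc d) (eval_image f B)))
      (card (h ` B) * card (h ` nfold_sum R d (eval_image f B)))"
  proof (rule FS.dichotomy_mult_add[OF over_F_hpoly[OF fs] deg_f f(3) assms])
    show "v * t \<in> h ` (B <#>\<^bsub>R\<^esub> B)" if "v \<in> h ` B" "t \<in> h ` B" for v t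
      using that h_mult_mem[OF _ _ B(1,1)] by auto
    show "v + poly (hpoly f) t \<in> h ` nfold_sum R (Suc d) (eval_image f B)"
      if "v \<in> h ` nfold_sum R d (eval_image f B)" "t \<in> h ` B" for v t
      using that poly_mem[OF _ B(1)] h_add_mem[OF _ _ T(1) B(4)] by auto
    show "h ` (B <#>\<^bsub>R\<^esub> B) \<subseteq> h ` carrier R - {0}" using B(1,3) by (intro h_image_nonzero set_mult_nonzero) auto
    show "h ` B \<subseteq> h ` carrier R - {0}" "h ` B \<subseteq> h ` carrier R - {0}" using good_h_image[OF g] by blast+
  qed (use T(1,2) B in \<open>simp_all add: bound_rules image_mono\<close>)
  then show "FS.dichotomy k (card (h ` B)) (card (h ` nfold_sum R (Suc d) (eval_image f B)) * card (h ` (B <#>\<^bsub>R\<^esub> B)))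
      (card (h ` nfold_sum R d (eval_image f B)) * card (h ` B))" by (simp only: mult.commute)
qed (simp_all add: bound_rules nfold_sum_props)

text \<open>The root \<open>r\<close> lies in the algebraically closed type and need not be in the
  image of the field.\<close>

lemma growth_prod_A:
  assumes root: "hpoly f = [:-r, 1:] * g" "poly g r \<noteq> 0" "r \<noteq> 0"
  shows "real (card (nfold_prod R d A)) \<ge>
    growth_const k d * growth_bound (card (carrier R)) d (card A) (card (eval_image f A <#>\<^bsub>R\<^esub> A))"
proof (rule growth_generic[where T = "\<lambda>d. nfold_prod R d" and Y = "\<lambda>B. eval_image f B <#>\<^bsub>R\<^esub> B", OF f(1) f_ne f(2) A d])
  fix B d assume g: "good f B"
  note B = goodD[OF g] and T = nfold_prod_props[OF goodD(1)[OF g]]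
  show "card B \<le> (k + 1) * card (nfold_prod R 1 B)" using T(3) by simp
  show "card (nfold_prod R d B) \<le> card (nfold_prod R (Suc d) B)" by (rule T(5)[OF B(2,3)])
  show "FS.dichotomy k (card (h ` B)) (card (h ` nfold_prod R (Suc d) B) * card (h ` (eval_image f B <#>\<^bsub>R\<^esub> B)))
      (card (h ` nfold_prod R d B) * card (h ` B))"
  proof (rule FS.dichotomy_mult_mult[OF over_F_hpoly[OF fs] deg_f root])
    show "v * t \<in> h ` nfold_prod R (Suc d) B" if "v \<in> h ` nfold_prod R d B" "t \<in> h ` B" for v t
      using that h_mult_mem[OF _ _ T(1) B(1)] by auto
    show "v * poly (hpoly f) t \<in> h ` (eval_image f B <#>\<^bsub>R\<^esub> B)" if "v \<in> h ` B" "t \<in> h ` B" for v t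
      using that poly_mem[OF _ B(1)] h_mult_mem[OF _ _ B(1,4)] by auto
    show "h ` nfold_prod R (Suc d) B \<subseteq> h ` carrier R - {0}" "h ` nfold_prod R d B \<subseteq> h ` carrier R - {0}"
      by (intro h_image_nonzero T(4)[OF B(3)])+
    show "h ` (eval_image f B <#>\<^bsub>R\<^esub> B) \<subseteq> h ` carrier R - {0}"
      using B by (intro h_image_nonzero set_mult_nonzero) auto
    show "h ` B \<subseteq> h ` carrier R - {0}" using good_h_image[OF g] by blast
    show "h ` B \<subseteq> {t \<in> h ` carrier R - {0}. poly (hpoly f) t \<noteq> 0}" by (rule good_h_image[OF g])
  qed (use T(1,2) B in \<open>simp_all add: bound_rules image_mono\<close>)
qed (simp_all add: bound_rules nfold_prod_props)

lemma growth_prod_fA: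
  assumes root: "hpoly f = [:-r, 1:] * g" "poly g r \<noteq> 0" "r \<noteq> 0"
  shows "real (card (nfold_prod R d (eval_image f A))) \<ge>
    growth_const k d * growth_bound (card (carrier R)) d (card A) (card (A <#>\<^bsub>R\<^esub> A))"
proof (rule growth_generic[where T = "\<lambda>d B. nfold_prod R d (eval_image f B)" and Y = "\<lambda>B. B <#>\<^bsub>R\<^esub> B", OF f(1) f_ne f(2) A d])
  fix B d assume g: "good f B"
  note B = goodD[OF g] and T = nfold_prod_props[OF goodD(4)[OF g]]
  show "card B \<le> (k + 1) * card (nfold_prod R 1 (eval_image f B))"
    using card_le_mult_eval_image[OF g] T(3) by simp
  show "card (nfold_prod R d (eval_image f B)) \<le> card (nfold_prod R (Suc d) (eval_image f B))"
    by (rule T(5)[OF B(5,6)])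
  have "FS.dichotomy k (card (h ` B)) (card (h ` (B <#>\<^bsub>R\<^esub> B)) * card (h ` nfold_prod R (Suc d) (eval_image f B)))
      (card (h ` B) * card (h ` nfold_prod R d (eval_image f B)))"
  proof (rule FS.dichotomy_mult_mult[OF over_F_hpoly[OF fs] deg_f root])
    show "v * t \<in> h ` (B <#>\<^bsub>R\<^esub> B)" if "v \<in> h ` B" "t \<in> h ` B" for v t
      using that h_mult_mem[OF _ _ B(1,1)] by auto
    show "v * poly (hpoly f) t \<in> h ` nfold_prod R (Suc d) (eval_image f B)"
      if "v \<in> h ` nfold_prod R d (eval_image f B)" "t \<in> h ` B" for v t
      using that poly_mem[OF _ B(1)] h_mult_mem[OF _ _ T(1) B(4)] by auto
    show "h ` (B <#>\<^bsub>R\<^esub> B) \<subseteq> h ` carrier R - {0}" using B(1,3) by (intro h_image_nonzero set_mult_nonzero) auto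
    show "h ` nfold_prod R (Suc d) (eval_image f B) \<subseteq> h ` carrier R - {0}"
      "h ` nfold_prod R d (eval_image f B) \<subseteq> h ` carrier R - {0}"
      by (intro h_image_nonzero T(4)[OF B(6)])+
    show "h ` B \<subseteq> h ` carrier R - {0}" using good_h_image[OF g] by blast
    show "h ` B \<subseteq> {t \<in> h ` carrier R - {0}. poly (hpoly f) t \<noteq> 0}" by (rule good_h_image[OF g])
  qed (use T(1,2) B in \<open>simp_all add: bound_rules image_mono\<close>)
  then show "FS.dichotomy k (card (h ` B)) (card (h ` nfold_prod R (Suc d) (eval_image f B)) * card (h ` (B <#>\<^bsub>R\<^esub> B)))
      (card (h ` nfold_prod R d (eval_image f B)) * card (h ` B))" by (simp only: mult.commute)
qed (simp_all add: bound_rules nfold_prod_props)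

end

end

section \<open>From carrier sets to types\<close>

definition alg_closed_ring :: "('a, 'b) ring_scheme \<Rightarrow> bool" where
  "alg_closed_ring M \<longleftrightarrow> field M \<and> (\<forall>P. set P \<subseteq> carrier M \<and> length P > 1 \<and> hd P \<noteq> \<zero>\<^bsub>M\<^esub> \<longrightarrow>
    (\<exists>x\<in>carrier M. ring.eval M P x = \<zero>\<^bsub>M\<^esub>))"

text \<open>The last clause expresses a nonzero simple root as f = (X - r) u with u(r) \<noteq> 0,
  through values only. In this form it passes along ring isomorphisms without reference to algebraic
  multiplicities or to a particular closure.\<close>

definition embeds :: "('a, 'b) ring_scheme \<Rightarrow> ('c, 'd) ring_scheme \<Rightarrow> ('a \<Rightarrow> 'c) \<Rightarrow> bool" where
  "embeds R M h \<longleftrightarrow> h \<in> ring_hom R M \<and> inj_on h (carrier R) \<and>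
    (\<forall>f\<in>carrier (poly_ring R). has_nonzero_simple_root R f \<longrightarrow>
      (\<exists>r\<in>carrier M. \<exists>u. set u \<subseteq> carrier M \<and> r \<noteq> \<zero>\<^bsub>M\<^esub> \<and> ring.eval M u r \<noteq> \<zero>\<^bsub>M\<^esub> \<and>
        (\<forall>y\<in>carrier M. ring.eval M (map h f) y = (y \<ominus>\<^bsub>M\<^esub> r) \<otimes>\<^bsub>M\<^esub> ring.eval M u y)))"

lemma alg_closed_ring_embeds_alg_closure:
  fixes R :: "('a, 'b) ring_scheme"
  assumes "field R"
  shows "alg_closed_ring (field.alg_closure R)" and "embeds R (field.alg_closure R) (ring.indexed_const R)"
proof -
  interpret R: field R by fact
  let ?L = "R.alg_closure"
  interpret L: algebraic_closure ?L "R.indexed_const ` carrier R" by (rule R.alg_closureE(1))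
  interpret UP: domain "poly_ring ?L" by (rule L.univ_poly_is_domain[OF L.carrier_is_subring])
  have "\<exists>x\<in>carrier ?L. L.eval P x = \<zero>\<^bsub>?L\<^esub>"
    if P: "set P \<subseteq> carrier ?L" "length P > 1" "hd P \<noteq> \<zero>\<^bsub>?L\<^esub>" for P
  proof -
    have P': "P \<in> carrier (poly_ring ?L)" using P by (auto simp: univ_poly_carrier[symmetric] polynomial_def)
    then have "L.splitted P" by (rule L.roots_over_carrier)
    then have "L.roots P \<noteq> {#}" using P(2) unfolding L.splitted_def by auto
    then obtain x where "x \<in># L.roots P" by blast
    then have "L.is_root P x" using L.roots_mem_iff_is_root[OF P'] by simp
    then show ?thesis by (auto simp: L.is_root_def)
  qed
  then show "alg_closed_ring ?L" using L.field_axioms by (simp add: alg_closed_ring_def)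
  have hom: "R.indexed_const \<in> ring_hom R ?L" by (rule R.alg_closureE(2))
  have inj: "inj_on (R.indexed_const :: 'a \<Rightarrow> ('a list \<times> nat) multiset \<Rightarrow> 'a) (carrier R)" by (rule R.indexed_const_inj_on)
  have "\<exists>r\<in>carrier ?L. \<exists>u. set u \<subseteq> carrier ?L \<and> r \<noteq> \<zero>\<^bsub>?L\<^esub> \<and> L.eval u r \<noteq> \<zero>\<^bsub>?L\<^esub> \<and>
      (\<forall>y\<in>carrier ?L. L.eval (map R.indexed_const f) y = (y \<ominus>\<^bsub>?L\<^esub> r) \<otimes>\<^bsub>?L\<^esub> L.eval u y)"
    if f: "f \<in> carrier (poly_ring R)" and root: "has_nonzero_simple_root R f" for f
  proof -
    let ?g = "map R.indexed_const f"
    obtain r where r: "L.is_root ?g r" "L.alg_mult ?g r = 1" "r \<noteq> \<zero>\<^bsub>?L\<^esub>"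
      using root by (auto simp: has_nonzero_simple_root_def R.\<sigma>_def Let_def)
    have rL: "r \<in> carrier ?L" using r(1) by (simp add: L.is_root_def)
    have "set f \<subseteq> carrier R" "f \<noteq> [] \<Longrightarrow> hd f \<noteq> \<zero>\<^bsub>R\<^esub>"
      using f by (auto simp: univ_poly_carrier[symmetric] polynomial_def)
    moreover have "R.indexed_const (hd f) \<noteq> \<zero>\<^bsub>?L\<^esub>" if "f \<noteq> []"
    proof
      assume eq: "R.indexed_const (hd f) = \<zero>\<^bsub>?L\<^esub>"
      have "hd f \<in> carrier R" using that \<open>set f \<subseteq> carrier R\<close> by auto
      then have "hd f = \<zero>\<^bsub>R\<^esub>"
        using inj_onD[OF inj, of "hd f" "\<zero>\<^bsub>R\<^esub>"] eq ring_hom_zero[OF hom R.ring_axioms L.ring_axioms] by simp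
      then show False using \<open>f \<noteq> [] \<Longrightarrow> hd f \<noteq> \<zero>\<^bsub>R\<^esub>\<close> that by simp
    qed
    ultimately have g: "?g \<in> carrier (poly_ring ?L)"
      using ring_hom_closed[OF hom] by (auto simp: univ_poly_carrier[symmetric] polynomial_def hd_map subset_iff)
    let ?l = "[\<one>\<^bsub>?L\<^esub>, \<ominus>\<^bsub>?L\<^esub> r]"
    have l: "?l \<in> carrier (poly_ring ?L)"
      using rL by (auto simp: univ_poly_carrier[symmetric] polynomial_def)
    obtain u where u: "u \<in> carrier (poly_ring ?L)" "?g = ?l \<otimes>\<^bsub>poly_ring ?L\<^esub> u"
      using L.is_root_imp_pdivides[OF g r(1)] unfolding pdivides_def by auto
    have uL: "set u \<subseteq> carrier ?L" using u(1) by (auto simp: univ_poly_carrier[symmetric] polynomial_def)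
    \<comment> \<open>A zero of the cofactor at r would make (X - r)^2 divide the polynomial,
      contrary to multiplicity 1.\<close>
    have "L.eval u r \<noteq> \<zero>\<^bsub>?L\<^esub>"
    proof
      assume "L.eval u r = \<zero>\<^bsub>?L\<^esub>"
      moreover have "u \<noteq> []"
      proof
        assume "u = []"
        then have "?g = \<zero>\<^bsub>poly_ring ?L\<^esub>" using u l UP.r_null by (simp add: univ_poly_zero)
        then show False using r(1) by (simp add: L.is_root_def univ_poly_zero)
      qed
      ultimately have "L.is_root u r" using rL by (simp add: L.is_root_def)
      then obtain v where v: "v \<in> carrier (poly_ring ?L)" "u = ?l \<otimes>\<^bsub>poly_ring ?L\<^esub> v"
        using L.is_root_imp_pdivides[OF u(1)] unfolding pdivides_def by auto
      have "?g = (?l [^]\<^bsub>poly_ring ?L\<^esub> (2::nat)) \<otimes>\<^bsub>poly_ring ?L\<^esub> v"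
        unfolding u(2) v(2) using l v(1) by (simp add: numeral_2_eq_2 UP.m_assoc)
      then have "(?l [^]\<^bsub>poly_ring ?L\<^esub> (2::nat)) pdivides\<^bsub>?L\<^esub> ?g" using v(1) unfolding pdivides_def by auto
      then have "2 \<le> L.alg_mult ?g r"
        using L.alg_multE(2)[OF rL g] r(1) by (auto simp: L.is_root_def)
      then show False using r(2) by simp
    qed
    moreover have "L.eval ?g y = (y \<ominus>\<^bsub>?L\<^esub> r) \<otimes>\<^bsub>?L\<^esub> L.eval u y" if "y \<in> carrier ?L" for y
      unfolding u(2) univ_poly_mult
      using L.eval_poly_mult[OF _ uL that, of ?l] rL that by (simp add: a_minus_def)
    ultimately show ?thesis using rL uL r(3) by blast
  qed
  then show "embeds R ?L R.indexed_const" using hom inj by (simp add: embeds_def)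
qed

text \<open>Together with \<open>embeds_image_ring\<close> this carries an algebraic closure along
  an injection into the type from which \<open>ambient\<close> is chosen.\<close>

lemma alg_closed_ring_image_ring:
  assumes "alg_closed_ring M" "inj_on \<phi> (carrier M)" shows "alg_closed_ring (image_ring \<phi> M)"
proof -
  interpret M: field M using assms(1) by (simp add: alg_closed_ring_def)
  let ?N = "image_ring \<phi> M"
  interpret N: field ?N by (rule M.inj_imp_image_ring_is_field[OF assms(2)])
  interpret H: ring_hom_ring M ?N \<phi>
    using inj_imp_image_ring_iso[OF assms(2)] M.ring_axioms N.ring_axioms
    by (intro ring_hom_ringI2) (auto simp: ring_iso_def)
  have "\<exists>x\<in>carrier ?N. N.eval P x = \<zero>\<^bsub>?N\<^esub>"
    if P: "set P \<subseteq> carrier ?N" "length P > 1" "hd P \<noteq> \<zero>\<^bsub>?N\<^esub>" for P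
  proof -
    define P0 where "P0 = map (inv_into (carrier M) \<phi>) P"
    have map: "map \<phi> P0 = P"
      using P(1) unfolding P0_def map_map by (intro map_idI) (auto simp: image_ring_carrier f_inv_into_f)
    have P0: "set P0 \<subseteq> carrier M" using P(1) by (auto simp: P0_def image_ring_carrier inv_into_into)
    have "P0 \<noteq> []" using P(2) by (auto simp: P0_def)
    then have "hd P0 \<noteq> \<zero>\<^bsub>M\<^esub>" using P(3) by (auto simp: map[symmetric] hd_map H.hom_zero)
    then obtain x where x: "x \<in> carrier M" "M.eval P0 x = \<zero>\<^bsub>M\<^esub>"
      using assms(1) P0 P(2) length_map[of "inv_into (carrier M) \<phi>" P] unfolding alg_closed_ring_def P0_def[symmetric] by metis
    then show ?thesis using H.eval_hom'[OF x(1) P0] by (intro bexI[of _ "\<phi> x"]) (auto simp: map)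
  qed
  then show ?thesis using N.field_axioms by (simp add: alg_closed_ring_def)
qed

lemma embeds_image_ring:
  assumes "alg_closed_ring M" "inj_on \<phi> (carrier M)" "embeds R M h" "ring R" shows "embeds R (image_ring \<phi> M) (\<phi> \<circ> h)"
proof -
  interpret R: ring R by fact
  interpret M: field M using assms(1) by (simp add: alg_closed_ring_def)
  let ?N = "image_ring \<phi> M"
  interpret N: field ?N by (rule M.inj_imp_image_ring_is_field[OF assms(2)])
  have \<phi>: "\<phi> \<in> ring_hom M ?N" using inj_imp_image_ring_iso[OF assms(2)] by (auto simp: ring_iso_def)
  interpret H: ring_hom_ring M ?N \<phi>
    using \<phi> M.ring_axioms N.ring_axioms by (intro ring_hom_ringI2)
  have h: "h \<in> ring_hom R M" "inj_on h (carrier R)" using assms(3) by (auto simp: embeds_def)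
  have hR: "h ` carrier R \<subseteq> carrier M" using ring_hom_closed[OF h(1)] by blast
  have "\<exists>r\<in>carrier ?N. \<exists>u. set u \<subseteq> carrier ?N \<and> r \<noteq> \<zero>\<^bsub>?N\<^esub> \<and> N.eval u r \<noteq> \<zero>\<^bsub>?N\<^esub> \<and>
        (\<forall>y\<in>carrier ?N. N.eval (map (\<phi> \<circ> h) f) y = (y \<ominus>\<^bsub>?N\<^esub> r) \<otimes>\<^bsub>?N\<^esub> N.eval u y)"
    if f: "f \<in> carrier (poly_ring R)" "has_nonzero_simple_root R f" for f
  proof -
    obtain r u where ru: "r \<in> carrier M" "set u \<subseteq> carrier M" "r \<noteq> \<zero>\<^bsub>M\<^esub>" "M.eval u r \<noteq> \<zero>\<^bsub>M\<^esub>"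
      "\<And>y. y \<in> carrier M \<Longrightarrow> M.eval (map h f) y = (y \<ominus>\<^bsub>M\<^esub> r) \<otimes>\<^bsub>M\<^esub> M.eval u y"
      using assms(3) f unfolding embeds_def by blast
    have fs: "set (map h f) \<subseteq> carrier M"
      using f(1) hR by (auto simp: univ_poly_carrier[symmetric] polynomial_def)
    have nz: "\<phi> x \<noteq> \<zero>\<^bsub>?N\<^esub>" if "x \<in> carrier M" "x \<noteq> \<zero>\<^bsub>M\<^esub>" for x
      using inj_onD[OF assms(2), of x "\<zero>\<^bsub>M\<^esub>"] that by auto
    have "N.eval (map (\<phi> \<circ> h) f) y = (y \<ominus>\<^bsub>?N\<^esub> \<phi> r) \<otimes>\<^bsub>?N\<^esub> N.eval (map \<phi> u) y" if "y \<in> carrier ?N" for y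
    proof -
      obtain x where x: "x \<in> carrier M" "y = \<phi> x" using \<open>y \<in> carrier ?N\<close> by (auto simp: image_ring_carrier)
      have "N.eval (map (\<phi> \<circ> h) f) y = \<phi> (M.eval (map h f) x)"
        using H.eval_hom'[OF x(1) fs] by (simp add: x(2))
      also have "\<dots> = (y \<ominus>\<^bsub>?N\<^esub> \<phi> r) \<otimes>\<^bsub>?N\<^esub> N.eval (map \<phi> u) y"
        using ru(1,2) x by (simp add: ru(5) M.eval_in_carrier H.eval_hom' a_minus_def)
      finally show ?thesis .
    qed
    moreover have "N.eval (map \<phi> u) (\<phi> r) \<noteq> \<zero>\<^bsub>?N\<^esub>"
      using nz[OF M.eval_in_carrier[OF ru(2,1)] ru(4)] H.eval_hom'[OF ru(1,2)] by simp
    ultimately show ?thesis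
      using ru(2) nz[OF ru(1,3)] H.hom_closed[OF ru(1)]
      by (intro bexI[of _ "\<phi> r"] exI[of _ "map \<phi> u"]) auto
  qed
  moreover have "\<phi> \<circ> h \<in> ring_hom R ?N" by (rule ring_hom_trans[OF h(1) \<phi>])
  moreover have "inj_on (\<phi> \<circ> h) (carrier R)" by (rule comp_inj_on[OF h(2) inj_on_subset[OF assms(2) hR]])
  ultimately show ?thesis by (simp add: embeds_def)
qed

lemma alg_closed_ring_complex: "alg_closed_ring (\<lparr>carrier = UNIV, monoid.mult = (*), one = 1, ring.zero = 0, add = (+)\<rparr> :: complex ring)"
  (is "alg_closed_ring ?C")
proof -
  have "\<exists>y. x + y = 0" "x \<noteq> 0 \<Longrightarrow> \<exists>y. x * y = 1" for x :: complex
    by (auto intro: exI[of _ "- x"] exI[of _ "inverse x"])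
  then interpret C: field ?C by unfold_locales (auto simp: algebra_simps Units_def)
  have "\<exists>x. C.eval P x = 0" if P: "length P > 1" "hd P \<noteq> 0" for P
  proof -
    have eval: "poly (Poly (rev P)) x = C.eval P x" for x
      using C.poly_eval_hom[of "\<lambda>x. x" P x] by simp
    have "coeff (Poly (rev P)) (length P - 1) = hd P"
      using P(1) by (cases P) (auto simp: coeff_Poly_eq nth_default_def nth_append)
    then have "degree (Poly (rev P)) \<ge> length P - 1" using P(2) by (intro le_degree) simp
    then show ?thesis using alg_closed_imp_poly_has_root[of "Poly (rev P)"] P(1) eval by auto
  qed
  then show ?thesis using C.field_axioms by (simp add: alg_closed_ring_def)
qed

text \<open>The assertion of the theorem with an explicit constant, made a predicate of the field so
  that counterexamples can be spoken of.\<close>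

definition growth_holds :: "('a, 'b) ring_scheme \<Rightarrow> nat \<Rightarrow> 'a set \<Rightarrow> 'a list \<Rightarrow> bool" where
  "growth_holds R d A f \<longleftrightarrow>
    (let k = length f - 1; c = growth_const k d; q = card (carrier R); p = characteristic R; fA = ring.eval R f ` A in
      (1 < k \<and> k < p \<longrightarrow>
        real (card (nfold_sum R d A)) \<ge> c * growth_bound q d (card A) (card (fA <+>\<^bsub>R\<^esub> A)) \<and>
        real (card (nfold_sum R d fA)) \<ge> c * growth_bound q d (card A) (card (A <+>\<^bsub>R\<^esub> A))) \<and>
      (1 \<le> k \<and> k < p \<longrightarrow>
        real (card (nfold_prod R d A)) \<ge> c * growth_bound q d (card A) (card (fA <+>\<^bsub>R\<^esub> A)) \<and>
        real (card (nfold_sum R d fA)) \<ge> c * growth_bound q d (card A) (card (A <#>\<^bsub>R\<^esub> A))) \<and>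
      (has_nonzero_simple_root R f \<longrightarrow>
        real (card (nfold_prod R d A)) \<ge> c * growth_bound q d (card A) (card (fA <#>\<^bsub>R\<^esub> A)) \<and>
        real (card (nfold_prod R d fA)) \<ge> c * growth_bound q d (card A) (card (A <#>\<^bsub>R\<^esub> A))))"

lemma (in finite_field_embedding) growth_holds_of_embedding:
  assumes d: "d \<ge> 1" and A: "A \<subseteq> carrier R" and f: "f \<in> carrier (poly_ring R)"
    and root: "has_nonzero_simple_root R f \<Longrightarrow>
      \<exists>r u. r \<noteq> 0 \<and> poly u r \<noteq> 0 \<and> (\<forall>y. poly (hpoly f) y = (y - r) * poly u y)"
  shows "growth_holds R d A f"
proof -
  define k where "k = length f - 1"
  have p: "characteristic R \<le> FS.p" by (rule characteristic_le)
  \<comment> \<open>A constant polynomial with a zero at r is 0. Its cofactor would then vanish at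
    all other points of an infinite field and so be 0, although its value at r is not. Hence all
    three cases of the claim are void.\<close>
  have 1: ?thesis if "\<not> (1 \<le> k)"
  proof -
    have "\<not> has_nonzero_simple_root R f"
    proof
      assume "has_nonzero_simple_root R f"
      then obtain r u where ru: "r \<noteq> 0" "poly u r \<noteq> 0" "\<And>y. poly (hpoly f) y = (y - r) * poly u y"
        using root by blast
      have "degree (hpoly f) = 0"
        using degree_hpoly(1)[OF f] that by (cases "f = []") (auto simp: k_def hpoly_def)
      then obtain c where c: "hpoly f = [:c:]" by (elim degree_eq_zeroE)
      then have "c = 0" using ru(3)[of r] by simp
      then have "(y - r) * poly u y = 0" for y using ru(3)[of y] c by simp
      then have "{y. poly u y \<noteq> 0} \<subseteq> {r}" by auto
      moreover have "u \<noteq> 0" using ru(2) by auto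
      ultimately have "UNIV \<subseteq> insert r {y. poly u y = 0}" "finite {y. poly u y = 0}"
        using poly_roots_finite by auto
      then have "finite (UNIV :: 'k set)" using finite_subset by blast
      then show False using infinite_UNIV_alg_closed by blast
    qed
    then show ?thesis using that by (simp add: growth_holds_def k_def Let_def)
  qed
  have 2: ?thesis if k: "1 \<le> k"
  proof -
    note args = f k_def[symmetric] k A d
    have "real (card (nfold_prod R d A)) \<ge> growth_const k d * growth_bound (card (carrier R)) d (card A) (card (eval_image f A <#>\<^bsub>R\<^esub> A)) \<and>
        real (card (nfold_prod R d (eval_image f A))) \<ge> growth_const k d * growth_bound (card (carrier R)) d (card A) (card (A <#>\<^bsub>R\<^esub> A))"
      if "has_nonzero_simple_root R f"
    proof -
      obtain r u where ru: "r \<noteq> 0" "poly u r \<noteq> 0" "\<And>y. poly (hpoly f) y = (y - r) * poly u y"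
        using root \<open>has_nonzero_simple_root R f\<close> by blast
      have "hpoly f = [:- r, 1:] * u"
        by (rule poly_eqI_alg_closed) (simp add: ru(3) algebra_simps)
      then show ?thesis using growth_prod_A[OF args _ ru(2,1)] growth_prod_fA[OF args _ ru(2,1)] by blast
    qed
    moreover have "k < FS.p" if "k < characteristic R" using that p by simp
    ultimately show ?thesis
      using growth_sum_A[OF args] growth_sum_fA[OF args] growth_prod_A_sum[OF args] growth_sum_fA_prod[OF args]
      unfolding growth_holds_def Let_def k_def[symmetric] eval_image_def by simp
  qed
  show ?thesis using 1 2 by blast
qed

text \<open>
  Fields given by a carrier set have to be turned into fields given by a type. This is possible without
  a local type definition: the type below is built from a field chosen by \<open>SOME\<close> to be a counterexample
  to the theorem, if there is one. The theorem for this type then shows that there is none. The summand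
  \<^typ>\<open>complex\<close> makes the type an algebraically closed field also when there is no counterexample,
  and the factor \<open>'b itself\<close> only serves to mention the type variable \<open>'b\<close>.
\<close>

definition counterexample :: "('a, 'b) ring_scheme \<Rightarrow> bool" where
  "counterexample R \<longleftrightarrow> field R \<and> finite (carrier R) \<and>
    (\<exists>d A f. d \<ge> 1 \<and> A \<subseteq> carrier R \<and> f \<in> carrier (poly_ring R) \<and> \<not> growth_holds R d A f)"

type_synonym ('a, 'b) universe = "(((('a list \<times> nat) multiset \<Rightarrow> 'a) + complex) \<times> 'b itself)"

definition ambient :: "('a, 'b) universe ring" where
  "ambient = (SOME M. alg_closed_ring M \<and> ((\<exists>R :: ('a, 'b) ring_scheme. counterexample R) \<longrightarrow>
    (\<exists>(R :: ('a, 'b) ring_scheme) h. counterexample R \<and> embeds R M h)))"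

lemma ambient:
  "alg_closed_ring (ambient :: ('a, 'b) universe ring)"
  "\<exists>R :: ('a, 'b) ring_scheme. counterexample R \<Longrightarrow>
    \<exists>(R :: ('a, 'b) ring_scheme) h. counterexample R \<and> embeds R (ambient :: ('a, 'b) universe ring) h"
proof -
  have "\<exists>M :: ('a, 'b) universe ring. alg_closed_ring M \<and> ((\<exists>R :: ('a, 'b) ring_scheme. counterexample R) \<longrightarrow>
    (\<exists>(R :: ('a, 'b) ring_scheme) h. counterexample R \<and> embeds R M h))"
  proof (cases "\<exists>R :: ('a, 'b) ring_scheme. counterexample R")
    case True
    then obtain R :: "('a, 'b) ring_scheme" where R: "counterexample R" by blast
    then have "field R" by (simp add: counterexample_def)
    interpret R: field R by fact
    let ?\<phi> = "\<lambda>x. (Inl x, TYPE('b)) :: ('a, 'b) universe"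
    have inj: "inj_on ?\<phi> B" for B by (simp add: inj_on_def)
    note L = alg_closed_ring_embeds_alg_closure[OF \<open>field R\<close>]
    show ?thesis
      using alg_closed_ring_image_ring[OF L(1) inj] embeds_image_ring[OF L(1) inj L(2) R.ring_axioms] R by blast
  next
    case False
    let ?\<phi> = "\<lambda>x. (Inr x, TYPE('b)) :: ('a, 'b) universe"
    have "inj_on ?\<phi> B" for B by (simp add: inj_on_def)
    then show ?thesis using alg_closed_ring_image_ring[OF alg_closed_ring_complex, of ?\<phi>] False by blast
  qed
  from someI_ex[OF this] show
    "alg_closed_ring (ambient :: ('a, 'b) universe ring)"
    "\<exists>R :: ('a, 'b) ring_scheme. counterexample R \<Longrightarrow>
      \<exists>(R :: ('a, 'b) ring_scheme) h. counterexample R \<and> embeds R (ambient :: ('a, 'b) universe ring) h"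
    unfolding ambient_def by blast+
qed

lemma field_ambient: "field (ambient :: ('a, 'b) universe ring)"
  using ambient(1) by (auto simp only: alg_closed_ring_def)

typedef ('a, 'b) ambient_field = "carrier (ambient :: ('a, 'b) universe ring)"
proof -
  interpret field "ambient :: ('a, 'b) universe ring" by (rule field_ambient)
  show "\<exists>x. x \<in> carrier (ambient :: ('a, 'b) universe ring)" using zero_closed by blast
qed

setup_lifting type_definition_ambient_field

instantiation ambient_field :: (type, type) Fields.field
begin

context
  fixes L :: "('a, 'b) universe ring"
  defines "L \<equiv> ambient"
begin

interpretation field L unfolding L_def by (rule field_ambient)

lift_definition zero_ambient_field :: "('a, 'b) ambient_field" is "ring.zero L"
  by (fold L_def) simp

lift_definition one_ambient_field :: "('a, 'b) ambient_field" is "monoid.one L"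
  by (fold L_def) simp

lift_definition plus_ambient_field :: "('a, 'b) ambient_field \<Rightarrow> ('a, 'b) ambient_field \<Rightarrow> ('a, 'b) ambient_field"
  is "ring.add L" by (fold L_def) simp

lift_definition minus_ambient_field :: "('a, 'b) ambient_field \<Rightarrow> ('a, 'b) ambient_field \<Rightarrow> ('a, 'b) ambient_field"
  is "a_minus L" by (fold L_def) simp

lift_definition times_ambient_field :: "('a, 'b) ambient_field \<Rightarrow> ('a, 'b) ambient_field \<Rightarrow> ('a, 'b) ambient_field"
  is "monoid.mult L" by (fold L_def) simp

lift_definition uminus_ambient_field :: "('a, 'b) ambient_field \<Rightarrow> ('a, 'b) ambient_field"
  is "a_inv L" by (fold L_def) simp

lift_definition inverse_ambient_field :: "('a, 'b) ambient_field \<Rightarrow> ('a, 'b) ambient_field"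
  is "\<lambda>x. if x = ring.zero L then ring.zero L else m_inv L x"
  by (fold L_def) (auto simp: field_Units)

lift_definition divide_ambient_field :: "('a, 'b) ambient_field \<Rightarrow> ('a, 'b) ambient_field \<Rightarrow> ('a, 'b) ambient_field"
  is "\<lambda>x y. if y = ring.zero L then ring.zero L else monoid.mult L x (m_inv L y)"
  by (fold L_def) (auto simp: field_Units)

end

instance
proof -
  interpret field "ambient :: ('a, 'b) universe ring" by (rule field_ambient)
  show "OFCLASS(('a, 'b) ambient_field, field_class)"
  proof
    fix a b c :: "('a, 'b) ambient_field"
    show "a * b * c = a * (b * c)" by transfer (rule m_assoc)
    show "a * b = b * a" by transfer (rule m_comm)
    show "1 * a = a" by transfer (rule l_one)
    show "a + b + c = a + (b + c)" by transfer (rule a_assoc)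
    show "a + b = b + a" by transfer (rule a_comm)
    show "0 + a = a" by transfer (rule l_zero)
    show "- a + a = 0" by transfer (rule l_neg)
    show "a - b = a + - b" by transfer (rule a_minus_def)
    show "(a + b) * c = a * c + b * c" by transfer (rule l_distr)
    show "(0 :: ('a, 'b) ambient_field) \<noteq> 1" by transfer (rule zero_not_one)
    show "inverse a * a = 1" if "a \<noteq> 0" using that by transfer (auto simp: field_Units)
    show "a div b = a * inverse b" by transfer auto
    show "inverse (0 :: ('a, 'b) ambient_field) = 0" by transfer simp
  qed
qed

end

lemma Abs_ambient_field_hom:
  defines "L \<equiv> ambient :: ('a, 'b) universe ring" and "h \<equiv> Abs_ambient_field :: _ \<Rightarrow> ('a, 'b) ambient_field"
  shows "h \<zero>\<^bsub>L\<^esub> = 0" "h \<one>\<^bsub>L\<^esub> = 1"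
    "\<lbrakk>x \<in> carrier L; y \<in> carrier L\<rbrakk> \<Longrightarrow> h (x \<oplus>\<^bsub>L\<^esub> y) = h x + h y"
    "\<lbrakk>x \<in> carrier L; y \<in> carrier L\<rbrakk> \<Longrightarrow> h (x \<otimes>\<^bsub>L\<^esub> y) = h x * h y"
    "\<lbrakk>x \<in> carrier L; y \<in> carrier L\<rbrakk> \<Longrightarrow> h (x \<ominus>\<^bsub>L\<^esub> y) = h x - h y"
    "inj_on h (carrier L)" "h ` carrier L = UNIV"
  unfolding L_def h_def
  by (auto simp: zero_ambient_field_def one_ambient_field_def plus_ambient_field.abs_eq times_ambient_field.abs_eq
      minus_ambient_field.abs_eq eq_onp_def inj_on_def Abs_ambient_field_inject Abs_ambient_field_inverse)
     (metis Abs_ambient_field_cases image_eqI)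

instance ambient_field :: (type, type) alg_closed_field
proof
  let ?L = "ambient :: ('a, 'b) universe ring"
  interpret field ?L by (rule field_ambient)
  note h = Abs_ambient_field_hom[where 'a = 'a and 'b = 'b]
  fix P :: "('a, 'b) ambient_field poly" assume P: "Polynomial.lead_coeff P = 1" "degree P > 0"
  define Q where "Q = rev (map Rep_ambient_field (Polynomial.coeffs P))"
  have ne: "coeffs P \<noteq> []" using P by auto
  have "hd Q = Rep_ambient_field 1"
    using ne P(1) by (simp add: Q_def hd_rev last_map last_coeffs_eq_coeff_degree)
  also have "\<dots> = \<one>\<^bsub>?L\<^esub>" by (rule one_ambient_field.rep_eq)
  finally have "hd Q \<noteq> \<zero>\<^bsub>?L\<^esub>" by simp
  moreover have Q: "set Q \<subseteq> carrier ?L" using Rep_ambient_field by (auto simp: Q_def)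
  moreover have "length Q > 1" using P(2) by (simp add: Q_def degree_eq_length_coeffs)
  ultimately obtain x where x: "x \<in> carrier ?L" "eval Q x = \<zero>\<^bsub>?L\<^esub>" using ambient(1) unfolding alg_closed_ring_def by blast
  have "rev (map Abs_ambient_field Q) = coeffs P" by (simp add: Q_def rev_map o_def Rep_ambient_field_inverse)
  then have "poly P (Abs_ambient_field x) = Abs_ambient_field (eval Q x)"
    using poly_eval_hom[of Abs_ambient_field, OF h(1-4) Q x(1)] by simp
  then show "\<exists>x. poly P x = 0" using x(2) h(1) by auto
qed

text \<open>By the choice of \<open>ambient\<close>, a counterexample would give one that embeds
  into it, not necessarily the given one. That one is refuted, since the estimates hold for every
  finite field embedded in an algebraically closed type.\<close>

lemma no_counterexample: "\<not> counterexample (R :: ('a, 'b) ring_scheme)"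
proof
  assume "counterexample R"
  then obtain R :: "('a, 'b) ring_scheme" and h where R: "counterexample R"
    and h: "embeds R (ambient :: ('a, 'b) universe ring) h"
    using ambient(2) by blast
  let ?L = "ambient :: ('a, 'b) universe ring" and ?H = "Abs_ambient_field :: _ \<Rightarrow> ('a, 'b) ambient_field"
  interpret L: field ?L by (rule field_ambient)
  interpret R: field R using R by (simp add: counterexample_def)
  note H = Abs_ambient_field_hom[where 'a = 'a and 'b = 'b]
  have hom: "h \<in> ring_hom R ?L" and inj: "inj_on h (carrier R)" using h by (auto simp: embeds_def)
  interpret E: finite_field_embedding R "?H \<circ> h"
  proof
    show "inj_on (?H \<circ> h) (carrier R)"
      using ring_hom_closed[OF hom] by (intro comp_inj_on inj inj_on_subset[OF H(6)]) auto
  qed (use R hom H(2-4) in \<open>auto simp: counterexample_def ring_hom_add ring_hom_mult ring_hom_one ring_hom_closed\<close>)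
  have "growth_holds R d A f" if dAf: "d \<ge> 1" "A \<subseteq> carrier R" "f \<in> carrier (poly_ring R)" for d A f
  proof (rule E.growth_holds_of_embedding[OF dAf])
    assume "has_nonzero_simple_root R f"
    then obtain r u where ru: "r \<in> carrier ?L" "set u \<subseteq> carrier ?L" "r \<noteq> \<zero>\<^bsub>?L\<^esub>" "L.eval u r \<noteq> \<zero>\<^bsub>?L\<^esub>"
      "\<And>y. y \<in> carrier ?L \<Longrightarrow> L.eval (map h f) y = (y \<ominus>\<^bsub>?L\<^esub> r) \<otimes>\<^bsub>?L\<^esub> L.eval u y"
      using h dAf(3) unfolding embeds_def by blast
    have fs: "set (map h f) \<subseteq> carrier ?L"
      using dAf(3) ring_hom_closed[OF hom] by (auto simp: univ_poly_carrier[symmetric] polynomial_def)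
    have nz: "?H x \<noteq> 0" if "x \<in> carrier ?L" "x \<noteq> \<zero>\<^bsub>?L\<^esub>" for x
      using inj_onD[OF H(6), of x "\<zero>\<^bsub>?L\<^esub>"] H(1) that by auto
    let ?U = "Poly (rev (map ?H u))"
    have U: "poly ?U (?H y) = ?H (L.eval u y)" if "y \<in> carrier ?L" for y
      by (rule L.poly_eval_hom[OF H(1-4) ru(2) that])
    have "poly (E.hpoly f) y = (y - ?H r) * poly ?U y" for y
    proof -
      obtain x where x: "x \<in> carrier ?L" "y = ?H x" using H(7) by blast
      have "poly (E.hpoly f) y = ?H (L.eval (map h f) x)"
        unfolding E.hpoly_def x(2) using L.poly_eval_hom[OF H(1-4) fs x(1)] by simp
      also have "\<dots> = (y - ?H r) * poly ?U y"
        using x ru(1,2) by (simp add: ru(5) H U L.eval_in_carrier)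
      finally show ?thesis .
    qed
    then show "\<exists>r u. r \<noteq> 0 \<and> poly u r \<noteq> 0 \<and> (\<forall>y. poly (E.hpoly f) y = (y - r) * poly u y)"
      using nz[OF ru(1,3)] nz[OF L.eval_in_carrier[OF ru(2,1)] ru(4)] U[OF ru(1)] by metis
  qed
  then show False using R by (auto simp: counterexample_def)
qed

hide_const (open) Polynomial.degree

theorem theorem2p12:
  fixes k d :: nat
  assumes "d > 0"
  shows "\<exists>c::real. c > 0 \<and>
    (\<forall>(R :: ('a, 'b) ring_scheme) A f.
      field R \<longrightarrow> finite (carrier R) \<longrightarrow> A \<subseteq> carrier R \<longrightarrow>
      f \<in> carrier (poly_ring R) \<longrightarrow> degree f = k \<longrightarrow>
      (let q = card (carrier R); p = characteristic R; fA = ring.eval R f ` A in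
        (1 < degree f \<and> degree f < p \<longrightarrow>
          real (card (nfold_sum R d A))
            \<ge> c * growth_bound q d (card A) (card (fA <+>\<^bsub>R\<^esub> A)) \<and>
          real (card (nfold_sum R d fA))
            \<ge> c * growth_bound q d (card A) (card (A <+>\<^bsub>R\<^esub> A))) \<and>
        (1 \<le> degree f \<and> degree f < p \<longrightarrow>
          real (card (nfold_prod R d A))
            \<ge> c * growth_bound q d (card A) (card (fA <+>\<^bsub>R\<^esub> A)) \<and>
          real (card (nfold_sum R d fA))
            \<ge> c * growth_bound q d (card A) (card (A <#>\<^bsub>R\<^esub> A))) \<and>
        (has_nonzero_simple_root R f \<longrightarrow>
          real (card (nfold_prod R d A))
            \<ge> c * growth_bound q d (card A) (card (fA <#>\<^bsub>R\<^esub> A)) \<and>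
          real (card (nfold_prod R d fA))
            \<ge> c * growth_bound q d (card A) (card (A <#>\<^bsub>R\<^esub> A)))))"
proof (rule exI[of _ "growth_const k d"], intro conjI[OF growth_const_pos] allI impI, goal_cases)
  case (1 R A f)
  then have "growth_holds R d A f"
    using no_counterexample[of R] assms unfolding counterexample_def by (metis One_nat_def Suc_leI)
  then show ?case unfolding growth_holds_def Let_def 1(5) .
qed

end
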